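(* Let $m\in\mathbb Z_{\ge0}$ and fix $\beta$, $1\le\beta\le n$. Define the row vector $\xi^{(m)}=(\xi^{(m)}_1,\ldots,\xi^{(m)}_n)$ by $$\xi^{(m)}=\xi^{(0)}\,A_1A_2\cdots A_m,\qquad A_j=U\Big(\Lambda+\frac{d_\beta-1}{h}+j\Big)^{-1},\quad 1\le j\le m,$$ where $\xi^{(0)}$ has components $\xi^{(0)}_\alpha=\delta_{\alpha\beta}$, $\alpha=1,\ldots,n$. Then for any $i=1,\ldots,n$ the polynomial $$q_i(x)=q_{\beta,i}(x)=\sum_{\alpha=1}^n\xi^{(m)}_\alpha\frac{\partial t^\alpha}{\partial x^i}$$ is a singular polynomial for the Dunkl operators with the parameter $c=\frac{d_\beta-1}{h}+m$. These polynomials are homogeneous of degree $d_\beta-1+hm$.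
   Context: Let $V=\mathbb C^n$ with standard basis $e_1,\ldots,e_n$, bilinear form $(e_i,e_j)=\delta_{ij}$ and coordinates $x=(x^1,\ldots,x^n)$. Let $W$ be an irreducible finite Coxeter group of rank $n$ acting on $V$ by orthogonal transformations so that $V$ is the complexified reflection representation. Let $\mathcal R\subset V$ be its root system, $\mathcal R_+$ the positive roots, normalized so that $(\gamma,\gamma)=2$, and $\gamma_i=(\gamma,e_i)$. $W$ acts on polynomials by $(wf)(x)=f(w^{-1}x)$; $\mathbb C[x]^W$ is the ring of invariants. Let $d_1\ge\ldots\ge d_n$ be the degrees of $W$ (degrees of homogeneous basic invariants); $h=d_1$ is the Coxeter number. Saito polynomials: homogeneous generators $t^1,\ldots,t^n$ of $\mathbb C[x]^W$ with $\deg t^\alpha=d_\alpha$ such that, writing $g^{\alpha\beta}=\sum_{a=1}^n\frac{\partial t^\alpha}{\partial x^a}\frac{\partial t^\beta}{\partial x^a}$ as polynomials in $t^1,\ldots,t^n$, one has $\partial_{t^1}g^{\alpha\beta}(t)=\delta_{\alpha+\beta,n+1}$ for all $1\le\alpha,\beta\le n$. Such polynomials exist; fix a choice. $U$ is the $n\times n$ matrix with entry in row $\alpha$, column $\beta$ equal to $U^\alpha_\beta=\sum_\lambda g^{\alpha\lambda}\eta_{\lambda\beta}$, where $\eta_{\lambda\beta}=\delta_{\lambda+\beta,n+1}$; i.e. $U^\alpha_\beta=g^{\alpha,n+1-\beta}$. $\Lambda=-\frac1h\mathrm{Diag}(d_1-1,\ldots,d_n-1)$. A scalar added to a matrix means that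 scalar times the identity matrix. Dunkl operators with parameter $c\in\mathbb C$: $\nabla_i=\partial_{x^i}-c\sum_{\gamma\in\mathcal R_+}\frac{\gamma_i}{(\gamma,x)}(1-s_\gamma)$, where $s_\gamma$ is the orthogonal reflection in the hyperplane $(\gamma,x)=0$. A polynomial $q(x)$ is singular (for parameter $c$) if $\nabla_iq=0$ for all $i=1,\ldots,n$. *)

theory Defs
  imports "HOL-Analysis.Analysis"
begin

text \<open>
  Since the complex field is infinite, an element of the polynomial ring in the coordinates
  \<open>x $ i\<close> is identified with the function it induces. The zero polynomial is homogeneous of
  every degree.
\<close>

definition monomial_fun :: "('n::finite \<Rightarrow> nat) \<Rightarrow> complex^'n \<Rightarrow> complex" where
  "monomial_fun a x = (\<Prod>i\<in>UNIV. x $ i ^ a i)"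

definition is_poly :: "(complex^'n::finite \<Rightarrow> complex) \<Rightarrow> bool" where
  "is_poly f \<longleftrightarrow> (\<exists>A c. finite A \<and> f = (\<lambda>x. \<Sum>a\<in>A. c a * monomial_fun a x))"

definition homogeneous :: "nat \<Rightarrow> (complex^'n::finite \<Rightarrow> complex) \<Rightarrow> bool" where
  "homogeneous k f \<longleftrightarrow>
     (\<exists>A c. finite A \<and> (\<forall>a\<in>A. (\<Sum>i\<in>UNIV. a i) = k) \<and>
            f = (\<lambda>x. \<Sum>a\<in>A. c a * monomial_fun a x))"

definition partial :: "'n::finite \<Rightarrow> (complex^'n \<Rightarrow> complex) \<Rightarrow> complex^'n \<Rightarrow> complex" where
  "partial i f x = deriv (\<lambda>z. f (x + axis i z)) 0"

definition refl_matrix :: "real^'n \<Rightarrow> real^'n^'n::finite" where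
  "refl_matrix a = matrix (\<lambda>y. y - (2 * (a \<bullet> y) / (a \<bullet> a)) *\<^sub>R a)"

text \<open>Reflections are involutions, so the monoid they generate is a group.\<close>

inductive_set reflection_group :: "(real^'n) set \<Rightarrow> (real^'n^'n::finite) set"
  for S :: "(real^'n) set" where
  one: "mat 1 \<in> reflection_group S"
| refl: "w \<in> reflection_group S \<Longrightarrow> a \<in> S \<Longrightarrow> refl_matrix a ** w \<in> reflection_group S"

definition roots :: "(real^'n^'n::finite) set \<Rightarrow> (real^'n) set" where
  "roots W = {\<gamma>. \<gamma> \<bullet> \<gamma> = 2 \<and> refl_matrix \<gamma> \<in> W}"

text \<open>
  The spanning condition says that the rank of \<open>W\<close> is the dimension of the space, the last
  condition that the Coxeter graph of \<open>W\<close> is connected.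
\<close>

definition irreducible_coxeter_group :: "(real^'n^'n::finite) set \<Rightarrow> bool" where
  "irreducible_coxeter_group W \<longleftrightarrow>
     finite W \<and>
     (\<exists>S. 0 \<notin> S \<and> W = reflection_group S) \<and>
     span (roots W) = UNIV \<and>
     (\<nexists>R1 R2. R1 \<noteq> {} \<and> R2 \<noteq> {} \<and> R1 \<union> R2 = roots W \<and>
              (\<forall>\<gamma>\<in>R1. \<forall>\<delta>\<in>R2. \<gamma> \<bullet> \<delta> = 0))"

definition positive_system :: "(real^'n^'n::finite) set \<Rightarrow> (real^'n) set \<Rightarrow> bool" where
  "positive_system W P \<longleftrightarrow>
     (\<exists>v. (\<forall>\<gamma>\<in>roots W. v \<bullet> \<gamma> \<noteq> 0) \<and> P = {\<gamma>\<in>roots W. v \<bullet> \<gamma> > 0})"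

definition act :: "real^'n^'n::finite \<Rightarrow> (complex^'n \<Rightarrow> complex) \<Rightarrow> complex^'n \<Rightarrow> complex" where
  "act w f x = f (map_matrix complex_of_real (matrix_inv w) *v x)"

definition invariant_poly :: "(real^'n^'n::finite) set \<Rightarrow> (complex^'n \<Rightarrow> complex) \<Rightarrow> bool" where
  "invariant_poly W f \<longleftrightarrow> is_poly f \<and> (\<forall>w\<in>W. act w f = f)"

definition root_form :: "real^'n::finite \<Rightarrow> complex^'n \<Rightarrow> complex" where
  "root_form \<gamma> x = (\<Sum>i\<in>UNIV. complex_of_real (\<gamma> $ i) * x $ i)"

text \<open>
  The polynomial \<open>(1 - s\<^sub>\<gamma>) f / (\<gamma>, x)\<close>. Pointwise division would give the wrong value
  on the hyperplane, where Isabelle has \<open>x / 0 = 0\<close>; existence and uniqueness of the quotient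
  are proved below.
\<close>

definition divided_difference ::
    "real^'n::finite \<Rightarrow> (complex^'n \<Rightarrow> complex) \<Rightarrow> complex^'n \<Rightarrow> complex" where
  "divided_difference \<gamma> f =
     (THE p. is_poly p \<and> (\<forall>x. root_form \<gamma> x * p x = f x - act (refl_matrix \<gamma>) f x))"

definition dunkl ::
    "(real^'n::finite) set \<Rightarrow> complex \<Rightarrow> 'n \<Rightarrow> (complex^'n \<Rightarrow> complex) \<Rightarrow> complex^'n \<Rightarrow> complex" where
  "dunkl P c i f x =
     partial i f x - c * (\<Sum>\<gamma>\<in>P. complex_of_real (\<gamma> $ i) * divided_difference \<gamma> f x)"

definition singular_poly :: "(real^'n::finite) set \<Rightarrow> complex \<Rightarrow> (complex^'n \<Rightarrow> complex) \<Rightarrow> bool" where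
  "singular_poly P c q \<longleftrightarrow> is_poly q \<and> (\<forall>i x. dunkl P c i q x = 0)"

lemma is_poly_zero: "is_poly (\<lambda>x. 0)"
  unfolding is_poly_def by (rule exI[of _ "{}"]) simp

lemma is_poly_monomial: "is_poly (\<lambda>x. k * monomial_fun a x)"
  unfolding is_poly_def by (rule exI[of _ "{a}"], rule exI[of _ "\<lambda>_. k"]) simp

lemma is_poly_add:
  assumes "is_poly f" "is_poly g"
  shows "is_poly (\<lambda>x. f x + g x)"
proof -
  obtain A c where A: "finite A" "f = (\<lambda>x. \<Sum>a\<in>A. c a * monomial_fun a x)"
    using assms(1) unfolding is_poly_def by blast
  obtain B d where B: "finite B" "g = (\<lambda>x. \<Sum>a\<in>B. d a * monomial_fun a x)"
    using assms(2) unfolding is_poly_def by blast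
  define c' where "c' a = (if a \<in> A then c a else 0)" for a
  define d' where "d' a = (if a \<in> B then d a else 0)" for a
  have "f x = (\<Sum>a\<in>A \<union> B. c' a * monomial_fun a x)" for x
    unfolding A(2) c'_def by (rule sum.mono_neutral_cong_left) (use A(1) B(1) in auto)
  moreover have "g x = (\<Sum>a\<in>A \<union> B. d' a * monomial_fun a x)" for x
    unfolding B(2) d'_def by (rule sum.mono_neutral_cong_left) (use A(1) B(1) in auto)
  ultimately have "(\<lambda>x. f x + g x) = (\<lambda>x. \<Sum>a\<in>A \<union> B. (c' a + d' a) * monomial_fun a x)"
    by (simp only: distrib_right sum.distrib)
  then show ?thesis
    unfolding is_poly_def using A(1) B(1)
    by (intro exI[of _ "A \<union> B"] exI[of _ "\<lambda>a. c' a + d' a"]) simp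
qed

lemma is_poly_sum: "(\<And>i. i \<in> I \<Longrightarrow> is_poly (f i)) \<Longrightarrow> is_poly (\<lambda>x. \<Sum>i\<in>I. f i x)"
proof (induction I rule: infinite_finite_induct)
  case (insert j I)
  have "is_poly (\<lambda>x. f j x + (\<Sum>i\<in>I. f i x))"
    by (rule is_poly_add) (use insert in auto)
  then show ?case
    by (simp only: sum.insert[OF insert.hyps])
qed (simp_all add: is_poly_zero)

lemma monomial_fun_mult: "monomial_fun a x * monomial_fun b x = monomial_fun (\<lambda>i. a i + b i) x"
  by (simp add: monomial_fun_def power_add prod.distrib)

lemma is_poly_mult:
  assumes "is_poly f" "is_poly g"
  shows "is_poly (\<lambda>x. f x * g x)"
proof -
  obtain A c where A: "finite A" "f = (\<lambda>x. \<Sum>a\<in>A. c a * monomial_fun a x)"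
    using assms(1) unfolding is_poly_def by blast
  obtain B d where B: "finite B" "g = (\<lambda>x. \<Sum>a\<in>B. d a * monomial_fun a x)"
    using assms(2) unfolding is_poly_def by blast
  have "(\<lambda>x. f x * g x) =
      (\<lambda>x. \<Sum>a\<in>A. \<Sum>b\<in>B. (c a * d b) * monomial_fun (\<lambda>i. a i + b i) x)"
    unfolding A(2) B(2) by (simp add: sum_product monomial_fun_mult[symmetric] mult_ac)
  then show ?thesis
    by (simp only:) (intro is_poly_sum is_poly_monomial)
qed

lemma is_poly_const: "is_poly (\<lambda>x. k)"
  using is_poly_monomial[of k "\<lambda>_. 0"] by (simp add: monomial_fun_def)

lemma is_poly_coord:
  fixes j :: "'n::finite"
  shows "is_poly (\<lambda>x. x $ j)"
proof -
  have "monomial_fun (\<lambda>i. if i = j then 1 else 0) x = x $ j" for x :: "complex^'n"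
    unfolding monomial_fun_def by (simp add: if_distrib[of "\<lambda>k. _ ^ k"] prod.delta cong: if_cong)
  then show ?thesis
    using is_poly_monomial[of 1 "\<lambda>i. if i = j then 1 else 0"] by simp
qed

lemma is_poly_diff: "is_poly f \<Longrightarrow> is_poly g \<Longrightarrow> is_poly (\<lambda>x. f x - g x)"
  using is_poly_add[of f "\<lambda>x. (-1) * g x"] is_poly_mult[OF is_poly_const[of "-1"], of g] by simp

lemma is_poly_induct [consumes 1, case_names const coord add mult]:
  fixes f :: "complex^'n::finite \<Rightarrow> complex"
  assumes "is_poly f"
    and const: "\<And>k. Q (\<lambda>x. k)"
    and coord: "\<And>i. Q (\<lambda>x. x $ i)"
    and add: "\<And>f g. is_poly f \<Longrightarrow> is_poly g \<Longrightarrow> Q f \<Longrightarrow> Q g \<Longrightarrow> Q (\<lambda>x. f x + g x)"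
    and mult: "\<And>f g. is_poly f \<Longrightarrow> is_poly g \<Longrightarrow> Q f \<Longrightarrow> Q g \<Longrightarrow> Q (\<lambda>x. f x * g x)"
  shows "Q f"
proof -
  define Q' where "Q' f \<longleftrightarrow> is_poly f \<and> Q f" for f
  have k: "Q' (\<lambda>x. k)" for k
    unfolding Q'_def by (intro conjI const is_poly_const)
  have c: "Q' (\<lambda>x. x $ i)" for i
    unfolding Q'_def by (intro conjI coord is_poly_coord)
  have a: "Q' (\<lambda>x. f x + g x)" if "Q' f" "Q' g" for f g
    using that unfolding Q'_def by (elim conjE, intro conjI is_poly_add add)
  have m: "Q' (\<lambda>x. f x * g x)" if "Q' f" "Q' g" for f g
    using that unfolding Q'_def by (elim conjE, intro conjI is_poly_mult mult)
  have pw: "Q' (\<lambda>x. x $ i ^ e)" for i e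
  proof (induction e)
    case 0
    show ?case using k[of 1] by simp
  next
    case (Suc e)
    show ?case unfolding power_Suc by (rule m[OF c Suc.IH])
  qed
  have pr: "Q' (\<lambda>x. \<Prod>i\<in>I. x $ i ^ b i)" if "finite I" for I and b :: "'n \<Rightarrow> nat"
    using that
  proof induction
    case empty
    show ?case using k[of 1] by simp
  next
    case (insert j I)
    show ?case unfolding prod.insert[OF insert.hyps] by (rule m[OF pw insert.IH])
  qed
  have su: "Q' (\<lambda>x. \<Sum>a\<in>A. d a * monomial_fun a x)" if "finite A" for A d
    using that
  proof induction
    case empty
    show ?case using k[of 0] by simp
  next
    case (insert b A)
    have "Q' (\<lambda>x. d b * monomial_fun b x)"
      unfolding monomial_fun_def by (rule m[OF k pr[OF finite]])
    from a[OF this insert.IH] show ?case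
      unfolding sum.insert[OF insert.hyps] .
  qed
  obtain A d where "finite A" "f = (\<lambda>x. \<Sum>a\<in>A. d a * monomial_fun a x)"
    using assms(1) unfolding is_poly_def by blast
  with su[of A d] show ?thesis
    unfolding Q'_def by simp
qed

lemma is_poly_continuous: "is_poly f \<Longrightarrow> continuous_on UNIV f"
  by (induction f rule: is_poly_induct) (auto intro!: continuous_intros)

lemma refl_matrix_mult: "refl_matrix \<gamma> *v y = y - (2 * (\<gamma> \<bullet> y) / (\<gamma> \<bullet> \<gamma>)) *\<^sub>R \<gamma>"
proof -
  have "linear (\<lambda>y. y - (2 * (\<gamma> \<bullet> y) / (\<gamma> \<bullet> \<gamma>)) *\<^sub>R \<gamma>)"
    by (rule linearI) (simp_all add: inner_add_right ring_distribs add_divide_distrib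
        scaleR_add_left scaleR_diff_right)
  then show ?thesis
    by (simp add: refl_matrix_def matrix_works)
qed

lemma matrix_inv_refl_matrix:
  assumes "\<gamma> \<bullet> \<gamma> = 2"
  shows "matrix_inv (refl_matrix \<gamma>) = refl_matrix \<gamma>"
proof -
  have "refl_matrix \<gamma> ** refl_matrix \<gamma> = mat 1"
    unfolding matrix_eq
    by (simp add: matrix_vector_mul_assoc[symmetric] refl_matrix_mult assms inner_diff_right)
  moreover from this have "\<exists>B. refl_matrix \<gamma> ** B = mat 1 \<and> B ** refl_matrix \<gamma> = mat 1"
    by blast
  then have "refl_matrix \<gamma> ** matrix_inv (refl_matrix \<gamma>) = mat 1"
    unfolding matrix_inv_def by (rule someI2_ex) simp
  ultimately show ?thesis
    by (metis matrix_mul_assoc matrix_mul_lid matrix_mul_rid)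
qed

lemma act_refl_matrix:
  assumes "\<gamma> \<bullet> \<gamma> = 2"
  shows "act (refl_matrix \<gamma>) f x = f (\<chi> i. x $ i - root_form \<gamma> x * complex_of_real (\<gamma> $ i))"
proof -
  have *: "refl_matrix \<gamma> $ i $ j = (if i = j then 1 else 0) - \<gamma> $ j * \<gamma> $ i" for i j
  proof -
    have "refl_matrix \<gamma> $ i $ j = (refl_matrix \<gamma> *v axis j 1) $ i"
      by (simp add: matrix_vector_mult_basis column_def)
    then show ?thesis
      by (simp add: refl_matrix_mult assms inner_axis) (simp add: axis_def)
  qed
  have "(map_matrix complex_of_real (refl_matrix \<gamma>) *v x) $ i =
      x $ i - root_form \<gamma> x * complex_of_real (\<gamma> $ i)" for i
  proof -
    have "(map_matrix complex_of_real (refl_matrix \<gamma>) *v x) $ i =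
      (\<Sum>j\<in>UNIV. (if i = j then x $ j else 0) - complex_of_real (\<gamma> $ j) * x $ j * complex_of_real (\<gamma> $ i))"
      unfolding matrix_vector_mult_def by (auto simp: * algebra_simps intro!: sum.cong)
    then show ?thesis
      by (simp add: sum_subtractf root_form_def sum_distrib_right)
  qed
  then have "map_matrix complex_of_real (refl_matrix \<gamma>) *v x =
      (\<chi> i. x $ i - root_form \<gamma> x * complex_of_real (\<gamma> $ i))"
    by (simp add: vec_eq_iff)
  then show ?thesis
    by (simp only: act_def matrix_inv_refl_matrix[OF assms])
qed

lemma divided_difference_exists:
  assumes "\<gamma> \<bullet> \<gamma> = 2" and "is_poly f"
  shows "is_poly (act (refl_matrix \<gamma>) f) \<and>
    (\<exists>p. is_poly p \<and> (\<forall>x. root_form \<gamma> x * p x = f x - act (refl_matrix \<gamma>) f x))"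
  using assms(2)
proof (induction f rule: is_poly_induct)
  case (const k)
  then show ?case
    using is_poly_const[of k] is_poly_zero by (auto simp: act_def[abs_def])
next
  case (coord i)
  have "is_poly (root_form \<gamma>)"
    unfolding root_form_def[abs_def] by (intro is_poly_sum is_poly_mult is_poly_const is_poly_coord)
  then show ?case
    by (auto simp: act_refl_matrix[OF assms(1), abs_def]
        intro!: is_poly_diff is_poly_mult is_poly_const is_poly_coord exI[of _ "\<lambda>_. complex_of_real (\<gamma> $ i)"])
next
  case (add f g)
  let ?s = "act (refl_matrix \<gamma>)"
  obtain p q where "is_poly p" "is_poly q"
    "\<And>x. root_form \<gamma> x * p x = f x - ?s f x" "\<And>x. root_form \<gamma> x * q x = g x - ?s g x"
    using add by blast
  then have "is_poly (\<lambda>x. p x + q x) \<and>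
      (\<forall>x. root_form \<gamma> x * (p x + q x) = (f x + g x) - ?s (\<lambda>x. f x + g x) x)"
    by (auto simp: distrib_left is_poly_add) (simp add: act_def)
  moreover have "is_poly (?s (\<lambda>x. f x + g x))"
    using is_poly_add[of "?s f" "?s g"] add by (simp add: act_def[abs_def])
  ultimately show ?case by blast
next
  case (mult f g)
  let ?s = "act (refl_matrix \<gamma>)"
  obtain p q where pq: "is_poly p" "is_poly q"
    "\<And>x. root_form \<gamma> x * p x = f x - ?s f x" "\<And>x. root_form \<gamma> x * q x = g x - ?s g x"
    using mult by blast
  have "root_form \<gamma> x * (p x * g x + ?s f x * q x) = f x * g x - ?s (\<lambda>x. f x * g x) x" for x
  proof -
    have "root_form \<gamma> x * (p x * g x + ?s f x * q x) =
        (root_form \<gamma> x * p x) * g x + ?s f x * (root_form \<gamma> x * q x)"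
      by (simp add: algebra_simps)
    also have "\<dots> = f x * g x - ?s f x * ?s g x"
      unfolding pq by (simp add: algebra_simps)
    finally show ?thesis
      by (simp add: act_def)
  qed
  moreover have "is_poly (\<lambda>x. p x * g x + ?s f x * q x)"
    using mult pq by (intro is_poly_add is_poly_mult) auto
  moreover have "is_poly (?s (\<lambda>x. f x * g x))"
    using is_poly_mult[of "?s f" "?s g"] mult by (simp add: act_def[abs_def])
  ultimately show ?case by blast
qed

lemma root_form_cancel:
  fixes \<gamma> :: "real^'n::finite"
  assumes "\<gamma> \<bullet> \<gamma> = 2" "is_poly p" "is_poly q" "\<And>x. root_form \<gamma> x * p x = root_form \<gamma> x * q x"
  shows "p = q"
proof
  fix x :: "complex^'n"
  define l where "l z = (\<chi> i. x $ i + z * complex_of_real (\<gamma> $ i))" for z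
  have l0: "l 0 = x"
    by (simp add: l_def vec_eq_iff)
  have rl: "root_form \<gamma> (l z) = root_form \<gamma> x + z * 2" for z
  proof -
    have "(\<Sum>i\<in>UNIV. complex_of_real (\<gamma> $ i) * complex_of_real (\<gamma> $ i)) = 2"
      using arg_cong[OF assms(1), of complex_of_real] by (simp add: inner_vec_def)
    then have "(\<Sum>i\<in>UNIV. z * (complex_of_real (\<gamma> $ i) * complex_of_real (\<gamma> $ i))) = z * 2"
      by (simp only: sum_distrib_left[symmetric])
    then show ?thesis
      by (simp add: root_form_def l_def distrib_left sum.distrib mult_ac)
  qed
  define u where "u z = p (l z) - q (l z)" for z
  have cl: "continuous_on UNIV l"
    unfolding l_def[abs_def] by (intro continuous_intros)
  have "continuous_on UNIV u"
    unfolding u_def[abs_def]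
    by (intro continuous_intros continuous_on_compose2[OF is_poly_continuous cl] assms) auto
  then have "(u \<longlongrightarrow> u 0) (at 0)"
    by (simp add: continuous_on_eq_continuous_at isCont_def)
  moreover have "(u \<longlongrightarrow> 0) (at 0)"
  proof (rule tendsto_eventually)
    show "eventually (\<lambda>z. u z = 0) (at 0)"
    proof (cases "root_form \<gamma> x = 0")
      case True
      have "u z = 0" if "z \<noteq> 0" for z
        using assms(4)[of "l z"] rl[of z] True that by (simp add: u_def)
      then show ?thesis
        by (simp add: eventually_at_filter)
    next
      case False
      have "((\<lambda>z. root_form \<gamma> x + z * 2) \<longlongrightarrow> root_form \<gamma> x + 0 * 2) (at 0)"
        by (intro tendsto_intros)
      then have "eventually (\<lambda>z. root_form \<gamma> x + z * 2 \<noteq> 0) (at 0)"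
        using False by (intro tendsto_imp_eventually_ne) auto
      then show ?thesis
      proof eventually_elim
        case (elim z)
        then show ?case
          using assms(4)[of "l z"] rl[of z] by (simp add: u_def)
      qed
    qed
  qed
  ultimately have "u 0 = 0"
    by (rule tendsto_unique[OF trivial_limit_at])
  then show "p x = q x"
    by (simp add: u_def l0)
qed

lemma divided_difference_unique:
  assumes "\<gamma> \<bullet> \<gamma> = 2" and "is_poly f"
  shows "\<exists>!p. is_poly p \<and> (\<forall>x. root_form \<gamma> x * p x = f x - act (refl_matrix \<gamma>) f x)"
proof -
  obtain p where "is_poly p" "\<And>x. root_form \<gamma> x * p x = f x - act (refl_matrix \<gamma>) f x"
    using divided_difference_exists[OF assms] by blast
  then show ?thesis
    by (intro ex1I[of _ p]) (auto intro!: root_form_cancel[OF assms(1)])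
qed

lemma divided_difference:
  assumes "\<gamma> \<bullet> \<gamma> = 2" and "is_poly f"
  shows "is_poly (divided_difference \<gamma> f)"
    and "root_form \<gamma> x * divided_difference \<gamma> f x = f x - act (refl_matrix \<gamma>) f x"
  using theI'[OF divided_difference_unique[OF assms]] by (auto simp: divided_difference_def)

type_synonym 'n rmat = "real^'n^'n"
type_synonym 'n cvec = "complex^'n"
type_synonym 'n cmat = "complex^'n^'n"

text \<open>
  The index type is finite and linearly ordered; \<open>idx\<close> identifies it with \<open>{1..n}\<close>, and
  \<open>Min UNIV\<close> is the index 1.
\<close>

definition idx :: "'n::{finite,linorder} \<Rightarrow> nat" where
  "idx \<alpha> = card {\<beta>. \<beta> \<le> \<alpha>}"

definition eta :: "'n::{finite,linorder} cmat" where
  "eta = (\<chi> \<alpha> \<beta>. if idx \<alpha> + idx \<beta> = CARD('n) + 1 then 1 else 0)"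

definition metric_g ::
    "('n::finite \<Rightarrow> 'n cvec \<Rightarrow> complex) \<Rightarrow> 'n cvec \<Rightarrow> 'n cmat" where
  "metric_g t x = (\<chi> \<alpha> \<beta>. \<Sum>a\<in>UNIV. partial a (t \<alpha>) x * partial a (t \<beta>) x)"

definition basic_invariants ::
    "'n::finite rmat set \<Rightarrow> ('n \<Rightarrow> nat) \<Rightarrow> ('n \<Rightarrow> 'n cvec \<Rightarrow> complex) \<Rightarrow> bool" where
  "basic_invariants W d t \<longleftrightarrow>
     (\<forall>\<alpha>. invariant_poly W (t \<alpha>) \<and> homogeneous (d \<alpha>) (t \<alpha>)) \<and>
     (\<forall>f. invariant_poly W f \<longrightarrow> (\<exists>F. is_poly F \<and> f = (\<lambda>x. F (\<chi> \<alpha>. t \<alpha> x))))"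

text \<open>
  In the last clause \<open>G\<close> is the expression of \<open>g\<^sup>\<alpha>\<^sup>\<beta>\<close> as a polynomial in
  \<open>t\<close>; it is unique because the basic invariants are algebraically independent.
\<close>

definition saito_polynomials ::
    "'n::{finite,linorder} rmat set \<Rightarrow> ('n \<Rightarrow> nat) \<Rightarrow> ('n \<Rightarrow> 'n cvec \<Rightarrow> complex) \<Rightarrow> bool" where
  "saito_polynomials W d t \<longleftrightarrow>
     antimono d \<and> basic_invariants W d t \<and>
     (\<forall>\<alpha> \<beta>. \<exists>G. is_poly G \<and> (\<forall>x. metric_g t x $ \<alpha> $ \<beta> = G (\<chi> \<mu>. t \<mu> x)) \<and>
                  (\<forall>y. partial (Min UNIV) G y = eta $ \<alpha> $ \<beta>))"

definition coxeter_number :: "('n::{finite,linorder} \<Rightarrow> nat) \<Rightarrow> nat" where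
  "coxeter_number d = d (Min UNIV)"

definition U_matrix ::
    "('n::{finite,linorder} \<Rightarrow> 'n cvec \<Rightarrow> complex) \<Rightarrow> 'n cvec \<Rightarrow> 'n cmat" where
  "U_matrix t x = metric_g t x ** eta"

definition Lambda_matrix :: "('n::{finite,linorder} \<Rightarrow> nat) \<Rightarrow> 'n cmat" where
  "Lambda_matrix d =
     (\<chi> \<alpha> \<beta>. if \<alpha> = \<beta> then - (of_nat (d \<alpha>) - 1) / of_nat (coxeter_number d) else 0)"

definition A_matrix ::
    "('n::{finite,linorder} \<Rightarrow> nat) \<Rightarrow> ('n \<Rightarrow> 'n cvec \<Rightarrow> complex) \<Rightarrow> 'n \<Rightarrow> nat \<Rightarrow>
      'n cvec \<Rightarrow> 'n cmat" where
  "A_matrix d t \<beta> j x =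
     U_matrix t x **
     matrix_inv (Lambda_matrix d + mat ((of_nat (d \<beta>) - 1) / of_nat (coxeter_number d)) + mat (of_nat j))"

primrec xi ::
    "('n::{finite,linorder} \<Rightarrow> nat) \<Rightarrow> ('n \<Rightarrow> 'n cvec \<Rightarrow> complex) \<Rightarrow> 'n \<Rightarrow> nat \<Rightarrow>
      'n cvec \<Rightarrow> 'n cvec" where
  "xi d t \<beta> 0 x = axis \<beta> 1"
| "xi d t \<beta> (Suc m) x = xi d t \<beta> m x v* A_matrix d t \<beta> (Suc m) x"

definition q_poly ::
    "('n::{finite,linorder} \<Rightarrow> nat) \<Rightarrow> ('n \<Rightarrow> 'n cvec \<Rightarrow> complex) \<Rightarrow> nat \<Rightarrow> 'n \<Rightarrow> 'n \<Rightarrow>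
      'n cvec \<Rightarrow> complex" where
  "q_poly d t m \<beta> i x = (\<Sum>\<alpha>\<in>UNIV. xi d t \<beta> m x $ \<alpha> * partial i (t \<alpha>) x)"

end

theory Submission
  imports Defs "HOL-Computational_Algebra.Fundamental_Theorem_Algebra"
begin

text \<open>
  Averaging over the group produces invariants with prescribed 2-jets at generic points. As the
  \<open>t\<^sup>\<alpha>\<close> generate all invariants, the quotient of their Jacobian determinant by
  \<open>Delta = \<Prod>\<^sub>\<gamma> (\<gamma>, x)\<close> has no zero outside codimension two, so it is constant. Cramer's rule then
  makes the Christoffel symbols of \<open>g\<close> polynomials in \<open>t\<close>. The metric is linear in \<open>t\<^sup>1\<close> with
  constant derivative \<open>\<eta>\<close>. Comparing coefficients of \<open>t\<^sup>1\<close> in the vanishing of torsion and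
  curvature, and using homogeneity, one finds that the symbols are \<open>\<nu>\<^sub>\<beta> c\<^sup>\<alpha>\<^sup>\<beta>\<^sub>\<gamma>\<close> with
  \<open>\<nu>\<^sub>\<beta> = (d\<^sub>\<beta> - 1) / h\<close> and \<open>c\<close> totally symmetric after raising an index with \<open>\<eta>\<close>.

  In the coordinates \<open>x\<close> the tensor \<open>c\<close> is \<open>D\<^sub>i\<^sub>j\<^sub>k = \<Sum>\<^sub>\<gamma> \<gamma>\<^sub>i \<gamma>\<^sub>j \<gamma>\<^sub>k / (\<gamma>, x)\<close>: it has simple poles on
  the hyperplanes, symmetry determines the residues up to a factor, and the trace of \<open>c\<close> is
  \<open>2 \<partial>\<^sub>i log Delta\<close>. For \<open>q = \<Sum>\<^sub>\<alpha> \<xi>\<^sub>\<alpha> dt\<^sup>\<alpha>\<close> with invariant \<open>\<xi>\<close>, singularity with parameter \<open>k\<close>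
  means \<open>\<partial>\<^sub>i q\<^sub>j = k \<Sum>\<^sub>l D\<^sub>i\<^sub>j\<^sub>l q\<^sub>l\<close>. This holds for \<open>dt\<^sup>\<beta>\<close> with \<open>k = \<nu>\<^sub>\<beta>\<close>, and the recursion for
  \<open>\<xi>\<close> raises \<open>k\<close> by one.
\<close>

section \<open>Polynomial functions\<close>

text \<open>\<open>basic_invariants\<close> only says that the \<open>t\<close> generate the
  invariants. Algebraic independence, the factorization of the Jacobian and the count of the
  positive roots must be extracted from that; testing generation on averaged polynomials does it.
  Quotients have poles on the hyperplanes, so identities are proved where \<open>Delta\<close> is
  nonzero, hence \<open>J\<close> invertible, and extended as identities of polynomials. Degrees are
  eigenvalues of the Euler field and may become negative; a polynomial with a negative eigenvalue is
  zero. This removes the second \<open>t one\<close>-derivatives of the Christoffel symbols and the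
  polynomial remainder of the tensor. The shift of the parameter rests on one numerical coincidence.
  The derivative of a coefficient carries the factor \<open>nu b + m - nu a\<close>, and the Hessian
  of \<open>t a\<close> adds \<open>nu a\<close>. In the next step the derivative of the metric adds
  \<open>nu a + nu (star r) = nu a + 1 - nu r\<close>, which gives
  \<open>nu b + (m + 1) - nu r\<close>: exactly the diagonal entry that \<open>A_matrix\<close>
  inverts.\<close>

lemma is_poly_prod: "(\<And>i. i \<in> I \<Longrightarrow> is_poly (f i)) \<Longrightarrow> is_poly (\<lambda>x. \<Prod>i\<in>I. f i x)"
proof (induction I rule: infinite_finite_induct)
  case (insert j I)
  have "is_poly (\<lambda>x. f j x * (\<Prod>i\<in>I. f i x))"
    by (rule is_poly_mult) (use insert in auto)
  then show ?case
    by (simp only: prod.insert[OF insert.hyps])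
qed (simp_all add: is_poly_const)

lemma is_poly_power: "is_poly f \<Longrightarrow> is_poly (\<lambda>x. f x ^ n)"
  by (induction n) (auto intro: is_poly_const is_poly_mult)

lemma is_poly_cmult: "is_poly f \<Longrightarrow> is_poly (\<lambda>x. k * f x)"
  by (intro is_poly_mult is_poly_const)

lemma is_poly_divide: "is_poly f \<Longrightarrow> is_poly (\<lambda>x. f x / k)"
  using is_poly_cmult[of f "inverse k"] by (simp add: field_simps)

lemma is_poly_root_form: "is_poly (root_form \<gamma>)"
  unfolding root_form_def[abs_def] by (intro is_poly_sum is_poly_mult is_poly_const is_poly_coord)

lemma is_poly_det:
  "(\<And>i j. is_poly (\<lambda>x. M x $ i $ j)) \<Longrightarrow> is_poly (\<lambda>x. det (M x))"
  unfolding det_def by (intro is_poly_sum is_poly_mult is_poly_const is_poly_prod)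

lemmas is_poly_intros = is_poly_zero is_poly_const is_poly_coord is_poly_add is_poly_diff is_poly_mult
  is_poly_sum is_poly_prod is_poly_power is_poly_root_form is_poly_divide

lemma is_poly_compose:
  assumes "is_poly F" "\<And>\<alpha>. is_poly (u \<alpha>)"
  shows "is_poly (\<lambda>x. F (\<chi> \<alpha>. u \<alpha> x))"
  using assms(1) by (induction F rule: is_poly_induct) (auto intro: is_poly_intros assms(2))

lemma partial_differentiable:
  assumes "is_poly f"
  shows "(\<lambda>z. f (x + axis i z)) field_differentiable at z"
  using assms
proof (induction f rule: is_poly_induct)
  case (coord j)
  show ?case
    by (cases "j = i") (auto simp: axis_def intro!: derivative_intros)
qed (auto intro: field_differentiable_add field_differentiable_mult)

lemma has_partial:
  "is_poly f \<Longrightarrow> ((\<lambda>z. f (x + axis i z)) has_field_derivative partial i f x) (at 0)"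
  unfolding partial_def using partial_differentiable DERIV_deriv_iff_field_differentiable by blast

lemma axis_zero [simp]: "axis i 0 = 0"
  by (simp add: vec_eq_iff axis_def)

lemma partial_const: "partial i (\<lambda>x. k) = (\<lambda>x. 0)"
  by (simp add: partial_def fun_eq_iff)

lemma partial_coord: "partial i (\<lambda>x. x $ j) = (\<lambda>x. if i = j then 1 else 0)"
proof
  fix x :: "complex^'a"
  have "((\<lambda>z. (x + axis i z) $ j) has_field_derivative (if i = j then 1 else 0)) (at 0)"
    by (auto simp: axis_def intro!: derivative_eq_intros)
  then show "partial i (\<lambda>x. x $ j) x = (if i = j then 1 else 0)"
    unfolding partial_def by (rule DERIV_imp_deriv)
qed

lemma partial_add:
  assumes "is_poly f" "is_poly g"
  shows "partial i (\<lambda>x. f x + g x) = (\<lambda>x. partial i f x + partial i g x)"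
proof
  fix x
  show "partial i (\<lambda>x. f x + g x) x = partial i f x + partial i g x"
    unfolding partial_def[of _ "\<lambda>x. f x + g x"]
    by (rule DERIV_imp_deriv) (intro DERIV_add has_partial assms)
qed

lemma partial_mult:
  assumes "is_poly f" "is_poly g"
  shows "partial i (\<lambda>x. f x * g x) = (\<lambda>x. partial i f x * g x + f x * partial i g x)"
proof
  fix x
  have "((\<lambda>z. f (x + axis i z) * g (x + axis i z)) has_field_derivative
     partial i f x * g (x + axis i 0) + partial i g x * f (x + axis i 0)) (at 0)"
    by (intro DERIV_mult has_partial assms)
  then show "partial i (\<lambda>x. f x * g x) x = partial i f x * g x + f x * partial i g x"
    unfolding partial_def[of _ "\<lambda>x. f x * g x"]
    by (intro DERIV_imp_deriv) (simp add: mult.commute)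
qed

lemma partial_cmult: "is_poly f \<Longrightarrow> partial i (\<lambda>x. k * f x) = (\<lambda>x. k * partial i f x)"
  by (simp add: partial_mult is_poly_const partial_const)

lemma partial_divide: "is_poly f \<Longrightarrow> partial i (\<lambda>x. f x / k) = (\<lambda>x. partial i f x / k)"
  using partial_cmult[of f i "inverse k"] by (simp add: field_simps)

lemma partial_diff:
  assumes "is_poly f" "is_poly g"
  shows "partial i (\<lambda>x. f x - g x) = (\<lambda>x. partial i f x - partial i g x)"
  using partial_add[OF assms(1) is_poly_cmult[OF assms(2), of "-1"]] partial_cmult[OF assms(2), of i "-1"]
  by simp

lemma partial_sum:
  "(\<And>a. a \<in> A \<Longrightarrow> is_poly (f a)) \<Longrightarrow>
    partial i (\<lambda>x. \<Sum>a\<in>A. f a x) = (\<lambda>x. \<Sum>a\<in>A. partial i (f a) x)"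
proof (induction A rule: infinite_finite_induct)
  case (insert b A)
  have "partial i (\<lambda>x. f b x + (\<Sum>a\<in>A. f a x)) =
      (\<lambda>x. partial i (f b) x + partial i (\<lambda>x. \<Sum>a\<in>A. f a x) x)"
    by (rule partial_add) (use insert.prems in \<open>auto intro: is_poly_sum\<close>)
  then show ?case
    using insert by simp
qed (simp_all add: partial_const)

text \<open>The differentiated factor is marked by an \<open>if\<close> instead of being split off,
  so that the products in a determinant turn into those of determinants with one replaced
  row.\<close>

lemma partial_prod:
  "finite A \<Longrightarrow> (\<And>a. a \<in> A \<Longrightarrow> is_poly (f a)) \<Longrightarrow>
    partial i (\<lambda>x. \<Prod>a\<in>A. f a x) =
      (\<lambda>x. \<Sum>b\<in>A. \<Prod>a\<in>A. if a = b then partial i (f a) x else f a x)"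
proof (induction A rule: finite_induct)
  case (insert c A)
  have "(\<Prod>a\<in>A. f a x) = (\<Prod>a\<in>A. if a = c then partial i (f a) x else f a x)" for x
    by (rule prod.cong) (use insert.hyps in auto)
  moreover have "(if c = b then partial i (f c) x else f c x) = f c x" if "b \<in> A" for b x
    using that insert.hyps by auto
  moreover have "partial i (\<lambda>x. f c x * (\<Prod>a\<in>A. f a x)) =
      (\<lambda>x. partial i (f c) x * (\<Prod>a\<in>A. f a x) + f c x * partial i (\<lambda>x. \<Prod>a\<in>A. f a x) x)"
    by (rule partial_mult) (use insert.prems in \<open>auto intro: is_poly_prod\<close>)
  ultimately show ?case
    using insert by (simp add: sum_distrib_left)
qed (simp add: partial_const)

lemma is_poly_partial: "is_poly f \<Longrightarrow> is_poly (partial i f)"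
proof (induction f rule: is_poly_induct)
  case (coord j)
  show ?case by (cases "i = j") (auto simp: partial_coord intro: is_poly_intros)
qed (auto simp: partial_const partial_add partial_mult intro: is_poly_intros)

lemma partial_commute:
  assumes "is_poly f"
  shows "partial i (partial j f) = partial j (partial i f)"
  using assms
proof (induction f rule: is_poly_induct)
  case (coord k)
  show ?case by (cases "i = k"; cases "j = k") (auto simp: partial_coord partial_const)
next
  case (mult f g)
  then show ?case
    by (simp add: partial_mult partial_add is_poly_mult is_poly_partial algebra_simps)
qed (auto simp: partial_const partial_add is_poly_partial)

lemma partial_compose:
  assumes "is_poly F" "\<And>\<alpha>. is_poly (u \<alpha>)"
  shows "partial k (\<lambda>x. F (\<chi> \<alpha>. u \<alpha> x)) =
    (\<lambda>x. \<Sum>\<alpha>\<in>UNIV. partial \<alpha> F (\<chi> \<alpha>. u \<alpha> x) * partial k (u \<alpha>) x)"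
  using assms(1)
proof (induction F rule: is_poly_induct)
  case (coord j)
  show ?case
    by (simp add: partial_coord if_distrib[of "\<lambda>c. c * _"] cong: if_cong)
next
  case (add f g)
  have "is_poly (\<lambda>x. f (\<chi> \<alpha>. u \<alpha> x))" "is_poly (\<lambda>x. g (\<chi> \<alpha>. u \<alpha> x))"
    using add assms(2) by (auto intro: is_poly_compose)
  then show ?case
    using add by (simp add: partial_add distrib_right sum.distrib)
next
  case (mult f g)
  have "is_poly (\<lambda>x. f (\<chi> \<alpha>. u \<alpha> x))" "is_poly (\<lambda>x. g (\<chi> \<alpha>. u \<alpha> x))"
    using mult assms(2) by (auto intro: is_poly_compose)
  then show ?case
    using mult by (simp add: partial_mult distrib_right distrib_left sum.distrib
        sum_distrib_left sum_distrib_right mult_ac)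
qed (simp add: partial_const)

lemma poly_line_derivative:
  assumes "is_poly f"
  shows "((\<lambda>z. f (x + z *s v)) has_field_derivative
    (\<Sum>k\<in>UNIV. v $ k * partial k f (x + z *s v))) (at z)"
  using assms
proof (induction f rule: is_poly_induct)
  case (coord j)
  show ?case
    by (auto simp: partial_coord if_distrib[of "\<lambda>c. _ * c"] cong: if_cong intro!: derivative_eq_intros)
next
  case (add f g)
  then show ?case
    by (auto simp: partial_add distrib_left sum.distrib intro!: derivative_eq_intros)
next
  case (mult f g)
  show ?case
    by (rule DERIV_cong[OF DERIV_mult[OF mult(3,4)]])
      (simp add: partial_mult mult distrib_left sum.distrib sum_distrib_left sum_distrib_right mult_ac)
qed (simp add: partial_const)

section \<open>Restriction to lines, and polynomial functions as an integral domain\<close>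

lemma poly_line:
  assumes "is_poly f"
  shows "\<exists>p. \<forall>z. f (x + z *s v) = poly p z"
  using assms
proof (induction f rule: is_poly_induct)
  case (const k)
  show ?case by (rule exI[of _ "[:k:]"]) simp
next
  case (coord i)
  show ?case by (rule exI[of _ "[:x $ i, v $ i:]"]) simp
next
  case (add f g)
  then show ?case by (metis poly_add)
next
  case (mult f g)
  then show ?case by (metis poly_mult)
qed

text \<open>On the line through \<open>x\<close> and \<open>y\<close> both factors become nonzero
  polynomials in one variable, as the parameters 0 and 1 show.\<close>

lemma is_poly_mult_nonzero:
  assumes "is_poly f" "is_poly g" "f x \<noteq> 0" "g y \<noteq> 0"
  shows "\<exists>z. f z * g z \<noteq> 0"
proof -
  obtain p where p: "\<And>z. f (x + z *s (y - x)) = poly p z" using poly_line[OF assms(1)] by blast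
  obtain q where q: "\<And>z. g (x + z *s (y - x)) = poly q z" using poly_line[OF assms(2)] by blast
  have "x + 0 *s (y - x) = x" "x + 1 *s (y - x) = y"
    by (simp_all add: vec_eq_iff)
  then have "p \<noteq> 0" "q \<noteq> 0"
    using p[of 0] q[of 1] assms by auto
  then have "p * q \<noteq> 0" by simp
  then obtain z where "poly (p * q) z \<noteq> 0"
    using poly_all_0_iff_0 by blast
  then show ?thesis
    by (intro exI[of _ "x + z *s (y - x)"]) (metis p q poly_mult)
qed

lemma is_poly_mult_eq_0:
  assumes "is_poly f" "is_poly g" "\<And>x. f x * g x = 0" "f y \<noteq> 0"
  shows "g x = 0"
  using is_poly_mult_nonzero[of f g y x] assms by auto

text \<open>This is how identities with denominators extend across the hyperplanes.\<close>

lemma is_poly_eq_on_nonzero: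
  assumes "is_poly h" "h y \<noteq> 0" "is_poly f" "is_poly g" "\<And>x. h x \<noteq> 0 \<Longrightarrow> f x = g x"
  shows "f = g"
proof
  fix x
  have "f x - g x = 0"
    by (rule is_poly_mult_eq_0[of h "\<lambda>x. f x - g x" y]) (use assms in \<open>auto intro: is_poly_intros\<close>)
  then show "f x = g x" by simp
qed

text \<open>Finitely many open conditions can be met at once; this supplies the generic points
  below.\<close>

lemma is_poly_common_nonzero:
  assumes "finite I" "\<And>i. i \<in> I \<Longrightarrow> is_poly (f i)" "\<And>i. i \<in> I \<Longrightarrow> \<exists>x. f i x \<noteq> 0"
  shows "\<exists>x. \<forall>i\<in>I. f i x \<noteq> 0"
proof -
  have "\<exists>x. (\<Prod>i\<in>I. f i x) \<noteq> 0"
    using assms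
  proof (induction I rule: finite_induct)
    case (insert j I)
    then obtain x y where "(\<Prod>i\<in>I. f i x) \<noteq> 0" "f j y \<noteq> 0" by blast
    moreover have "is_poly (\<lambda>x. \<Prod>i\<in>I. f i x)"
      using insert.prems by (auto intro: is_poly_prod)
    ultimately obtain z where "f j z * (\<Prod>i\<in>I. f i z) \<noteq> 0"
      using is_poly_mult_nonzero[of "f j" "\<lambda>x. \<Prod>i\<in>I. f i x" y x] insert.prems by auto
    then show ?case using insert.hyps by auto
  qed simp
  then show ?thesis using assms(1) by auto
qed

text \<open>On every line through the point, induct on the degree.\<close>

lemma is_poly_zero_if_derivatives_vanish:
  assumes I: "\<And>F. F \<in> I \<Longrightarrow> is_poly F" "\<And>F. F \<in> I \<Longrightarrow> F y = 0"
    "\<And>F v. F \<in> I \<Longrightarrow> (\<lambda>x. \<Sum>k\<in>UNIV. v $ k * partial k F x) \<in> I"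
    and "F \<in> I"
  shows "F x = 0"
proof -
  define v where "v = x - y"
  have *: "p = 0" if "F \<in> I" "\<And>z. F (y + z *s v) = poly p z" for p F
    using that
  proof (induction "degree p" arbitrary: p F rule: less_induct)
    case less
    have p0: "poly p 0 = 0" using less.prems(2)[of 0] I(2)[OF less.prems(1)] by simp
    show ?case
    proof (cases "degree p = 0")
      case True
      then obtain c where "p = [:c:]" by (metis degree_eq_zeroE)
      then show ?thesis using p0 by simp
    next
      case False
      have d: "degree (pderiv p) < degree p" using False by (simp add: degree_pderiv)
      have "(\<Sum>k\<in>UNIV. v $ k * partial k F (y + z *s v)) = poly (pderiv p) z" for z
      proof (rule DERIV_unique)
        show "((\<lambda>z. F (y + z *s v)) has_field_derivative (\<Sum>k\<in>UNIV. v $ k * partial k F (y + z *s v))) (at z)"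
          by (rule poly_line_derivative[OF I(1)[OF less.prems(1)]])
        show "((\<lambda>z. F (y + z *s v)) has_field_derivative poly (pderiv p) z) (at z)"
          unfolding less.prems(2) by (rule poly_DERIV)
      qed
      then have "pderiv p = 0"
        using less.hyps[OF d I(3)[OF less.prems(1), of v]] by simp
      then show ?thesis using False by (simp add: pderiv_eq_0_iff)
    qed
  qed
  obtain p where p: "\<And>z. F (y + z *s v) = poly p z" using poly_line[OF I(1)[OF assms(4)]] by blast
  have "y + 1 *s v = x" by (simp add: v_def vec_eq_iff)
  then show ?thesis using p[of 1] *[OF assms(4) p] by simp
qed

subsection \<open>Eigenfunctions of the Euler field\<close>

text \<open>Euler's identity replaces \<open>homogeneous\<close> because the eigenvalue is complex:
  it can be subtracted freely, and the negative values that arise force the function to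
  vanish.\<close>

definition eul :: "complex \<Rightarrow> (complex^'n::finite \<Rightarrow> complex) \<Rightarrow> bool" where
  "eul \<kappa> f \<longleftrightarrow> is_poly f \<and> (\<forall>x. (\<Sum>k\<in>UNIV. x $ k * partial k f x) = \<kappa> * f x)"

lemma eul_is_poly: "eul \<kappa> f \<Longrightarrow> is_poly f"
  by (simp add: eul_def)

lemma eulD: "eul \<kappa> f \<Longrightarrow> (\<Sum>k\<in>UNIV. x $ k * partial k f x) = \<kappa> * f x"
  by (simp add: eul_def)

lemma eul_zero: "eul \<kappa> (\<lambda>x. 0)"
  by (simp add: eul_def is_poly_zero partial_const)

lemma eul_const: "eul 0 (\<lambda>x. k)"
  by (simp add: eul_def is_poly_const partial_const)

lemma eul_add: "eul \<kappa> f \<Longrightarrow> eul \<kappa> g \<Longrightarrow> eul \<kappa> (\<lambda>x. f x + g x)"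
  by (simp add: eul_def is_poly_add partial_add distrib_left sum.distrib)

lemma eul_mult:
  assumes "eul \<kappa> f" "eul \<mu> g"
  shows "eul (\<kappa> + \<mu>) (\<lambda>x. f x * g x)"
proof -
  have "(\<Sum>k\<in>UNIV. x $ k * partial k (\<lambda>x. f x * g x) x) =
      (\<Sum>k\<in>UNIV. x $ k * partial k f x) * g x + f x * (\<Sum>k\<in>UNIV. x $ k * partial k g x)" for x
    using assms by (simp add: eul_is_poly partial_mult distrib_left sum.distrib sum_distrib_left
        sum_distrib_right mult_ac)
  then show ?thesis
    using assms by (simp add: eul_def is_poly_mult algebra_simps)
qed

lemma eul_cmult: "eul \<kappa> f \<Longrightarrow> eul \<kappa> (\<lambda>x. k * f x)"
  using eul_mult[OF eul_const] by simp

lemma eul_divide: "eul \<kappa> f \<Longrightarrow> eul \<kappa> (\<lambda>x. f x / k)"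
  using eul_cmult[of \<kappa> f "inverse k"] by (simp add: field_simps)

lemma eul_diff: "eul \<kappa> f \<Longrightarrow> eul \<kappa> g \<Longrightarrow> eul \<kappa> (\<lambda>x. f x - g x)"
  using eul_add[of \<kappa> f "\<lambda>x. (-1) * g x"] eul_cmult[of \<kappa> g "-1"] by simp

lemma eul_sum: "(\<And>a. a \<in> A \<Longrightarrow> eul \<kappa> (f a)) \<Longrightarrow> eul \<kappa> (\<lambda>x. \<Sum>a\<in>A. f a x)"
  by (induction A rule: infinite_finite_induct) (simp_all add: eul_zero eul_add)

lemma eul_prod:
  "(\<And>a. a \<in> A \<Longrightarrow> eul (\<kappa> a) (f a)) \<Longrightarrow> eul (\<Sum>a\<in>A. \<kappa> a) (\<lambda>x. \<Prod>a\<in>A. f a x)"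
  by (induction A rule: infinite_finite_induct) (simp_all add: eul_const eul_mult)

lemma eul_partial:
  assumes "eul \<kappa> f"
  shows "eul (\<kappa> - 1) (partial i f)"
proof -
  have pf: "is_poly f" by (rule eul_is_poly[OF assms])
  have "partial i (\<lambda>x. \<Sum>k\<in>UNIV. x $ k * partial k f x) x = \<kappa> * partial i f x" for x
    using assms by (simp add: eulD partial_cmult pf)
  moreover have "partial i (\<lambda>x. \<Sum>k\<in>UNIV. x $ k * partial k f x) x =
      partial i f x + (\<Sum>k\<in>UNIV. x $ k * partial k (partial i f) x)" for x
    by (simp add: partial_sum partial_mult partial_coord pf is_poly_partial is_poly_coord is_poly_mult
        sum.distrib if_distrib[of "\<lambda>c. c * _"] partial_commute[OF pf, of i] cong: if_cong)
  ultimately show ?thesis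
    using pf by (simp add: eul_def is_poly_partial algebra_simps)
qed

lemma eul_root_form: "eul 1 (root_form \<gamma>)"
proof -
  have "eul 1 (\<lambda>x. x $ i)" for i :: 'a
    by (simp add: eul_def is_poly_coord partial_coord if_distrib[of "\<lambda>c. _ * c"] cong: if_cong)
  then show ?thesis
    unfolding root_form_def[abs_def] by (intro eul_sum eul_cmult)
qed

text \<open>Each permutation uses every row and every column once, so all terms of the determinant
  have the same eigenvalue.\<close>

lemma eul_det:
  assumes "\<And>i j. eul (r i + s j) (\<lambda>x. M x $ i $ j)"
  shows "eul ((\<Sum>i\<in>UNIV. r i) + (\<Sum>j\<in>UNIV. s j)) (\<lambda>x. det (M x))"
  unfolding det_def
proof (intro eul_sum eul_cmult)
  fix p :: "'a \<Rightarrow> 'a"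
  assume "p \<in> {p. p permutes UNIV}"
  then have "(\<Sum>i\<in>UNIV. s (p i)) = (\<Sum>j\<in>UNIV. s j)"
    by (simp add: sum.permute[of p UNIV s, symmetric, unfolded comp_def])
  then have "(\<Sum>i\<in>UNIV. r i + s (p i)) = (\<Sum>i\<in>UNIV. r i) + (\<Sum>j\<in>UNIV. s j)"
    by (simp add: sum.distrib)
  then show "eul ((\<Sum>i\<in>UNIV. r i) + (\<Sum>j\<in>UNIV. s j)) (\<lambda>x. \<Prod>i\<in>UNIV. M x $ i $ p i)"
    using eul_prod[of UNIV "\<lambda>i. r i + s (p i)" "\<lambda>i x. M x $ i $ p i"] assms by simp
qed

text \<open>The Euler field is a derivation, so \<open>f\<close> times the defect of
  \<open>g\<close> vanishes, and the nonzero \<open>f\<close> cancels.\<close>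

lemma eul_quotient:
  assumes "eul \<kappa> (\<lambda>x. f x * g x)" "eul \<mu> f" "is_poly g" "f y \<noteq> 0"
  shows "eul (\<kappa> - \<mu>) g"
proof -
  define e where "e x = (\<Sum>k\<in>UNIV. x $ k * partial k g x) - (\<kappa> - \<mu>) * g x" for x
  have pf: "is_poly f" by (rule eul_is_poly[OF assms(2)])
  have "(\<Sum>k\<in>UNIV. x $ k * partial k (\<lambda>x. f x * g x) x) =
      (\<Sum>k\<in>UNIV. x $ k * partial k f x) * g x + f x * (\<Sum>k\<in>UNIV. x $ k * partial k g x)" for x
    using assms by (simp add: pf partial_mult distrib_left sum.distrib sum_distrib_left
        sum_distrib_right mult_ac)
  then have "f x * e x = 0" for x
    using eulD[OF assms(1)] eulD[OF assms(2)] by (simp add: e_def algebra_simps)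
  moreover have "is_poly e"
    unfolding e_def[abs_def] by (intro is_poly_intros is_poly_partial assms(3))
  ultimately have "e x = 0" for x
    by (metis is_poly_mult_eq_0 pf assms(4))
  then show ?thesis
    using assms(3) by (simp add: eul_def e_def)
qed

lemma homogeneous_scale:
  assumes "homogeneous k f"
  shows "f (z *s x) = z ^ k * f x"
proof -
  obtain A c where A: "finite A" "\<forall>a\<in>A. (\<Sum>i\<in>UNIV. a i) = k" "f = (\<lambda>x. \<Sum>a\<in>A. c a * monomial_fun a x)"
    using assms unfolding homogeneous_def by blast
  have "monomial_fun a (z *s x) = z ^ k * monomial_fun a x" if "a \<in> A" for a
    using A(2) that by (auto simp: monomial_fun_def power_mult_distrib prod.distrib power_sum)
  then show ?thesis
    unfolding A(3) by (simp add: sum_distrib_left mult.left_commute)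
qed

lemma homogeneous_is_poly: "homogeneous k f \<Longrightarrow> is_poly f"
  unfolding homogeneous_def is_poly_def by blast

text \<open>Differentiate \<open>f ((1 + z) *s x) = (1 + z) ^ k * f x\<close> at
  \<open>z = 0\<close>.\<close>

lemma eul_homogeneous:
  assumes "homogeneous k f"
  shows "eul (of_nat k) f"
proof -
  have pf: "is_poly f" by (rule homogeneous_is_poly[OF assms])
  have "(\<Sum>j\<in>UNIV. x $ j * partial j f x) = of_nat k * f x" for x
  proof (rule DERIV_unique)
    show "((\<lambda>z. f (x + z *s x)) has_field_derivative (\<Sum>j\<in>UNIV. x $ j * partial j f x)) (at 0)"
      using poly_line_derivative[OF pf, of x x 0] by simp
    have ray: "x + z *s x = (1 + z) *s x" for z
      by (simp add: vec_eq_iff algebra_simps)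
    have *: "f (x + z *s x) = (1 + z) ^ k * f x" for z
      unfolding ray by (rule homogeneous_scale[OF assms])
    show "((\<lambda>z. f (x + z *s x)) has_field_derivative of_nat k * f x) (at 0)"
      unfolding * by (auto intro!: derivative_eq_intros)
  qed
  then show ?thesis using pf by (simp add: eul_def)
qed

text \<open>Along the ray through \<open>x\<close> the Euler field is \<open>z d/dz\<close>, so
  comparing coefficients leaves only the power \<open>\<kappa>\<close>.\<close>

lemma eul_ray:
  assumes "eul \<kappa> f" "\<And>z. f (z *s x) = poly p z"
  shows "(of_nat n - \<kappa>) * coeff p n = 0"
proof -
  have pf: "is_poly f" by (rule eul_is_poly[OF assms(1)])
  have "z * poly (pderiv p) z = \<kappa> * poly p z" for z
  proof -
    have "((\<lambda>z. f (z *s x)) has_field_derivative (\<Sum>k\<in>UNIV. x $ k * partial k f (z *s x))) (at z)"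
      using poly_line_derivative[OF pf, of 0 x z] by simp
    moreover have "((\<lambda>z. f (z *s x)) has_field_derivative poly (pderiv p) z) (at z)"
      unfolding assms(2) by (rule poly_DERIV)
    ultimately have "(\<Sum>k\<in>UNIV. x $ k * partial k f (z *s x)) = poly (pderiv p) z"
      by (rule DERIV_unique)
    then show ?thesis
      using eulD[OF assms(1), of "z *s x"] by (simp add: assms(2) mult.assoc flip: sum_distrib_left)
  qed
  then have "poly (pCons 0 (pderiv p)) = poly (smult \<kappa> p)"
    by (intro ext) simp
  then have "pCons 0 (pderiv p) = smult \<kappa> p"
    by (simp add: poly_eq_poly_eq_iff)
  then have "coeff (pCons 0 (pderiv p)) n = coeff (smult \<kappa> p) n" by simp
  then show ?thesis
    by (cases n) (simp_all add: coeff_pderiv algebra_simps)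
qed

text \<open>No power of the ray parameter can carry such an eigenvalue. The typical use is a
  negative one.\<close>

lemma eul_not_nat:
  assumes "eul \<kappa> f" "\<kappa> \<notin> \<nat>"
  shows "f x = 0"
proof -
  obtain p where p: "\<And>z. f (0 + z *s x) = poly p z" using poly_line[OF eul_is_poly[OF assms(1)]] by blast
  have "coeff p n = 0" for n
    using eul_ray[OF assms(1), of x p n] p assms(2) by (auto simp: Nats_def)
  then have "p = 0" by (simp add: poly_eq_iff)
  then show ?thesis using p[of 1] by simp
qed

lemma homogeneous_eul:
  assumes "eul (of_nat k) f"
  shows "homogeneous k f"
proof -
  obtain A c where A: "finite A" "f = (\<lambda>x. \<Sum>a\<in>A. c a * monomial_fun a x)"
    using eul_is_poly[OF assms] unfolding is_poly_def by blast
  define B where "B = {a\<in>A. (\<Sum>i\<in>UNIV. a i) = k}"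
  have "f x = (\<Sum>a\<in>B. c a * monomial_fun a x)" for x
  proof -
    define p where "p = (\<Sum>a\<in>A. monom (c a * monomial_fun a x) (\<Sum>i\<in>UNIV. a i))"
    have "monomial_fun a (z *s x) = z ^ (\<Sum>i\<in>UNIV. a i) * monomial_fun a x" for a z
      by (simp add: monomial_fun_def power_mult_distrib prod.distrib power_sum)
    then have p: "f (z *s x) = poly p z" for z
      by (simp add: A(2) p_def poly_sum poly_monom mult_ac)
    have "coeff p n = 0" if "n \<noteq> k" for n
      using eul_ray[OF assms p, of n] that by auto
    then have "p = monom (coeff p k) k"
      by (auto simp: poly_eq_iff)
    then have "poly p 1 = coeff p k"
      by (metis poly_monom mult.right_neutral power_one)
    moreover have "coeff p k = (\<Sum>a\<in>B. c a * monomial_fun a x)"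
      unfolding p_def coeff_sum coeff_monom B_def using A(1)
      by (simp add: sum.inter_filter)
    ultimately show ?thesis using p[of 1] by simp
  qed
  then show ?thesis
    unfolding homogeneous_def B_def using A(1)
    by (intro exI[of _ "{a\<in>A. (\<Sum>i\<in>UNIV. a i) = k}"] exI[of _ c]) auto
qed

section \<open>Reflection groups acting on complex vectors\<close>

definition cplx :: "real^'n \<Rightarrow> complex^'n" where
  "cplx v = (\<chi> i. complex_of_real (v $ i))"

definition capp :: "real^'n^'n::finite \<Rightarrow> complex^'n \<Rightarrow> complex^'n" where
  "capp w x = map_matrix complex_of_real w *v x"

lemma capp_nth: "capp w x $ i = (\<Sum>j\<in>UNIV. complex_of_real (w $ i $ j) * x $ j)"
  by (simp add: capp_def matrix_vector_mult_def)

lemma cplx_nth [simp]: "cplx v $ i = complex_of_real (v $ i)"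
  by (simp add: cplx_def)

lemma cplx_eq_iff: "cplx u = cplx v \<longleftrightarrow> u = v"
  by (simp add: vec_eq_iff)

lemma act_capp: "act w f x = f (capp (matrix_inv w) x)"
  by (simp add: act_def capp_def)

lemma map_matrix_mult:
  "map_matrix complex_of_real (v ** w) = map_matrix complex_of_real v ** map_matrix complex_of_real w"
  by (simp add: vec_eq_iff matrix_matrix_mult_def map_matrix_def)

lemma capp_mult: "capp (v ** w) x = capp v (capp w x)"
  by (simp add: capp_def map_matrix_mult matrix_vector_mul_assoc)

lemma capp_one [simp]: "capp (mat 1) x = x"
proof -
  have "map_matrix complex_of_real (mat 1) = (mat 1 :: complex^'a^'a)"
    by (simp add: vec_eq_iff mat_def map_matrix_def)
  then show ?thesis by (simp add: capp_def)
qed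

lemma capp_add: "capp w (x + y) = capp w x + capp w y"
  by (simp add: capp_def matrix_vector_right_distrib)

lemma capp_scale: "capp w (z *s x) = z *s capp w x"
  by (simp add: capp_def vector_scalar_commute)

lemma capp_cplx: "capp w (cplx v) = cplx (w *v v)"
  by (simp add: vec_eq_iff capp_nth matrix_vector_mult_def)

lemma capp_refl:
  assumes "\<gamma> \<bullet> \<gamma> = 2"
  shows "capp (refl_matrix \<gamma>) x = x - root_form \<gamma> x *s cplx \<gamma>"
proof -
  have "(capp (refl_matrix \<gamma>) x) $ i = x $ i - root_form \<gamma> x * complex_of_real (\<gamma> $ i)" for i
    using act_refl_matrix[OF assms, of "\<lambda>x. x $ i" x]
    by (simp add: act_capp matrix_inv_refl_matrix[OF assms])
  then show ?thesis by (simp add: vec_eq_iff)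
qed

lemma root_form_add: "root_form \<gamma> (x + y) = root_form \<gamma> x + root_form \<gamma> y"
  by (simp add: root_form_def distrib_left sum.distrib)

lemma root_form_diff: "root_form \<gamma> (x - y) = root_form \<gamma> x - root_form \<gamma> y"
  by (simp add: root_form_def right_diff_distrib sum_subtractf)

lemma root_form_scale: "root_form \<gamma> (z *s x) = z * root_form \<gamma> x"
  by (simp add: root_form_def sum_distrib_left mult_ac)

lemma root_form_cplx: "root_form \<gamma> (cplx v) = complex_of_real (\<gamma> \<bullet> v)"
  by (simp add: root_form_def inner_vec_def)

lemma sum_root_square:
  "\<gamma> \<bullet> \<gamma> = 2 \<Longrightarrow> (\<Sum>i\<in>UNIV. complex_of_real (\<gamma> $ i) * complex_of_real (\<gamma> $ i)) = 2"
  using root_form_cplx[of \<gamma> \<gamma>] by (simp add: root_form_def)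

lemma partial_root_form: "partial i (root_form \<gamma>) x = complex_of_real (\<gamma> $ i)"
  unfolding root_form_def[abs_def]
  by (simp add: partial_sum partial_cmult partial_coord is_poly_intros
      if_distrib[of "\<lambda>c. _ * c"] cong: if_cong)

lemma is_poly_capp: "is_poly f \<Longrightarrow> is_poly (\<lambda>x. f (capp w x))"
proof -
  assume "is_poly f"
  then have "is_poly (\<lambda>x. f (\<chi> i. \<Sum>j\<in>UNIV. complex_of_real (w $ i $ j) * x $ j))"
    by (rule is_poly_compose) (intro is_poly_intros)
  then show ?thesis by (simp add: capp_def matrix_vector_mult_def)
qed

lemma partial_capp:
  assumes "is_poly f"
  shows "partial k (\<lambda>x. f (capp w x)) =
    (\<lambda>x. \<Sum>i\<in>UNIV. partial i f (capp w x) * complex_of_real (w $ i $ k))"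
proof -
  have *: "capp w x = (\<chi> i. \<Sum>j\<in>UNIV. complex_of_real (w $ i $ j) * x $ j)" for x
    by (simp add: vec_eq_iff capp_nth)
  have "partial k (\<lambda>x. \<Sum>j\<in>UNIV. complex_of_real (w $ i $ j) * x $ j) = (\<lambda>x. complex_of_real (w $ i $ k))" for i
    by (simp add: partial_sum partial_cmult partial_coord is_poly_intros
        if_distrib[of "\<lambda>c. _ * c"] cong: if_cong)
  then show ?thesis
    unfolding * by (subst partial_compose) (auto intro!: assms is_poly_intros)
qed

lemma refl_matrix_self: "\<gamma> \<bullet> \<gamma> = 2 \<Longrightarrow> refl_matrix \<gamma> *v \<gamma> = - \<gamma>"
  by (simp add: refl_matrix_mult vec_eq_iff)

lemma refl_matrix_scaleR: "k \<noteq> 0 \<Longrightarrow> refl_matrix (k *\<^sub>R a) = refl_matrix a"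
  by (simp add: matrix_eq refl_matrix_mult)

text \<open>For vectors of squared length 2 this is the equality case of Cauchy-Schwarz:
  \<open>\<delta> - \<gamma>\<close> or \<open>\<delta> + \<gamma>\<close> has length 0.\<close>

lemma proportional_roots:
  fixes \<gamma> \<delta> :: "real^'n"
  assumes "\<gamma> \<bullet> \<gamma> = 2" "\<delta> \<bullet> \<delta> = 2" "(\<gamma> \<bullet> \<delta>)\<^sup>2 = 4"
  shows "\<delta> = \<gamma> \<or> \<delta> = - \<gamma>"
proof -
  have "(\<delta> - \<gamma>) \<bullet> (\<delta> - \<gamma>) = 4 - 2 * (\<gamma> \<bullet> \<delta>)" "(\<delta> + \<gamma>) \<bullet> (\<delta> + \<gamma>) = 4 + 2 * (\<gamma> \<bullet> \<delta>)"
    using assms(1,2) by (simp_all add: inner_diff_left inner_diff_right inner_add_left inner_add_right inner_commute)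
  moreover have "\<gamma> \<bullet> \<delta> = 2 \<or> \<gamma> \<bullet> \<delta> = - 2"
    using assms(3) power2_eq_iff[of "\<gamma> \<bullet> \<delta>" 2] by simp
  ultimately have "(\<delta> - \<gamma>) \<bullet> (\<delta> - \<gamma>) = 0 \<or> (\<delta> + \<gamma>) \<bullet> (\<delta> + \<gamma>) = 0"
    by linarith
  then show ?thesis by (simp add: eq_neg_iff_add_eq_0)
qed

lemma refl_matrix_eq_iff:
  fixes \<gamma> \<delta> :: "real^'n"
  assumes "\<gamma> \<bullet> \<gamma> = 2" "\<delta> \<bullet> \<delta> = 2" "refl_matrix \<gamma> = refl_matrix \<delta>"
  shows "\<delta> = \<gamma> \<or> \<delta> = - \<gamma>"
proof -
  have "refl_matrix \<gamma> *v \<delta> = - \<delta>"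
    using refl_matrix_self[OF assms(2)] assms(3) by simp
  then have "\<delta> - (\<gamma> \<bullet> \<delta>) *\<^sub>R \<gamma> = - \<delta>"
    by (simp only: refl_matrix_mult assms(1)) simp
  then have "\<delta> \<bullet> (\<delta> - (\<gamma> \<bullet> \<delta>) *\<^sub>R \<gamma>) = \<delta> \<bullet> (- \<delta>)"
    by (rule arg_cong)
  then have "(\<gamma> \<bullet> \<delta>)\<^sup>2 = 4"
    using assms(2) by (simp add: inner_diff_right power2_eq_square inner_commute)
  then show ?thesis using proportional_roots assms by blast
qed

text \<open>Division by a linear form compares a polynomial with its composition with
  the projection onto the hyperplane.\<close>

definition hproj :: "real^'n::finite \<Rightarrow> complex^'n \<Rightarrow> complex^'n" where
  "hproj \<gamma> x = (\<chi> i. x $ i - root_form \<gamma> x / 2 * complex_of_real (\<gamma> $ i))"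

lemma hproj_eq: "hproj \<gamma> x = x - (root_form \<gamma> x / 2) *s cplx \<gamma>"
  by (simp add: hproj_def vec_eq_iff)

lemma is_poly_hproj: "is_poly f \<Longrightarrow> is_poly (\<lambda>x. f (hproj \<gamma> x))"
  unfolding hproj_def by (erule is_poly_compose) (intro is_poly_intros)

lemma root_form_hproj: "\<gamma> \<bullet> \<gamma> = 2 \<Longrightarrow> root_form \<gamma> (hproj \<gamma> x) = 0"
  by (simp add: hproj_eq root_form_diff root_form_scale root_form_cplx)

lemma hproj_id: "root_form \<gamma> x = 0 \<Longrightarrow> hproj \<gamma> x = x"
  by (simp add: hproj_def)

lemma root_form_factor:
  assumes "is_poly f"
  shows "\<exists>p. is_poly p \<and> (\<forall>x. f x - f (hproj \<gamma> x) = root_form \<gamma> x * p x)"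
  using assms
proof (induction f rule: is_poly_induct)
  case (const k)
  show ?case by (rule exI[of _ "\<lambda>x. 0"]) (simp add: is_poly_zero)
next
  case (coord i)
  show ?case
    by (rule exI[of _ "\<lambda>x. complex_of_real (\<gamma> $ i) / 2"]) (simp add: is_poly_const hproj_def)
next
  case (add f g)
  obtain p where p: "is_poly p" "\<And>x. f x - f (hproj \<gamma> x) = root_form \<gamma> x * p x"
    using add(3) by blast
  obtain q where q: "is_poly q" "\<And>x. g x - g (hproj \<gamma> x) = root_form \<gamma> x * q x"
    using add(4) by blast
  have "f x + g x - (f (hproj \<gamma> x) + g (hproj \<gamma> x)) = root_form \<gamma> x * (p x + q x)" for x
    unfolding distrib_left p(2)[symmetric] q(2)[symmetric] by simp
  then show ?case
    using is_poly_add[OF p(1) q(1)] by blast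
next
  case (mult f g)
  obtain p where p: "is_poly p" "\<And>x. f x - f (hproj \<gamma> x) = root_form \<gamma> x * p x"
    using mult(3) by blast
  obtain q where q: "is_poly q" "\<And>x. g x - g (hproj \<gamma> x) = root_form \<gamma> x * q x"
    using mult(4) by blast
  have "f x * g x - f (hproj \<gamma> x) * g (hproj \<gamma> x) = root_form \<gamma> x * (p x * g x + f (hproj \<gamma> x) * q x)" for x
  proof -
    have "f x * g x - f (hproj \<gamma> x) * g (hproj \<gamma> x) =
        (f x - f (hproj \<gamma> x)) * g x + f (hproj \<gamma> x) * (g x - g (hproj \<gamma> x))"
      by (simp add: algebra_simps)
    then show ?thesis unfolding p(2) q(2) by (simp add: algebra_simps)
  qed
  moreover have "is_poly (\<lambda>x. p x * g x + f (hproj \<gamma> x) * q x)"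
    by (intro is_poly_add is_poly_mult is_poly_hproj p(1) q(1) mult(1,2))
  ultimately show ?case by blast
qed

lemma root_form_dvd:
  assumes "is_poly f" "\<gamma> \<bullet> \<gamma> = 2" "\<And>x. root_form \<gamma> x = 0 \<Longrightarrow> f x = 0"
  shows "\<exists>p. is_poly p \<and> (\<forall>x. f x = root_form \<gamma> x * p x)"
  using root_form_factor[OF assms(1), of \<gamma>] assms(3)[OF root_form_hproj[OF assms(2)]] by auto

lemma orthogonal_refl_matrix: "orthogonal_matrix (refl_matrix a)"
proof -
  have "orthogonal_transformation ((*v) (refl_matrix a))"
    unfolding orthogonal_transformation_def refl_matrix_mult[abs_def]
  proof (intro conjI allI)
    show "linear (\<lambda>y. y - (2 * (a \<bullet> y) / (a \<bullet> a)) *\<^sub>R a)"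
      by (rule linearI) (simp_all add: inner_add_right ring_distribs add_divide_distrib
          scaleR_add_left scaleR_diff_right)
    \<comment> \<open>For \<open>a = 0\<close> the quotient is 0 by convention and the map is the
      identity, which is orthogonal as well.\<close>
    show "(v - (2 * (a \<bullet> v) / (a \<bullet> a)) *\<^sub>R a) \<bullet> (w - (2 * (a \<bullet> w) / (a \<bullet> a)) *\<^sub>R a) = v \<bullet> w" for v w
      by (cases "a = 0") (simp_all add: inner_diff_left inner_diff_right inner_commute field_simps)
  qed
  then show ?thesis
    by (simp add: orthogonal_transformation_matrix)
qed

lemma orthogonal_matrix_inner:
  fixes w :: "real^'n^'n::finite"
  shows "orthogonal_matrix w \<Longrightarrow> (w *v u) \<bullet> (w *v v) = u \<bullet> v"
  using orthogonal_transformation_matrix[of "(*v) w"] by (simp add: orthogonal_transformation_def)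

text \<open>If \<open>w\<close> moves \<open>y\<close> by a multiple of \<open>a\<close>,
  preservation of length leaves only the multiple 0 and the one prescribed by the reflection in
  \<open>a\<close>. The direction \<open>u\<close> is complex, so a real direction has to be found
  first.\<close>

lemma orthogonal_rank_one:
  fixes w :: "real^'n^'n::finite"
  assumes "orthogonal_matrix w" "w \<noteq> mat 1" "\<And>y. \<exists>c. capp w y - y = c *s u"
  shows "\<exists>\<gamma>. \<gamma> \<bullet> \<gamma> = 2 \<and> w = refl_matrix \<gamma>"
proof -
  obtain y0 where "w *v y0 \<noteq> y0"
    using assms(2) by (auto simp: matrix_eq)
  define a where "a = w *v y0 - y0"
  have a0: "a \<noteq> 0" using \<open>w *v y0 \<noteq> y0\<close> by (simp add: a_def)
  then obtain i where i: "a $ i \<noteq> 0" by (auto simp: vec_eq_iff)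
  obtain c0 where c0: "cplx a = c0 *s u"
    using assms(3)[of "cplx y0"] by (auto simp: a_def capp_cplx vec_eq_iff)
  have *: "\<exists>r. w *v y - y = r *\<^sub>R a" for y
  proof -
    obtain c where c: "cplx (w *v y - y) = c *s u"
      using assms(3)[of "cplx y"] by (auto simp: capp_cplx vec_eq_iff)
    \<comment> \<open>Cross-multiplying components removes the complex factors \<open>c\<close> and
      \<open>c0\<close>, so the displacement is a real multiple of \<open>a\<close>.\<close>
    have "complex_of_real ((w *v y - y) $ j * a $ i) = complex_of_real ((w *v y - y) $ i * a $ j)" for j
      using arg_cong[OF c, of "\<lambda>v. v $ j"] arg_cong[OF c, of "\<lambda>v. v $ i"]
        arg_cong[OF c0, of "\<lambda>v. v $ j"] arg_cong[OF c0, of "\<lambda>v. v $ i"]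
      by (simp only: cplx_nth of_real_mult vector_smult_component) (simp add: mult_ac)
    then have "(w *v y - y) $ j * a $ i = (w *v y - y) $ i * a $ j" for j
      by (simp only: of_real_eq_iff)
    then have "w *v y - y = ((w *v y - y) $ i / a $ i) *\<^sub>R a"
      using i by (simp add: vec_eq_iff field_simps)
    then show ?thesis by blast
  qed
  have r: "r = 0 \<or> r = - 2 * (y \<bullet> a) / (a \<bullet> a)" if "w *v y - y = r *\<^sub>R a" for y r
  proof -
    have "w *v y = y + r *\<^sub>R a" using that by (simp add: algebra_simps)
    then have "(y + r *\<^sub>R a) \<bullet> (y + r *\<^sub>R a) = y \<bullet> y"
      using orthogonal_matrix_inner[OF assms(1), of y y] by simp
    then have "r * (2 * (y \<bullet> a) + r * (a \<bullet> a)) = 0"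
      by (simp add: inner_add_left inner_add_right inner_commute algebra_simps)
    then have "r = 0 \<or> r * (a \<bullet> a) = - 2 * (y \<bullet> a)" by auto
    then show ?thesis using a0 by (auto simp: field_simps)
  qed
  have "w *v y = refl_matrix a *v y" for y
  proof -
    obtain s where s: "w *v y - y = s *\<^sub>R a" using * by blast
    have "s = - 2 * (y \<bullet> a) / (a \<bullet> a)"
    proof (cases "s = 0")
      case True
      \<comment> \<open>If \<open>y\<close> is fixed, then \<open>y + y0\<close> and
        \<open>y0\<close> are both moved by \<open>a\<close>; comparing the two admissible multiples
        shows that \<open>y\<close> is orthogonal to \<open>a\<close>.\<close>
      have "w *v (y + y0) - (y + y0) = 1 *\<^sub>R a" "w *v y0 - y0 = 1 *\<^sub>R a"
        using s True by (simp_all add: a_def matrix_vector_right_distrib)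
      from r[OF this(1)] r[OF this(2)] show ?thesis
        using True a0 by (simp add: field_simps inner_add_left)
    next
      case False
      then show ?thesis using r[OF s] by blast
    qed
    moreover have "w *v y = y + s *\<^sub>R a" using s by (simp add: algebra_simps)
    ultimately show ?thesis
      by (simp add: refl_matrix_mult inner_commute)
  qed
  then have "w = refl_matrix a" by (simp add: matrix_eq)
  moreover have "(sqrt 2 / norm a) *\<^sub>R a \<bullet> (sqrt 2 / norm a) *\<^sub>R a = 2"
    using a0 by (simp add: dot_square_norm power2_eq_square)
  moreover have "refl_matrix ((sqrt 2 / norm a) *\<^sub>R a) = refl_matrix a"
    using a0 by (intro refl_matrix_scaleR) simp
  ultimately show ?thesis by metis
qed

lemma matrix_inv_eqI:
  fixes A :: "'a::semiring_1^'n^'m"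
  assumes "A ** B = mat 1" "B ** A = mat 1"
  shows "matrix_inv A = B"
proof -
  have "A ** matrix_inv A = mat 1 \<and> matrix_inv A ** A = mat 1"
    unfolding matrix_inv_def by (rule someI[of _ B]) (use assms in simp)
  then show ?thesis
    by (metis assms(2) matrix_mul_assoc matrix_mul_lid matrix_mul_rid)
qed

text \<open>A triple zero has vanishing derivatives up to order two; hence the cubes in the bump
  below.\<close>

lemma flat_cube:
  assumes l: "is_poly l" and R: "is_poly R" and "l y = 0"
  shows "partial i (\<lambda>x. l x * (l x * (l x * R x))) y = 0"
    and "partial j (partial i (\<lambda>x. l x * (l x * (l x * R x)))) y = 0"
proof -
  define A where "A x = l x * R x" for x
  define B where "B x = l x * A x" for x
  have A: "is_poly A" unfolding A_def[abs_def] by (intro is_poly_mult l R)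
  have B: "is_poly B" unfolding B_def[abs_def] by (intro is_poly_mult l A)
  have vanish: "A y = 0" "B y = 0" using assms(3) by (simp_all add: A_def B_def)
  have "partial i B = (\<lambda>x. partial i l x * A x + l x * partial i A x)" for i
    unfolding B_def[abs_def] by (rule partial_mult[OF l A])
  then have dB: "partial i B y = 0" for i
    using vanish assms(3) by simp
  have 1: "partial i (\<lambda>x. l x * B x) = (\<lambda>x. partial i l x * B x + l x * partial i B x)" for i
    by (rule partial_mult[OF l B])
  have 2: "partial j (\<lambda>x. partial i l x * B x + l x * partial i B x) y = 0"
    using vanish assms(3) dB
    by (simp add: partial_add partial_mult is_poly_mult is_poly_partial l B)
  have "(\<lambda>x. l x * (l x * (l x * R x))) = (\<lambda>x. l x * B x)" by (simp add: A_def B_def)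
  then show "partial i (\<lambda>x. l x * (l x * (l x * R x))) y = 0"
    "partial j (partial i (\<lambda>x. l x * (l x * (l x * R x)))) y = 0"
    using 1[of i] 2 vanish assms(3) by simp_all
qed

section \<open>Mirrors of the group, the product of the positive roots, and averaging\<close>

locale reflection_setup =
  fixes W :: "(real^'n^'n::finite) set" and P :: "(real^'n) set"
  assumes finite_W: "finite W"
    and generated: "\<exists>S. W = reflection_group S"
    and positive: "positive_system W P"
begin

lemma one_W: "mat 1 \<in> W"
  using generated reflection_group.one by auto

lemma mult_W:
  assumes "v \<in> W" "w \<in> W"
  shows "v ** w \<in> W"
proof -
  obtain S where S: "W = reflection_group S" using generated by blast
  have "v ** w \<in> reflection_group S" if "v \<in> reflection_group S" for v
    using that
    by (induction rule: reflection_group.induct)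
      (use assms(2) S in \<open>auto simp: matrix_mul_assoc[symmetric] intro: reflection_group.refl\<close>)
  then show ?thesis using assms S by blast
qed

lemma orthogonal_W:
  assumes "w \<in> W"
  shows "orthogonal_matrix w"
proof -
  obtain S where S: "W = reflection_group S" using generated by blast
  have "w \<in> reflection_group S" using assms S by blast
  then show ?thesis
    by (induction rule: reflection_group.induct)
      (auto simp: orthogonal_matrix_id intro: orthogonal_matrix_mul orthogonal_refl_matrix)
qed

lemma P_root: "\<gamma> \<in> P \<Longrightarrow> \<gamma> \<bullet> \<gamma> = 2" and P_refl: "\<gamma> \<in> P \<Longrightarrow> refl_matrix \<gamma> \<in> W"
  using positive by (auto simp: positive_system_def roots_def)

lemma P_nonzero: "\<gamma> \<in> P \<Longrightarrow> \<exists>i. \<gamma> $ i \<noteq> 0"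
  using P_root[of \<gamma>] by (auto simp: inner_vec_def intro: ccontr)

lemma P_minus: "\<gamma> \<in> P \<Longrightarrow> - \<gamma> \<notin> P"
  using positive by (auto simp: positive_system_def)

lemma P_or_minus:
  assumes "\<gamma> \<bullet> \<gamma> = 2" "refl_matrix \<gamma> \<in> W"
  shows "\<gamma> \<in> P \<or> - \<gamma> \<in> P"
proof -
  have m: "refl_matrix (- \<gamma>) = refl_matrix \<gamma>"
    using refl_matrix_scaleR[of "-1" \<gamma>] by simp
  obtain v where v: "\<forall>\<gamma>\<in>roots W. v \<bullet> \<gamma> \<noteq> 0" "P = {\<gamma>\<in>roots W. v \<bullet> \<gamma> > 0}"
    using positive by (auto simp: positive_system_def)
  have "\<gamma> \<in> roots W" "- \<gamma> \<in> roots W" using assms m by (auto simp: roots_def)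
  then show ?thesis using v by (auto simp: neq_iff)
qed

lemma P_eqI:
  assumes "\<gamma> \<in> P" "\<delta> \<in> P" "(\<gamma> \<bullet> \<delta>)\<^sup>2 = 4"
  shows "\<delta> = \<gamma>"
  using proportional_roots[OF P_root[OF assms(1)] P_root[OF assms(2)] assms(3)] P_minus assms by auto

lemma refl_matrix_inj: "inj_on refl_matrix P"
proof (rule inj_onI)
  fix \<gamma> \<delta> assume "\<gamma> \<in> P" "\<delta> \<in> P" "refl_matrix \<gamma> = refl_matrix \<delta>"
  then show "\<gamma> = \<delta>"
    using refl_matrix_eq_iff[OF P_root P_root, of \<gamma> \<delta>] P_minus by auto
qed

lemma finite_P: "finite P"
  by (rule inj_on_finite[OF refl_matrix_inj _ finite_W]) (auto intro: P_refl)

lemma reflection_in_P: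
  assumes "w \<in> W" "\<gamma> \<bullet> \<gamma> = 2" "w = refl_matrix \<gamma>"
  shows "\<exists>\<delta>\<in>P. w = refl_matrix \<delta>"
proof -
  have "refl_matrix (- \<gamma>) = refl_matrix \<gamma>"
    using refl_matrix_scaleR[of "-1" \<gamma>] by simp
  moreover have "\<gamma> \<in> P \<or> - \<gamma> \<in> P"
    using P_or_minus[OF assms(2)] assms(1,3) by simp
  ultimately show ?thesis using assms(3) by (elim disjE) (auto intro: bexI[of _ \<gamma>] bexI[of _ "- \<gamma>"])
qed

lemma rank_one_in_P:
  assumes "w \<in> W" "w \<noteq> mat 1" "\<And>y. \<exists>c. capp w y - y = c *s u"
  shows "\<exists>\<delta>\<in>P. w = refl_matrix \<delta>"
  using orthogonal_rank_one[OF orthogonal_W[OF assms(1)] assms(2,3)] reflection_in_P assms(1) by blast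

text \<open>On the projection of \<open>\<delta>\<close> to the hyperplane of
  \<open>\<gamma>\<close> the form of \<open>\<delta>\<close> takes the value
  \<open>2 - (\<gamma> \<bullet> \<delta>)^2 / 2\<close>; its vanishing is the equality case of
  Cauchy-Schwarz.\<close>

lemma hyperplane_subset_eq:
  assumes "\<gamma> \<in> P" "\<delta> \<in> P" "\<And>x. root_form \<gamma> x = 0 \<Longrightarrow> root_form \<delta> x = 0"
  shows "\<delta> = \<gamma>"
proof -
  have "root_form \<delta> (hproj \<gamma> (cplx \<delta>)) = 0"
    by (rule assms(3)) (simp add: root_form_hproj P_root assms)
  then have "complex_of_real (2 - (\<gamma> \<bullet> \<delta>) / 2 * (\<gamma> \<bullet> \<delta>)) = 0"
    by (simp add: hproj_eq root_form_diff root_form_scale root_form_cplx P_root assms inner_commute)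
  then have "(\<gamma> \<bullet> \<delta>)\<^sup>2 = 4"
    by (simp only: of_real_eq_0_iff) (simp add: power2_eq_square field_simps)
  then show ?thesis using P_eqI assms by blast
qed

text \<open>The displacement \<open>w - 1\<close> depends only on the normal coordinate, so it has
  rank at most one and a nontrivial \<open>w\<close> is a reflection; its mirror contains that of
  \<open>\<gamma>\<close>, so the two agree.\<close>

lemma hyperplane_fixed:
  assumes "w \<in> W" "\<gamma> \<in> P" "\<And>x. root_form \<gamma> x = 0 \<Longrightarrow> capp w x = x"
  shows "w = mat 1 \<or> w = refl_matrix \<gamma>"
proof (cases "w = mat 1")
  case False
  have "capp w y - y = (root_form \<gamma> y / 2) *s (capp w (cplx \<gamma>) - cplx \<gamma>)" for y
  proof -
    have y: "y = hproj \<gamma> y + (root_form \<gamma> y / 2) *s cplx \<gamma>" by (simp add: hproj_eq)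
    have "capp w (hproj \<gamma> y) = hproj \<gamma> y"
      by (rule assms(3)) (simp add: root_form_hproj P_root assms)
    then have "capp w y = hproj \<gamma> y + (root_form \<gamma> y / 2) *s capp w (cplx \<gamma>)"
      by (subst y) (simp add: capp_add capp_scale)
    then show ?thesis by (simp add: hproj_eq vec_eq_iff algebra_simps)
  qed
  then have "\<exists>c. capp w y - y = c *s (capp w (cplx \<gamma>) - cplx \<gamma>)" for y
    by blast
  then obtain \<delta> where \<delta>: "\<delta> \<in> P" "w = refl_matrix \<delta>"
    using rank_one_in_P[OF assms(1) False] by blast
  have "root_form \<delta> x = 0" if "root_form \<gamma> x = 0" for x
  proof -
    have "root_form \<delta> x *s cplx \<delta> = 0"
      using assms(3)[OF that] by (simp add: \<delta> capp_refl P_root)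
    moreover obtain i where "\<delta> $ i \<noteq> 0" using P_nonzero \<delta> by blast
    ultimately show ?thesis by (auto simp: vec_eq_iff)
  qed
  then have "\<delta> = \<gamma>" by (rule hyperplane_subset_eq[OF assms(2) \<delta>(1)])
  then show ?thesis using \<delta> by simp
qed simp

definition Delta :: "complex^'n \<Rightarrow> complex" where
  "Delta x = (\<Prod>\<gamma>\<in>P. root_form \<gamma> x)"

lemma is_poly_Delta: "is_poly Delta"
  unfolding Delta_def[abs_def] by (intro is_poly_intros)

lemma Delta_nonzero_iff: "Delta x \<noteq> 0 \<longleftrightarrow> (\<forall>\<gamma>\<in>P. root_form \<gamma> x \<noteq> 0)"
  by (simp add: Delta_def finite_P)

lemma root_form_nonzero: "\<gamma> \<in> P \<Longrightarrow> \<exists>x. root_form \<gamma> x \<noteq> 0"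
  by (rule exI[of _ "cplx \<gamma>"]) (simp add: root_form_cplx P_root)

lemma Delta_nonzero: "\<exists>x. Delta x \<noteq> 0"
  unfolding Delta_nonzero_iff
  by (rule is_poly_common_nonzero) (auto simp: finite_P is_poly_root_form root_form_nonzero)

text \<open>The root forms are split off one at a time. Distinct positive roots have distinct
  hyperplanes, so the factors already removed do not vanish identically on the next one, and the
  remaining quotient must vanish there.\<close>

lemma Delta_dvd:
  assumes "is_poly f" "\<And>\<gamma> x. \<gamma> \<in> P \<Longrightarrow> root_form \<gamma> x = 0 \<Longrightarrow> f x = 0"
  shows "\<exists>p. is_poly p \<and> (\<forall>x. f x = Delta x * p x)"
proof -
  have "\<exists>p. is_poly p \<and> (\<forall>x. f x = (\<Prod>\<gamma>\<in>Q. root_form \<gamma> x) * p x)" if "finite Q" "Q \<subseteq> P" for Q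
    using that
  proof (induction Q rule: finite_induct)
    case empty
    show ?case using assms(1) by auto
  next
    case (insert \<delta> Q)
    then obtain p where p: "is_poly p" "\<And>x. f x = (\<Prod>\<gamma>\<in>Q. root_form \<gamma> x) * p x" by auto
    have d: "\<delta> \<in> P" "Q \<subseteq> P" "\<delta> \<bullet> \<delta> = 2" using insert P_root by auto
    have "\<exists>x. \<forall>\<gamma>\<in>Q. root_form \<gamma> (hproj \<delta> x) \<noteq> 0"
    proof (rule is_poly_common_nonzero[OF insert.hyps(1)])
      fix \<gamma> assume g: "\<gamma> \<in> Q"
      show "is_poly (\<lambda>x. root_form \<gamma> (hproj \<delta> x))" by (intro is_poly_hproj is_poly_root_form)
      show "\<exists>x. root_form \<gamma> (hproj \<delta> x) \<noteq> 0"
      proof (rule ccontr)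
        assume "\<nexists>x. root_form \<gamma> (hproj \<delta> x) \<noteq> 0"
        then have "root_form \<gamma> x = 0" if "root_form \<delta> x = 0" for x
          using hproj_id[OF that] by metis
        then have "\<gamma> = \<delta>"
          using hyperplane_subset_eq[of \<delta> \<gamma>] d g by blast
        then show False using insert.hyps g by blast
      qed
    qed
    then obtain y where y: "(\<Prod>\<gamma>\<in>Q. root_form \<gamma> (hproj \<delta> y)) \<noteq> 0"
      using insert.hyps by auto
    have "p (hproj \<delta> x) = 0" for x
    proof (rule is_poly_mult_eq_0[where f = "\<lambda>x. \<Prod>\<gamma>\<in>Q. root_form \<gamma> (hproj \<delta> x)"
        and g = "\<lambda>x. p (hproj \<delta> x)" and y = y])
      show "is_poly (\<lambda>x. \<Prod>\<gamma>\<in>Q. root_form \<gamma> (hproj \<delta> x))"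
        by (intro is_poly_prod is_poly_hproj is_poly_root_form)
      show "is_poly (\<lambda>x. p (hproj \<delta> x))" by (intro is_poly_hproj p)
      show "(\<Prod>\<gamma>\<in>Q. root_form \<gamma> (hproj \<delta> x)) * p (hproj \<delta> x) = 0" for x
        using assms(2)[OF d(1) root_form_hproj[OF d(3)]] p(2)[of "hproj \<delta> x"] by simp
      show "(\<Prod>\<gamma>\<in>Q. root_form \<gamma> (hproj \<delta> y)) \<noteq> 0" by (rule y)
    qed
    then have "p x = 0" if "root_form \<delta> x = 0" for x
      using hproj_id[OF that] by metis
    then obtain q where "is_poly q" "\<And>x. p x = root_form \<delta> x * q x"
      using root_form_dvd[OF p(1) d(3)] by blast
    then show ?case using p(2) insert.hyps by (auto simp: mult_ac)
  qed
  from this[OF finite_P subset_refl] show ?thesis by (simp add: Delta_def)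
qed

lemma capp_W_inj: "w \<in> W \<Longrightarrow> matrix_inv w ** w = mat 1" "w \<in> W \<Longrightarrow> w ** matrix_inv w = mat 1"
proof -
  have "matrix_inv w = transpose w" "transpose w ** w = mat 1" "w ** transpose w = mat 1" if "w \<in> W"
    using orthogonal_W[OF that] by (auto simp: orthogonal_matrix_def intro!: matrix_inv_eqI)
  then show "w \<in> W \<Longrightarrow> matrix_inv w ** w = mat 1" "w \<in> W \<Longrightarrow> w ** matrix_inv w = mat 1"
    by simp_all
qed

lemma invariant_iff: "invariant_poly W f \<longleftrightarrow> is_poly f \<and> (\<forall>w\<in>W. \<forall>x. f (capp w x) = f x)"
proof -
  have "(act w f = f) \<longleftrightarrow> (\<forall>x. f (capp w x) = f x)" if "w \<in> W" for w
  proof -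
    have "capp w (capp (matrix_inv w) x) = x" "capp (matrix_inv w) (capp w x) = x" for x
      using capp_W_inj[OF that] by (simp_all flip: capp_mult)
    then show ?thesis unfolding act_capp fun_eq_iff by metis
  qed
  then show ?thesis by (auto simp: invariant_poly_def)
qed

lemma bij_mult_W: "v \<in> W \<Longrightarrow> bij_betw (\<lambda>w. w ** v) W W"
proof -
  assume v: "v \<in> W"
  have "inj_on (\<lambda>w. w ** v) W"
    by (rule inj_onI) (metis capp_W_inj(2)[OF v] matrix_mul_assoc matrix_mul_rid)
  moreover have "(\<lambda>w. w ** v) ` W \<subseteq> W" using mult_W v by auto
  ultimately show ?thesis
    using endo_inj_surj[OF finite_W] unfolding bij_betw_def by blast
qed

lemma invariant_average:
  assumes "is_poly p"
  shows "invariant_poly W (\<lambda>x. \<Sum>w\<in>W. p (capp w x))"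
proof -
  have "(\<Sum>w\<in>W. p (capp w (capp v x))) = (\<Sum>w\<in>W. p (capp w x))" if "v \<in> W" for v x
    using sum.reindex_bij_betw[OF bij_mult_W[OF that], of "\<lambda>w. p (capp w x)"] by (simp add: capp_mult)
  moreover have "is_poly (\<lambda>x. \<Sum>w\<in>W. p (capp w x))"
    by (rule is_poly_sum, rule is_poly_capp[OF assms])
  ultimately show ?thesis
    unfolding invariant_iff by blast
qed

definition stab :: "complex^'n \<Rightarrow> (real^'n^'n) set" where
  "stab x = {w \<in> W. capp w x = x}"

text \<open>A bump at \<open>x0\<close>, flat to second order at the other points of the orbit. Multiplying by it
  before averaging prescribes the 2-jet of an invariant at \<open>x0\<close>.\<close>

lemma bump_exists:
  "\<exists>L. is_poly L \<and> L x0 \<noteq> 0 \<and> (\<forall>w\<in>W - stab x0. L (capp w x0) = 0 \<and>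
     (\<forall>i. partial i L (capp w x0) = 0) \<and> (\<forall>i j. partial j (partial i L) (capp w x0) = 0))"
proof -
  \<comment> \<open>An affine form vanishing at \<open>capp w x0\<close>. The conjugated
    coefficients make its value at \<open>x0\<close> the squared distance of the two points, which
    is nonzero if \<open>w\<close> moves \<open>x0\<close>.\<close>
  define l where "l w x = (\<Sum>i\<in>UNIV. cnj (x0 $ i - capp w x0 $ i) * (x $ i - capp w x0 $ i))" for w x
  define L where "L x = (\<Prod>w\<in>W - stab x0. l w x ^ 3)" for x
  have l: "is_poly (l w)" for w
    unfolding l_def[abs_def] by (intro is_poly_intros)
  have "l w x0 \<noteq> 0" if "w \<in> W - stab x0" for w
  proof -
    obtain i where "x0 $ i - capp w x0 $ i \<noteq> 0"
      using \<open>w \<in> W - stab x0\<close> by (auto simp: stab_def vec_eq_iff) (metis right_minus_eq)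
    moreover have "l w x0 = complex_of_real (\<Sum>i\<in>UNIV. (cmod (x0 $ i - capp w x0 $ i))\<^sup>2)"
      unfolding l_def of_real_sum complex_norm_square by (rule sum.cong[OF HOL.refl mult.commute])
    ultimately show ?thesis
      by (simp only: of_real_eq_0_iff) (subst sum_nonneg_eq_0_iff, auto)
  qed
  then have "L x0 \<noteq> 0" using finite_W by (simp add: L_def)
  moreover have "is_poly L"
    unfolding L_def[abs_def] by (intro is_poly_intros l)
  moreover have "L (capp w x0) = 0 \<and> (\<forall>i. partial i L (capp w x0) = 0) \<and>
     (\<forall>i j. partial j (partial i L) (capp w x0) = 0)" if "w \<in> W - stab x0" for w
  proof -
    define R where "R x = (\<Prod>w\<in>W - stab x0 - {w}. l w x ^ 3)" for x
    have R: "is_poly R"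
      unfolding R_def[abs_def] by (intro is_poly_intros l)
    have "L = (\<lambda>x. l w x * (l w x * (l w x * R x)))"
      using that finite_W unfolding L_def R_def
      by (intro ext, subst prod.remove[of _ w]) (simp_all add: power3_eq_cube mult.assoc)
    moreover have "l w (capp w x0) = 0" by (simp add: l_def)
    ultimately show ?thesis
      using flat_cube[OF l R] by simp
  qed
  ultimately show ?thesis by blast
qed

end

section \<open>The Jacobian of the basic invariants\<close>

lemma refl_matrix_nth:
  assumes "\<gamma> \<bullet> \<gamma> = 2"
  shows "refl_matrix \<gamma> $ i $ k = (if i = k then 1 else 0) - \<gamma> $ i * \<gamma> $ k"
proof -
  have "refl_matrix \<gamma> $ i $ k = (refl_matrix \<gamma> *v axis k 1) $ i"
    by (simp add: matrix_vector_mult_basis column_def)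
  then show ?thesis
    by (simp add: refl_matrix_mult assms inner_axis) (simp add: axis_def)
qed

lemma det_column_mul:
  fixes A :: "complex^'n^'n"
  shows "det (\<chi> i j. if j = k then c * b i else A $ i $ j) = c * det (\<chi> i j. if j = k then b i else A $ i $ j)"
proof -
  have tr: "transpose (\<chi> i j. if j = k then f i else A $ i $ j) =
      (\<chi> j. if j = k then (\<chi> i. f i) else (\<chi> i. A $ i $ j))" for f
    by (simp add: vec_eq_iff transpose_def)
  have scale: "(\<chi> i. c * b i) = c *s (\<chi> i. b i)"
    by (simp add: vec_eq_iff)
  have "det (transpose (\<chi> i j. if j = k then c * b i else A $ i $ j)) =
      c * det (transpose (\<chi> i j. if j = k then b i else A $ i $ j))"
    unfolding tr scale by (rule det_row_mul)
  then show ?thesis by (simp only: det_transpose)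
qed

lemma det_zero_kernel:
  fixes A :: "complex^'n^'n"
  shows "det A = 0 \<longleftrightarrow> (\<exists>v. v \<noteq> 0 \<and> A *v v = 0)"
  using invertible_det_nz[of A] matrix_left_invertible_ker[of A] invertible_left_inverse[of A] by metis

lemma poly_zero_punctured:
  assumes "\<And>z. z \<noteq> 0 \<Longrightarrow> poly p z = (0::complex)"
  shows "p = 0"
proof -
  have "poly (pCons 0 p) z = 0" for z using assms[of z] by auto
  then show ?thesis using poly_all_0_iff_0[of "pCons 0 p"] by simp
qed

context reflection_setup
begin

text \<open>These are the components of a \<open>W\<close>-invariant one-form: pulling back along
  \<open>w\<close> multiplies the row of coefficients by \<open>w\<close> from the right.\<close>

definition equivariant :: "('n \<Rightarrow> complex^'n \<Rightarrow> complex) \<Rightarrow> bool" where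
  "equivariant v \<longleftrightarrow>
     (\<forall>w\<in>W. \<forall>x k. (\<Sum>i\<in>UNIV. v i (capp w x) * complex_of_real (w $ i $ k)) = v k x)"

lemma capp_refl_invol: "\<gamma> \<in> P \<Longrightarrow> capp (refl_matrix \<gamma>) (capp (refl_matrix \<gamma>) x) = x"
  by (simp add: capp_refl P_root root_form_diff root_form_scale root_form_cplx vec_eq_iff)

text \<open>A reflection is an involution, so the transformation law can be read from
  \<open>x\<close> to its mirror image; the matrix \<open>1 - \<gamma> \<gamma>^T\<close> gives the
  correction term.\<close>

lemma equivariant_refl:
  assumes "equivariant v" "\<gamma> \<in> P"
  shows "v k (capp (refl_matrix \<gamma>) x) =
    v k x - complex_of_real (\<gamma> $ k) * (\<Sum>i\<in>UNIV. complex_of_real (\<gamma> $ i) * v i x)"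
proof -
  have "v k (capp (refl_matrix \<gamma>) x) = (\<Sum>i\<in>UNIV. v i x * complex_of_real (refl_matrix \<gamma> $ i $ k))"
    using assms(1) P_refl[OF assms(2)] capp_refl_invol[OF assms(2), of x]
    unfolding equivariant_def by metis
  also have "\<dots> = (\<Sum>i\<in>UNIV. (if i = k then v i x else 0) -
      complex_of_real (\<gamma> $ k) * (complex_of_real (\<gamma> $ i) * v i x))"
    by (intro sum.cong) (auto simp: refl_matrix_nth P_root assms(2) algebra_simps)
  finally show ?thesis
    by (simp add: sum_subtractf sum_distrib_left)
qed

lemma capp_refl_fixed: "\<gamma> \<in> P \<Longrightarrow> root_form \<gamma> x = 0 \<Longrightarrow> capp (refl_matrix \<gamma>) x = x"
  by (simp add: capp_refl P_root)

text \<open>The point is fixed by the reflection, so the correction term in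
  \<open>equivariant_refl\<close> must vanish.\<close>

lemma equivariant_hyperplane:
  assumes "equivariant v" "\<gamma> \<in> P" "root_form \<gamma> x = 0"
  shows "(\<Sum>i\<in>UNIV. complex_of_real (\<gamma> $ i) * v i x) = 0"
proof -
  obtain k where "\<gamma> $ k \<noteq> 0" using P_nonzero[OF assms(2)] by blast
  then show ?thesis
    using equivariant_refl[OF assms(1,2), of k x] capp_refl_fixed[OF assms(2,3)] by simp
qed

lemma equivariant_gradient:
  assumes "invariant_poly W f"
  shows "equivariant (\<lambda>i. partial i f)"
  unfolding equivariant_def
proof (intro ballI allI)
  fix w x k assume w: "w \<in> W"
  have "(\<lambda>x. f (capp w x)) = f" using assms w by (auto simp: invariant_iff)
  moreover have "is_poly f" using assms by (simp add: invariant_iff)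
  ultimately show "(\<Sum>i\<in>UNIV. partial i f (capp w x) * complex_of_real (w $ i $ k)) = partial k f x"
    using partial_capp[of f k w] by metis
qed

section \<open>Test invariants, and points with small stabilizer\<close>

lemma stab_one: "mat 1 \<in> stab x"
  by (simp add: stab_def one_W)

text \<open>Averaging \<open>x $ i - x0 $ i\<close> times a bump gives an invariant whose gradient
  at \<open>x0\<close> is, up to a nonzero factor, row \<open>i\<close> of the sum of the stabilizer
  elements.\<close>

lemma kernel_of_invariants:
  assumes "\<And>f. invariant_poly W f \<Longrightarrow> (\<Sum>k\<in>UNIV. partial k f x0 * v $ k) = 0"
  shows "(\<Sum>w\<in>stab x0. capp w v $ i) = 0"
proof -
  obtain L where L: "is_poly L" "L x0 \<noteq> 0" "\<And>w. w \<in> W - stab x0 \<Longrightarrow> L (capp w x0) = 0"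
    "\<And>w j. w \<in> W - stab x0 \<Longrightarrow> partial j L (capp w x0) = 0"
    using bump_exists[of x0] by blast
  define p where "p x = (x $ i - x0 $ i) * L x" for x
  have lin: "is_poly (\<lambda>x. x $ i - x0 $ i)" by (intro is_poly_intros)
  have dlin: "partial j (\<lambda>x. x $ i - x0 $ i) = (\<lambda>x. if j = i then 1 else 0)" for j
    by (simp add: partial_diff partial_coord partial_const is_poly_intros)
  have p: "is_poly p" unfolding p_def[abs_def] by (intro is_poly_mult lin L)
  have dp: "partial j p = (\<lambda>x. (if j = i then 1 else 0) * L x + (x $ i - x0 $ i) * partial j L x)" for j
    unfolding p_def[abs_def] partial_mult[OF lin L(1)] dlin ..
  define f where "f x = (\<Sum>w\<in>W. p (capp w x))" for x
  have f: "invariant_poly W f" unfolding f_def[abs_def] by (rule invariant_average[OF p])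
  have df: "partial k f x0 = L x0 * (\<Sum>w\<in>stab x0. complex_of_real (w $ i $ k))" for k
  proof -
    have "partial k f x0 = (\<Sum>w\<in>W. \<Sum>j\<in>UNIV. partial j p (capp w x0) * complex_of_real (w $ j $ k))"
      unfolding f_def[abs_def] by (simp add: partial_sum partial_capp[OF p] is_poly_capp[OF p])
    also have "\<dots> = (\<Sum>w\<in>stab x0. L x0 * complex_of_real (w $ i $ k))"
    proof (rule sum.mono_neutral_cong_right)
      show "finite W" "stab x0 \<subseteq> W" by (auto simp: finite_W stab_def)
      show "\<forall>w\<in>W - stab x0. (\<Sum>j\<in>UNIV. partial j p (capp w x0) * complex_of_real (w $ j $ k)) = 0"
        by (simp add: dp L)
      show "(\<Sum>j\<in>UNIV. partial j p (capp w x0) * complex_of_real (w $ j $ k)) = L x0 * complex_of_real (w $ i $ k)"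
        if "w \<in> stab x0" for w
        using that by (simp add: dp stab_def if_distrib[of "\<lambda>c. c * _"] cong: if_cong)
    qed
    finally show ?thesis by (simp add: sum_distrib_left)
  qed
  have "0 = (\<Sum>k\<in>UNIV. \<Sum>w\<in>stab x0. L x0 * (complex_of_real (w $ i $ k) * v $ k))"
    using assms[OF f] unfolding df by (simp add: sum_distrib_left sum_distrib_right mult.assoc)
  also have "\<dots> = (\<Sum>w\<in>stab x0. \<Sum>k\<in>UNIV. L x0 * (complex_of_real (w $ i $ k) * v $ k))"
    by (rule sum.swap)
  also have "\<dots> = L x0 * (\<Sum>w\<in>stab x0. capp w v $ i)"
    by (simp add: capp_nth sum_distrib_left)
  finally show ?thesis using L(2) by simp
qed

text \<open>At a generic point of a hyperplane some invariant has a nondegenerate quadratic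
  dependence on the normal coordinate.\<close>

lemma normal_invariant_exists:
  assumes \<gamma>: "\<gamma> \<in> P" and x0: "root_form \<gamma> x0 = 0" "stab x0 = {mat 1, refl_matrix \<gamma>}"
  shows "\<exists>f. invariant_poly W f \<and> (\<forall>k. partial k f x0 = 0) \<and>
    (\<forall>b. is_poly b \<longrightarrow> (\<forall>x. (\<Sum>k\<in>UNIV. complex_of_real (\<gamma> $ k) * partial k f x) = root_form \<gamma> x * b x) \<longrightarrow>
       b x0 \<noteq> 0)"
proof -
  obtain L where L: "is_poly L" "L x0 \<noteq> 0" "\<And>w. w \<in> W - stab x0 \<Longrightarrow> L (capp w x0) = 0"
    "\<And>w j. w \<in> W - stab x0 \<Longrightarrow> partial j L (capp w x0) = 0"
    "\<And>w i j. w \<in> W - stab x0 \<Longrightarrow> partial j (partial i L) (capp w x0) = 0"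
    using bump_exists[of x0] by blast
  define r where "r = root_form \<gamma>"
  define g where "g i = complex_of_real (\<gamma> $ i)" for i
  have r: "is_poly r" unfolding r_def by (rule is_poly_root_form)
  have r0: "r x0 = 0" using x0 by (simp add: r_def)
  have dr: "partial i r = (\<lambda>x. g i)" for i
    by (rule ext) (simp add: r_def g_def partial_root_form)
  \<comment> \<open>The square of the normal coordinate survives averaging, as the reflection only
    changes the sign of \<open>r\<close>.\<close>
  define p where "p x = r x * (r x * L x)" for x
  have p: "is_poly p" unfolding p_def[abs_def] by (intro is_poly_mult r L)
  have dp: "partial i p = (\<lambda>x. r x * (2 * g i * L x + r x * partial i L x))" for i
    unfolding p_def[abs_def]
    by (simp add: partial_mult r L is_poly_mult dr algebra_simps)
  have ddp: "partial j (partial i p) = (\<lambda>x. g j * (2 * g i * L x + r x * partial i L x) +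
      r x * (2 * g i * partial j L x + (g j * partial i L x + r x * partial j (partial i L) x)))" for i j
    unfolding dp
    by (simp add: partial_mult partial_add partial_const r L is_poly_mult is_poly_add is_poly_const
        is_poly_partial dr mult.assoc)
  define f where "f x = (\<Sum>w\<in>W. p (capp w x))" for x
  have f: "invariant_poly W f" unfolding f_def[abs_def] by (rule invariant_average[OF p])
  have df: "partial k f = (\<lambda>x. \<Sum>w\<in>W. \<Sum>i\<in>UNIV. partial i p (capp w x) * complex_of_real (w $ i $ k))" for k
    unfolding f_def[abs_def] by (simp add: partial_sum partial_capp[OF p] is_poly_capp[OF p])
  have df0: "partial k f x0 = 0" for k
    unfolding df
  proof (intro sum.neutral ballI)
    fix w i assume "w \<in> W"
    show "partial i p (capp w x0) * complex_of_real (w $ i $ k) = 0"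
      using \<open>w \<in> W\<close> L r0 by (cases "w \<in> stab x0") (auto simp: dp stab_def)
  qed
  have dq: "is_poly (\<lambda>x. partial i p (capp w x) * complex_of_real (w $ i $ k))" for w i k
    by (intro is_poly_mult is_poly_const is_poly_capp is_poly_partial p)
  have ddf: "partial j (partial k f) x0 = (\<Sum>w\<in>W. \<Sum>i\<in>UNIV. \<Sum>l\<in>UNIV.
      partial l (partial i p) (capp w x0) * complex_of_real (w $ l $ j) * complex_of_real (w $ i $ k))" for j k
    unfolding df
    by (simp add: partial_sum dq is_poly_sum partial_mult is_poly_const partial_const
        is_poly_capp[OF is_poly_partial[OF p]] partial_capp[OF is_poly_partial[OF p]] sum_distrib_right)
  have sg: "(\<Sum>i\<in>UNIV. g i * complex_of_real (refl_matrix \<gamma> $ i $ k)) = - g k" for k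
  proof -
    have "(\<Sum>i\<in>UNIV. g i * complex_of_real (refl_matrix \<gamma> $ i $ k)) =
        (\<Sum>i\<in>UNIV. (if i = k then g i else 0) - g k * (g i * g i))"
      by (intro sum.cong) (auto simp: refl_matrix_nth P_root \<gamma> g_def algebra_simps)
    also have "\<dots> = g k - g k * 2"
      using sum_root_square[OF P_root[OF \<gamma>]] by (simp add: sum_subtractf g_def flip: sum_distrib_left)
    finally show ?thesis by simp
  qed
  have og: "(\<Sum>i\<in>UNIV. g i * complex_of_real (mat 1 $ i $ k)) = g k" for k
    by (simp add: mat_def if_distrib[of complex_of_real] if_distrib[of "\<lambda>c. _ * c"] cong: if_cong)
  have ddf0: "partial j (partial k f) x0 = 4 * L x0 * g j * g k" for j k
  proof -
    have "partial j (partial k f) x0 = (\<Sum>w\<in>stab x0. 2 * L x0 *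
        ((\<Sum>i\<in>UNIV. g i * complex_of_real (w $ i $ j)) * (\<Sum>i\<in>UNIV. g i * complex_of_real (w $ i $ k))))"
      unfolding ddf
    proof (rule sum.mono_neutral_cong_right)
      show "finite W" "stab x0 \<subseteq> W" by (auto simp: finite_W stab_def)
      show "\<forall>w\<in>W - stab x0. (\<Sum>i\<in>UNIV. \<Sum>l\<in>UNIV.
          partial l (partial i p) (capp w x0) * complex_of_real (w $ l $ j) * complex_of_real (w $ i $ k)) = 0"
        by (simp add: ddp L)
      show "(\<Sum>i\<in>UNIV. \<Sum>l\<in>UNIV.
          partial l (partial i p) (capp w x0) * complex_of_real (w $ l $ j) * complex_of_real (w $ i $ k)) =
        2 * L x0 * ((\<Sum>i\<in>UNIV. g i * complex_of_real (w $ i $ j)) * (\<Sum>i\<in>UNIV. g i * complex_of_real (w $ i $ k)))"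
        if "w \<in> stab x0" for w
      proof -
        have "capp w x0 = x0" using that by (simp add: stab_def)
        then have "(\<Sum>i\<in>UNIV. \<Sum>l\<in>UNIV.
          partial l (partial i p) (capp w x0) * complex_of_real (w $ l $ j) * complex_of_real (w $ i $ k)) =
          (\<Sum>i\<in>UNIV. \<Sum>l\<in>UNIV. 2 * L x0 * ((g l * complex_of_real (w $ l $ j)) * (g i * complex_of_real (w $ i $ k))))"
          by (simp add: ddp r0 mult_ac)
        also have "\<dots> = 2 * L x0 * (\<Sum>l\<in>UNIV. \<Sum>i\<in>UNIV. (g l * complex_of_real (w $ l $ j)) * (g i * complex_of_real (w $ i $ k)))"
          by (subst sum.swap) (simp add: sum_distrib_left)
        finally show ?thesis by (simp add: sum_product)
      qed
    qed
    moreover have "mat 1 \<noteq> refl_matrix \<gamma>"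
    proof
      assume "mat 1 = refl_matrix \<gamma>"
      then have "\<gamma> = - \<gamma>" using refl_matrix_self[OF P_root[OF \<gamma>]] by (metis matrix_vector_mul_lid)
      then show False using P_nonzero[OF \<gamma>] by (auto simp: vec_eq_iff)
    qed
    ultimately show ?thesis by (simp add: x0(2) sg og)
  qed
  have "b x0 \<noteq> 0" if b: "is_poly b" "\<And>x. (\<Sum>k\<in>UNIV. g k * partial k f x) = r x * b x" for b
  proof -
    obtain j where j: "\<gamma> $ j \<noteq> 0" using P_nonzero[OF \<gamma>] by blast
    have pf: "is_poly f" using f by (simp add: invariant_iff)
    have "(\<lambda>x. \<Sum>k\<in>UNIV. g k * partial k f x) = (\<lambda>x. r x * b x)" using b(2) by auto
    \<comment> \<open>Differentiating \<open>r * b\<close> at \<open>x0\<close> isolates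
      \<open>b x0\<close>, since \<open>r\<close> vanishes there. Its value is
      \<open>8 * L x0\<close>: the factor 4 comes from a square and two stabilizer elements, the
      factor 2 from the length of the root.\<close>
    then have "partial j (\<lambda>x. \<Sum>k\<in>UNIV. g k * partial k f x) x0 = partial j (\<lambda>x. r x * b x) x0"
      by (rule arg_cong)
    moreover have "partial j (\<lambda>x. \<Sum>k\<in>UNIV. g k * partial k f x) x0 =
        (\<Sum>k\<in>UNIV. g k * partial j (partial k f) x0)"
      by (simp add: partial_sum partial_cmult is_poly_partial[OF pf] is_poly_cmult)
    moreover have "partial j (\<lambda>x. r x * b x) x0 = g j * b x0"
      by (simp add: partial_mult[OF r b(1)] dr r0)
    ultimately have "(\<Sum>k\<in>UNIV. g k * partial j (partial k f) x0) = g j * b x0"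
      by (simp only:)
    moreover have "(\<Sum>k\<in>UNIV. g k * partial j (partial k f) x0) = 4 * L x0 * g j * (\<Sum>k\<in>UNIV. g k * g k)"
      by (simp add: ddf0 sum_distrib_left mult_ac)
    ultimately have "g j * b x0 = 8 * L x0 * g j"
      using sum_root_square[OF P_root[OF \<gamma>]] by (simp add: g_def)
    then show ?thesis using L(2) j by (auto simp: g_def)
  qed
  then show ?thesis
    using f df0 unfolding g_def r_def by blast
qed

text \<open>Every group element other than these two moves some point of the hyperplane, hence its
  generic points. Multiplying \<open>f\<close> by the displacements takes care of the exceptional
  ones.\<close>

lemma hyperplane_generic:
  assumes \<gamma>: "\<gamma> \<in> P" and f: "is_poly f"
    and *: "\<And>x. root_form \<gamma> x = 0 \<Longrightarrow> stab x = {mat 1, refl_matrix \<gamma>} \<Longrightarrow> f x = 0"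
    and x: "root_form \<gamma> x = 0"
  shows "f x = 0"
proof -
  define W' where "W' = W - {mat 1, refl_matrix \<gamma>}"
  have "\<exists>i. \<exists>x. capp w (hproj \<gamma> x) $ i - hproj \<gamma> x $ i \<noteq> 0" if "w \<in> W'" for w
  proof -
    have w: "w \<in> W" "w \<noteq> mat 1" "w \<noteq> refl_matrix \<gamma>" using that by (auto simp: W'_def)
    then obtain x where "root_form \<gamma> x = 0" "capp w x \<noteq> x"
      using hyperplane_fixed[OF w(1) \<gamma>] by blast
    then obtain i where "capp w x $ i - x $ i \<noteq> 0" "hproj \<gamma> x = x"
      using hproj_id[of \<gamma> x] by (auto simp: vec_eq_iff)
    then show ?thesis by (intro exI[of _ i] exI[of _ x]) simp
  qed
  then obtain i where i: "\<And>w. w \<in> W' \<Longrightarrow> \<exists>x. capp w (hproj \<gamma> x) $ i w - hproj \<gamma> x $ i w \<noteq> 0"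
    by metis
  define h where "h w x = capp w (hproj \<gamma> x) $ i w - hproj \<gamma> x $ i w" for w x
  have h: "is_poly (h w)" for w
  proof -
    have "is_poly (\<lambda>x. capp w x $ i w - x $ i w)"
      unfolding capp_nth by (intro is_poly_intros)
    from is_poly_hproj[OF this] show ?thesis unfolding h_def[abs_def] .
  qed
  have fin: "finite W'" by (simp add: W'_def finite_W)
  obtain y where y: "\<forall>w\<in>W'. h w y \<noteq> 0"
    using is_poly_common_nonzero[OF fin, of h] h i by (auto simp: h_def)
  have "f (hproj \<gamma> x) = 0" for x
  proof (rule is_poly_mult_eq_0[where f = "\<lambda>x. \<Prod>w\<in>W'. h w x" and g = "\<lambda>x. f (hproj \<gamma> x)" and y = y])
    show "is_poly (\<lambda>x. \<Prod>w\<in>W'. h w x)" by (intro is_poly_prod h)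
    show "is_poly (\<lambda>x. f (hproj \<gamma> x))" by (rule is_poly_hproj[OF f])
    show "(\<Prod>w\<in>W'. h w y) \<noteq> 0" using y fin by simp
    show "(\<Prod>w\<in>W'. h w x) * f (hproj \<gamma> x) = 0" for x
    proof (cases "\<forall>w\<in>W'. h w x \<noteq> 0")
      case True
      have 0: "root_form \<gamma> (hproj \<gamma> x) = 0" by (rule root_form_hproj[OF P_root[OF \<gamma>]])
      have "capp w (hproj \<gamma> x) \<noteq> hproj \<gamma> x" if "w \<in> W'" for w
      proof
        assume "capp w (hproj \<gamma> x) = hproj \<gamma> x"
        then have "h w x = 0" by (simp add: h_def)
        with True that show False by blast
      qed
      then have "stab (hproj \<gamma> x) = {mat 1, refl_matrix \<gamma>}"
        using one_W P_refl[OF \<gamma>] capp_refl_fixed[OF \<gamma> 0] by (auto simp: stab_def W'_def)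
      then show ?thesis using *[OF 0] by simp
    qed (use fin in auto)
  qed
  then show ?thesis using hproj_id[OF x] by metis
qed

text \<open>The line avoids all fixed point sets of codimension at least two. A polynomial which vanishes
  only on their union is constant on it.\<close>

lemma generic_line_exists:
  "\<exists>p q. stab q = {mat 1} \<and> (\<forall>z. stab (p + z *s q) = {mat 1} \<or>
     (\<exists>\<gamma>\<in>P. root_form \<gamma> (p + z *s q) = 0 \<and> stab (p + z *s q) = {mat 1, refl_matrix \<gamma>}))"
proof -
  have "\<exists>q. \<forall>w\<in>W - {mat 1}. capp w q \<noteq> q"
  proof -
    have "\<exists>i. \<exists>x. capp w x $ i - x $ i \<noteq> 0" if "w \<in> W - {mat 1}" for w
    proof (rule ccontr)
      assume "\<not> ?thesis"
      then have "capp w (cplx v) = cplx v" for v by (simp add: vec_eq_iff)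
      then have "w *v v = v" for v by (simp add: capp_cplx cplx_eq_iff)
      then have "w = mat 1" by (simp add: matrix_eq)
      then show False using that by simp
    qed
    then obtain i where i: "\<And>w. w \<in> W - {mat 1} \<Longrightarrow> \<exists>x. capp w x $ i w - x $ i w \<noteq> 0"
      by metis
    have "\<exists>x. \<forall>w\<in>W - {mat 1}. capp w x $ i w - x $ i w \<noteq> 0"
    proof (rule is_poly_common_nonzero)
      show "is_poly (\<lambda>x. capp w x $ i w - x $ i w)" for w
        unfolding capp_nth by (intro is_poly_intros)
    qed (use i finite_W in auto)
    then obtain x where "\<forall>w\<in>W - {mat 1}. capp w x $ i w - x $ i w \<noteq> 0" by blast
    then show ?thesis by (intro exI[of _ x]) force
  qed
  then obtain q where q: "\<And>w. w \<in> W \<Longrightarrow> w \<noteq> mat 1 \<Longrightarrow> capp w q \<noteq> q" by blast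
  have stq: "stab q = {mat 1}" using q one_W by (auto simp: stab_def)
  define W' where "W' = W - {mat 1} - refl_matrix ` P"
  have "\<exists>g. is_poly g \<and> (\<exists>x. g x \<noteq> 0) \<and> (\<forall>p. g p \<noteq> 0 \<longrightarrow> (\<forall>z. capp w (p + z *s q) \<noteq> p + z *s q))"
    if "w \<in> W'" for w
  proof -
    have w: "w \<in> W" "w \<noteq> mat 1" "\<not> (\<exists>\<delta>\<in>P. w = refl_matrix \<delta>)"
      using that by (auto simp: W'_def)
    define D where "D x = capp w x - x" for x
    have D: "is_poly (\<lambda>x. D x $ j)" for j
      unfolding D_def vector_minus_component capp_nth by (intro is_poly_intros)
    have "D q \<noteq> 0" using q[OF w(1,2)] by (simp add: D_def)
    then obtain i where i: "D q $ i \<noteq> 0" by (auto simp: vec_eq_iff)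
    \<comment> \<open>If all these minors vanished, \<open>w - 1\<close> would have rank one and
      \<open>w\<close> would be a reflection. A nonzero minor at \<open>p\<close> makes
      \<open>D p\<close> and \<open>D q\<close> independent, so \<open>w\<close> fixes no point of
      the line.\<close>
    have "\<exists>y j. D y $ j * D q $ i - D y $ i * D q $ j \<noteq> 0"
    proof (rule ccontr)
      assume "\<not> ?thesis"
      then have "D y $ j * D q $ i - D y $ i * D q $ j = 0" for y j by blast
      then have *: "D y $ j * D q $ i = D y $ i * D q $ j" for y j by (simp only: right_minus_eq)
      have "D y $ j = D y $ i / D q $ i * D q $ j" for y j
        using eq_divide_imp[OF i *[of y j]] by (simp only: times_divide_eq_left)
      then have "D y = (D y $ i / D q $ i) *s D q" for y
        unfolding vec_eq_iff vector_smult_component by blast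
      then have "capp w y - y = (D y $ i / D q $ i) *s D q" for y
        unfolding D_def .
      then have "\<exists>\<delta>\<in>P. w = refl_matrix \<delta>"
        by (intro rank_one_in_P[OF w(1,2), of "D q"]) blast
      with w(3) show False by blast
    qed
    then obtain y j where yj: "D y $ j * D q $ i - D y $ i * D q $ j \<noteq> 0" by blast
    show ?thesis
    proof (intro exI[of _ "\<lambda>x. D x $ j * D q $ i - D x $ i * D q $ j"] conjI allI impI)
      show "is_poly (\<lambda>x. D x $ j * D q $ i - D x $ i * D q $ j)"
        by (intro is_poly_diff is_poly_mult is_poly_const D)
      show "\<exists>x. D x $ j * D q $ i - D x $ i * D q $ j \<noteq> 0" using yj by blast
      fix p z assume p: "D p $ j * D q $ i - D p $ i * D q $ j \<noteq> 0"
      show "capp w (p + z *s q) \<noteq> p + z *s q"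
      proof
        assume "capp w (p + z *s q) = p + z *s q"
        moreover have "D p $ k + z * D q $ k = capp w (p + z *s q) $ k - (p + z *s q) $ k" for k
          by (simp add: D_def capp_add capp_scale algebra_simps)
        ultimately have "D p $ k + z * D q $ k = 0" for k by simp
        then have "D p $ i = - z * D q $ i" "D p $ j = - z * D q $ j"
          by (simp_all add: eq_neg_iff_add_eq_0)
        with p show False by simp
      qed
    qed
  qed
  then have "\<exists>g. \<forall>w\<in>W'. is_poly (g w) \<and> (\<exists>x. g w x \<noteq> 0) \<and>
      (\<forall>p. g w p \<noteq> 0 \<longrightarrow> (\<forall>z. capp w (p + z *s q) \<noteq> p + z *s q))"
    by (intro bchoice ballI)
  then obtain g where g: "\<And>w. w \<in> W' \<Longrightarrow> is_poly (g w)" "\<And>w. w \<in> W' \<Longrightarrow> \<exists>x. g w x \<noteq> 0"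
    "\<And>w p z. w \<in> W' \<Longrightarrow> g w p \<noteq> 0 \<Longrightarrow> capp w (p + z *s q) \<noteq> p + z *s q"
    by blast
  define Q where "Q = {(\<gamma>, \<delta>). \<gamma> \<in> P \<and> \<delta> \<in> P \<and> \<gamma> \<noteq> \<delta>}"
  \<comment> \<open>Nonzero exactly if the line meets the two hyperplanes at different parameters;
    no root form vanishes at \<open>q\<close>.\<close>
  define k where "k = (\<lambda>(\<gamma>, \<delta>) p. root_form \<gamma> p * root_form \<delta> q - root_form \<gamma> q * root_form \<delta> p)"
  have rq: "root_form \<gamma> q \<noteq> 0" if "\<gamma> \<in> P" for \<gamma>
  proof
    assume "root_form \<gamma> q = 0"
    then have "refl_matrix \<gamma> \<in> stab q" using that by (simp add: stab_def P_refl capp_refl_fixed)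
    then have "refl_matrix \<gamma> *v \<gamma> = \<gamma>" by (simp add: stq)
    then have "\<gamma> = - \<gamma>" using refl_matrix_self[OF P_root[OF that]] by simp
    then show False using P_nonzero[OF that] by (auto simp: vec_eq_iff)
  qed
  have k: "is_poly (k e)" for e
    by (cases e) (auto simp: k_def intro!: is_poly_intros)
  have k0: "\<exists>x. k e x \<noteq> 0" if e: "e \<in> Q" for e
  proof -
    obtain \<gamma> \<delta> where [simp]: "e = (\<gamma>, \<delta>)" by (cases e)
    have P: "\<gamma> \<in> P" "\<delta> \<in> P" "\<delta> \<noteq> \<gamma>" using e by (auto simp: Q_def)
    then obtain x where "root_form \<gamma> x = 0" "root_form \<delta> x \<noteq> 0"
      using hyperplane_subset_eq[OF P(1,2)] by blast
    then show ?thesis using rq[OF P(1)] by (intro exI[of _ x]) (simp add: k_def)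
  qed
  have "finite W'" "finite Q"
    using finite_W finite_subset[of Q "P \<times> P"] finite_P by (auto simp: W'_def Q_def)
  then have "\<exists>x. \<forall>e\<in>W' <+> Q. (case e of Inl w \<Rightarrow> g w | Inr e \<Rightarrow> k e) x \<noteq> 0"
    by (intro is_poly_common_nonzero) (use g k k0 in \<open>auto split: sum.splits\<close>)
  then obtain p where p: "\<forall>e\<in>W' <+> Q. (case e of Inl w \<Rightarrow> g w | Inr e \<Rightarrow> k e) p \<noteq> 0" by blast
  have p1: "g w p \<noteq> 0" if "w \<in> W'" for w using p that by (auto dest!: bspec[of _ _ "Inl w"])
  have p2: "k e p \<noteq> 0" if "e \<in> Q" for e using p that by (auto dest!: bspec[of _ _ "Inr e"])
  have unique: "\<gamma> = \<delta>" if "\<gamma> \<in> P" "\<delta> \<in> P" "root_form \<gamma> (p + z *s q) = 0" "root_form \<delta> (p + z *s q) = 0" for \<gamma> \<delta> z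
  proof (rule ccontr)
    assume "\<gamma> \<noteq> \<delta>"
    then have "k (\<gamma>, \<delta>) p \<noteq> 0" using that by (intro p2) (auto simp: Q_def)
    moreover have "root_form \<gamma> p = - z * root_form \<gamma> q" "root_form \<delta> p = - z * root_form \<delta> q"
      using that by (auto simp: root_form_add root_form_scale add_eq_0_iff2)
    ultimately show False by (simp add: k_def)
  qed
  have "stab (p + z *s q) = {mat 1} \<or>
     (\<exists>\<gamma>\<in>P. root_form \<gamma> (p + z *s q) = 0 \<and> stab (p + z *s q) = {mat 1, refl_matrix \<gamma>})" for z
  proof (cases "stab (p + z *s q) = {mat 1}")
    case False
    have refl_in: "\<exists>\<gamma>\<in>P. w = refl_matrix \<gamma> \<and> root_form \<gamma> (p + z *s q) = 0"
      if w: "w \<in> stab (p + z *s q)" "w \<noteq> mat 1" for w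
    proof -
      have "w \<notin> W'" using g(3)[OF _ p1] w by (auto simp: stab_def)
      then obtain \<gamma> where \<gamma>: "\<gamma> \<in> P" "w = refl_matrix \<gamma>" using w by (auto simp: W'_def stab_def)
      have "capp (refl_matrix \<gamma>) (p + z *s q) = p + z *s q"
        using w(1) \<gamma>(2) by (simp add: stab_def)
      then have "root_form \<gamma> (p + z *s q) *s cplx \<gamma> = 0"
        unfolding capp_refl[OF P_root[OF \<gamma>(1)]] by (simp only: diff_eq_eq) simp
      moreover obtain i where "\<gamma> $ i \<noteq> 0" using P_nonzero[OF \<gamma>(1)] by blast
      ultimately show ?thesis using \<gamma> by (auto simp: vec_eq_iff)
    qed
    obtain w where "w \<in> stab (p + z *s q)" "w \<noteq> mat 1" using False stab_one by blast
    then obtain \<gamma> where \<gamma>: "\<gamma> \<in> P" "root_form \<gamma> (p + z *s q) = 0" "refl_matrix \<gamma> \<in> stab (p + z *s q)"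
      using refl_in by blast
    have "stab (p + z *s q) = {mat 1, refl_matrix \<gamma>}"
      using refl_in unique[OF \<gamma>(1) _ \<gamma>(2)] \<gamma>(3) stab_one by blast
    then show ?thesis using \<gamma> by blast
  qed simp
  then show ?thesis using stq by blast
qed

end

section \<open>The Jacobian determinant as a multiple of the product of the positive roots\<close>

locale invariants_setup = reflection_setup W P
  for W :: "(real^'n^'n::finite) set" and P +
  fixes d :: "'n \<Rightarrow> nat" and t :: "'n \<Rightarrow> complex^'n \<Rightarrow> complex"
  assumes basic: "basic_invariants W d t"
begin

lemma t_invariant: "invariant_poly W (t a)"
  and t_eul: "eul (of_nat (d a)) (t a)"
  using basic by (auto simp: basic_invariants_def intro: eul_homogeneous)

lemma t_poly: "is_poly (t a)"
  by (rule eul_is_poly[OF t_eul])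

abbreviation dt :: "'n \<Rightarrow> 'n \<Rightarrow> complex^'n \<Rightarrow> complex" where
  "dt k a \<equiv> partial k (t a)"

definition T :: "complex^'n \<Rightarrow> complex^'n" where
  "T x = (\<chi> a. t a x)"

lemma T_nth [simp]: "T x $ a = t a x"
  by (simp add: T_def)

lemma invariant_through_T: "invariant_poly W f \<Longrightarrow> \<exists>F. is_poly F \<and> (\<forall>x. f x = F (T x))"
  using basic unfolding basic_invariants_def T_def by metis

lemma is_poly_T: "is_poly F \<Longrightarrow> is_poly (\<lambda>x. F (T x))"
  unfolding T_def by (rule is_poly_compose) (auto intro: t_poly)

lemma partial_T:
  "is_poly F \<Longrightarrow> partial k (\<lambda>x. F (T x)) = (\<lambda>x. \<Sum>a\<in>UNIV. partial a F (T x) * dt k a x)"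
  unfolding T_def by (rule partial_compose) (auto intro: t_poly)

definition J :: "complex^'n \<Rightarrow> complex^'n^'n" where
  "J x = (\<chi> a i. dt i a x)"

lemma J_nth [simp]: "J x $ a $ i = dt i a x"
  by (simp add: J_def)

lemma is_poly_J: "is_poly (dt i a)"
  by (rule is_poly_partial[OF t_poly])

lemma is_poly_detJ: "is_poly (\<lambda>x. det (J x))"
  by (rule is_poly_det) (simp add: is_poly_J)

lemma gradient_kernel:
  assumes "J x *v v = 0" "invariant_poly W f"
  shows "(\<Sum>k\<in>UNIV. partial k f x * v $ k) = 0"
proof -
  obtain F where F: "is_poly F" "f = (\<lambda>x. F (T x))"
    using invariant_through_T[OF assms(2)] by blast
  have Jv: "(\<Sum>k\<in>UNIV. dt k a x * v $ k) = 0" for a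
    using arg_cong[OF assms(1), of "\<lambda>u. u $ a"] by (simp add: matrix_vector_mult_def)
  have "(\<Sum>k\<in>UNIV. partial k f x * v $ k) =
      (\<Sum>k\<in>UNIV. \<Sum>a\<in>UNIV. partial a F (T x) * (dt k a x * v $ k))"
    unfolding F(2) partial_T[OF F(1)] by (simp add: sum_distrib_right mult.assoc)
  also have "\<dots> = (\<Sum>a\<in>UNIV. partial a F (T x) * (\<Sum>k\<in>UNIV. dt k a x * v $ k))"
    by (subst sum.swap) (simp add: sum_distrib_left)
  finally show ?thesis by (simp add: Jv)
qed

lemma detJ_nonzero_if_stab_trivial:
  assumes "stab x = {mat 1}"
  shows "det (J x) \<noteq> 0"
proof
  assume "det (J x) = 0"
  then obtain v where v: "v \<noteq> 0" "J x *v v = 0" using det_zero_kernel by blast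
  have "(\<Sum>w\<in>stab x. capp w v $ i) = 0" for i
    by (rule kernel_of_invariants) (rule gradient_kernel[OF v(2)])
  then have "v = 0" by (simp add: assms vec_eq_iff)
  with v(1) show False ..
qed

lemma refl_matrix_not_one: "\<gamma> \<in> P \<Longrightarrow> refl_matrix \<gamma> \<noteq> mat 1"
proof
  assume "\<gamma> \<in> P" "refl_matrix \<gamma> = mat 1"
  then have "- \<gamma> = \<gamma>" using refl_matrix_self[OF P_root, of \<gamma>] by simp
  then show False using P_nonzero[OF \<open>\<gamma> \<in> P\<close>] by (auto simp: vec_eq_iff)
qed

text \<open>Annihilation by the sum over the two-element stabilizer puts \<open>v\<close> into the
  -1 eigenspace of the reflection.\<close>

lemma kernel_on_hyperplane:
  assumes "\<gamma> \<in> P" "stab x = {mat 1, refl_matrix \<gamma>}" "J x *v v = 0"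
  shows "v = (root_form \<gamma> v / 2) *s cplx \<gamma>"
proof -
  have "(\<Sum>w\<in>stab x. capp w v $ i) = 0" for i
    by (rule kernel_of_invariants) (rule gradient_kernel[OF assms(3)])
  then have "v $ i + capp (refl_matrix \<gamma>) v $ i = 0" for i
    using refl_matrix_not_one[OF assms(1)] by (simp add: assms(2))
  then have "2 * v $ i = root_form \<gamma> v * complex_of_real (\<gamma> $ i)" for i
    by (simp add: capp_refl P_root assms(1))
  then have "v $ i = root_form \<gamma> v / 2 * complex_of_real (\<gamma> $ i)" for i
    by (simp add: field_simps)
  then show ?thesis by (simp only: vec_eq_iff vector_smult_component cplx_nth) simp
qed

lemma equivariant_J: "equivariant (\<lambda>i. dt i a)"
  by (rule equivariant_gradient[OF t_invariant])

lemma normal_derivative: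
  assumes "invariant_poly W f" "\<gamma> \<in> P"
  shows "\<exists>b. is_poly b \<and>
    (\<forall>x. (\<Sum>k\<in>UNIV. complex_of_real (\<gamma> $ k) * partial k f x) = root_form \<gamma> x * b x)"
proof (rule root_form_dvd)
  have "is_poly f" using assms by (simp add: invariant_iff)
  then show "is_poly (\<lambda>x. \<Sum>k\<in>UNIV. complex_of_real (\<gamma> $ k) * partial k f x)"
    by (intro is_poly_sum is_poly_mult is_poly_const is_poly_partial)
qed (use assms in \<open>auto simp: P_root equivariant_hyperplane[OF equivariant_gradient]\<close>)

lemma J_root:
  assumes "\<gamma> \<in> P" "root_form \<gamma> x = 0"
  shows "J x *v cplx \<gamma> = 0"
  using equivariant_hyperplane[OF equivariant_J assms]
  by (simp add: vec_eq_iff matrix_vector_mult_def mult.commute)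

lemma cplx_root_nonzero: "\<gamma> \<in> P \<Longrightarrow> cplx \<gamma> \<noteq> 0"
  using P_nonzero[of \<gamma>] by (auto simp: vec_eq_iff)

lemma detJ_factor:
  "\<exists>K. is_poly K \<and> (\<forall>x. det (J x) = Delta x * K x)"
proof (rule Delta_dvd[OF is_poly_detJ])
  fix \<gamma> x assume "\<gamma> \<in> P" "root_form \<gamma> x = 0"
  then show "det (J x) = 0"
    unfolding det_zero_kernel using J_root cplx_root_nonzero by blast
qed

text \<open>The determinant vanishes only to first order: dividing the normal derivative by the root
  form leaves an invertible matrix. A kernel vector with nonzero \<open>j\<close> component would
  make the normal part of the invariant from \<open>normal_invariant_exists\<close> degenerate, and
  one with zero \<open>j\<close> component would be a multiple of the root.\<close>

lemma cofactor_nonzero_on_hyperplane: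
  assumes K: "is_poly K" "\<And>x. det (J x) = Delta x * K x"
    and \<gamma>: "\<gamma> \<in> P" and x0: "root_form \<gamma> x0 = 0" "stab x0 = {mat 1, refl_matrix \<gamma>}"
  shows "K x0 \<noteq> 0"
proof
  assume K0: "K x0 = 0"
  obtain j where j: "\<gamma> $ j \<noteq> 0" using P_nonzero[OF \<gamma>] by blast
  have "\<exists>b. is_poly b \<and>
      (\<forall>x. (\<Sum>k\<in>UNIV. complex_of_real (\<gamma> $ k) * dt k a x) = root_form \<gamma> x * b x)" for a
    by (rule normal_derivative[OF t_invariant \<gamma>])
  then have "\<forall>a. \<exists>b. is_poly b \<and>
      (\<forall>x. (\<Sum>k\<in>UNIV. complex_of_real (\<gamma> $ k) * dt k a x) = root_form \<gamma> x * b x)" by blast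
  from choice[OF this] obtain b where b: "\<And>a. is_poly (b a)"
    "\<And>a x. (\<Sum>k\<in>UNIV. complex_of_real (\<gamma> $ k) * dt k a x) = root_form \<gamma> x * b a x"
    by blast
  \<comment> \<open>The normal derivative, divided by the root form, replaces column
    \<open>j\<close>, which enters it with the nonzero weight \<open>\<gamma> $ j\<close>. By
    Cramer's lemma the determinant is \<open>\<gamma> $ j * R * K\<close>.\<close>
  define M where "M x = (\<chi> a i. if i = j then b a x else J x $ a $ i)" for x
  define R where "R x = (\<Prod>\<delta>\<in>P - {\<gamma>}. root_form \<delta> x)" for x
  have Delta: "Delta x = root_form \<gamma> x * R x" for x
    unfolding Delta_def R_def by (rule prod.remove[OF finite_P \<gamma>])
  have M: "is_poly (\<lambda>x. det (M x))"
  proof (rule is_poly_det)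
    show "is_poly (\<lambda>x. M x $ a $ i)" for a i
      by (cases "i = j") (simp_all add: M_def b is_poly_J)
  qed
  have eq: "root_form \<gamma> x * (complex_of_real (\<gamma> $ j) * (R x * K x)) = root_form \<gamma> x * det (M x)" for x
  proof -
    have "complex_of_real (\<gamma> $ j) * det (J x) =
        det (\<chi> a i. if i = j then (J x *v cplx \<gamma>) $ a else J x $ a $ i)"
      by (simp only: cramer_lemma cplx_nth)
    also have "(\<chi> a i. if i = j then (J x *v cplx \<gamma>) $ a else J x $ a $ i) =
        (\<chi> a i. if i = j then root_form \<gamma> x * b a x else J x $ a $ i)"
      by (simp add: vec_eq_iff matrix_vector_mult_def b(2)[symmetric] mult.commute)
    finally show ?thesis
      unfolding det_column_mul M_def by (simp add: K(2) Delta mult_ac)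
  qed
  have "is_poly (\<lambda>x. complex_of_real (\<gamma> $ j) * (R x * K x))"
    unfolding R_def by (intro is_poly_intros K(1))
  from root_form_cancel[OF P_root[OF \<gamma>] this M eq]
  have "(\<lambda>x. complex_of_real (\<gamma> $ j) * (R x * K x)) = (\<lambda>x. det (M x))" .
  then have "det (M x0) = 0" using K0 by (metis mult_zero_right)
  then obtain v where v: "v \<noteq> 0" "M x0 *v v = 0" using det_zero_kernel by blast
  define u where "u = (\<chi> i. if i = j then 0 else v $ i)"
  have Mv: "(\<Sum>i\<in>UNIV. dt i a x0 * u $ i) + b a x0 * v $ j = 0" for a
  proof -
    have "0 = (\<Sum>i\<in>UNIV. (if i = j then b a x0 else dt i a x0) * v $ i)"
      using arg_cong[OF v(2), of "\<lambda>u. u $ a"] by (simp add: matrix_vector_mult_def M_def cong: if_cong)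
    also have "\<dots> = (\<Sum>i\<in>UNIV. dt i a x0 * u $ i + (if i = j then b a x0 * v $ j else 0))"
      by (intro sum.cong) (auto simp: u_def)
    finally show ?thesis by (simp add: sum.distrib)
  qed
  obtain f where f: "invariant_poly W f" "\<And>k. partial k f x0 = 0"
    "\<And>b. is_poly b \<Longrightarrow> (\<And>x. (\<Sum>k\<in>UNIV. complex_of_real (\<gamma> $ k) * partial k f x) = root_form \<gamma> x * b x) \<Longrightarrow>
       b x0 \<noteq> 0"
    using normal_invariant_exists[OF \<gamma> x0] by blast
  obtain F where F: "is_poly F" "f = (\<lambda>x. F (T x))"
    using invariant_through_T[OF f(1)] by blast
  define bf where "bf x = (\<Sum>a\<in>UNIV. partial a F (T x) * b a x)" for x
  have "bf x0 \<noteq> 0"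
  proof (rule f(3))
    show "is_poly bf"
      unfolding bf_def[abs_def] by (intro is_poly_sum is_poly_mult is_poly_T is_poly_partial F b)
    fix x
    have "(\<Sum>k\<in>UNIV. complex_of_real (\<gamma> $ k) * partial k f x) =
        (\<Sum>k\<in>UNIV. \<Sum>a\<in>UNIV. partial a F (T x) * (complex_of_real (\<gamma> $ k) * dt k a x))"
      unfolding F(2) partial_T[OF F(1)] by (simp add: sum_distrib_left mult_ac)
    also have "\<dots> = (\<Sum>a\<in>UNIV. partial a F (T x) * (root_form \<gamma> x * b a x))"
      unfolding b(2)[symmetric] by (subst sum.swap) (simp only: sum_distrib_left)
    finally show "(\<Sum>k\<in>UNIV. complex_of_real (\<gamma> $ k) * partial k f x) = root_form \<gamma> x * bf x"
      by (simp add: bf_def sum_distrib_left mult_ac)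
  qed
  \<comment> \<open>The kernel equations are combined with the derivatives of \<open>F\<close> as
    weights. The gradient of \<open>f\<close> vanishes at \<open>x0\<close>, so only the normal term
    remains.\<close>
  moreover have "0 = bf x0 * v $ j"
  proof -
    have "0 = (\<Sum>a\<in>UNIV. partial a F (T x0) * ((\<Sum>i\<in>UNIV. dt i a x0 * u $ i) + b a x0 * v $ j))"
      by (simp only: Mv) simp
    also have "\<dots> = (\<Sum>a\<in>UNIV. \<Sum>i\<in>UNIV. partial a F (T x0) * dt i a x0 * u $ i) + bf x0 * v $ j"
      by (simp add: bf_def distrib_left sum.distrib sum_distrib_left sum_distrib_right mult.assoc)
    also have "(\<Sum>a\<in>UNIV. \<Sum>i\<in>UNIV. partial a F (T x0) * dt i a x0 * u $ i) =
        (\<Sum>i\<in>UNIV. partial i f x0 * u $ i)"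
      unfolding F(2) partial_T[OF F(1)] by (subst sum.swap) (simp only: sum_distrib_right)
    finally show ?thesis by (simp add: f(2))
  qed
  ultimately have vj: "v $ j = 0" by simp
  then have "u = v" by (simp add: u_def vec_eq_iff)
  with Mv vj have "J x0 *v v = 0" by (simp add: vec_eq_iff matrix_vector_mult_def)
  then have *: "v = (root_form \<gamma> v / 2) *s cplx \<gamma>" by (rule kernel_on_hyperplane[OF \<gamma> x0(2)])
  have "v $ j = root_form \<gamma> v / 2 * complex_of_real (\<gamma> $ j)"
    by (subst *) simp
  then have "root_form \<gamma> v = 0" using vj j by simp
  then show False using * v(1) by simp
qed

text \<open>The cofactor has no zero on the generic line, so it is constant there by the fundamental
  theorem of algebra. Homogeneity then forces degree 0, which also counts the positive
  roots.\<close>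

lemma detJ_Delta:
  "\<exists>k\<noteq>0. \<forall>x. det (J x) = k * Delta x"
  and sum_degrees: "(\<Sum>a\<in>UNIV. of_nat (d a) - 1) = (of_nat (card P) :: complex)"
proof -
  obtain K where K: "is_poly K" "\<And>x. det (J x) = Delta x * K x"
    using detJ_factor by blast
  obtain p q where q: "stab q = {mat 1}" and line: "\<And>z. stab (p + z *s q) = {mat 1} \<or>
     (\<exists>\<gamma>\<in>P. root_form \<gamma> (p + z *s q) = 0 \<and> stab (p + z *s q) = {mat 1, refl_matrix \<gamma>})"
    using generic_line_exists by blast
  have Kq: "K q \<noteq> 0" using detJ_nonzero_if_stab_trivial[OF q] K(2)[of q] by auto
  have nz: "K (p + z *s q) \<noteq> 0" for z
    using line[of z]
  proof
    assume "stab (p + z *s q) = {mat 1}"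
    then show ?thesis using detJ_nonzero_if_stab_trivial K(2)[of "p + z *s q"] by fastforce
  next
    assume "\<exists>\<gamma>\<in>P. root_form \<gamma> (p + z *s q) = 0 \<and> stab (p + z *s q) = {mat 1, refl_matrix \<gamma>}"
    then show ?thesis using cofactor_nonzero_on_hyperplane[OF K] by blast
  qed
  obtain r where r: "\<And>z. K (p + z *s q) = poly r z" using poly_line[OF K(1)] by blast
  have "constant (poly r)"
    using fundamental_theorem_of_algebra[of r] nz r by auto
  then have const: "K (p + z *s q) = K p" for z
    using r[of 0] r[of z] unfolding constant_def by simp
  have edet: "eul (\<Sum>a\<in>UNIV. of_nat (d a) - 1) (\<lambda>x. det (J x))"
    using eul_det[of "\<lambda>a. of_nat (d a) - 1" "\<lambda>_. 0" J] eul_partial[OF t_eul] by simp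
  have eD: "eul (of_nat (card P)) Delta"
    unfolding Delta_def[abs_def] using eul_prod[of P "\<lambda>_. 1" root_form] by (simp add: eul_root_form)
  define \<kappa> where "\<kappa> = (\<Sum>a\<in>UNIV. of_nat (d a) - 1) - (of_nat (card P) :: complex)"
  obtain y where "Delta y \<noteq> 0" using Delta_nonzero by blast
  then have eK: "eul \<kappa> K"
    unfolding \<kappa>_def using edet eD K by (intro eul_quotient[of _ Delta K]) simp_all
  then obtain k where k: "\<kappa> = of_nat k" using eul_not_nat[OF eK] Kq unfolding Nats_def by blast
  have hK: "homogeneous k K" using eK k by (simp add: homogeneous_eul)
  obtain r' where r': "\<And>z. K (q + z *s p) = poly r' z" using poly_line[OF K(1)] by blast
  \<comment> \<open>The same line seen from its point at infinity: rescaling turns constancy on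
    \<open>p + z *s q\<close> into the values \<open>z ^ k * K p\<close> on
    \<open>q + z *s p\<close>. At \<open>z = 0\<close> the value is \<open>K q\<close>, which is
    nonzero, so \<open>k = 0\<close>.\<close>
  have "r' - monom (K p) k = 0"
  proof (rule poly_zero_punctured)
    fix z :: complex assume z: "z \<noteq> 0"
    have "q + z *s p = z *s (p + (1 / z) *s q)" using z by (simp add: vec_eq_iff field_simps)
    then have "poly r' z = z ^ k * K p"
      unfolding r'[symmetric] by (simp only: homogeneous_scale[OF hK] const)
    then show "poly (r' - monom (K p) k) z = 0" by (simp add: poly_monom)
  qed
  then have "r' = monom (K p) k" by simp
  then have "K q = poly (monom (K p) k) 0" using r'[of 0] by simp
  then have "k = 0" using Kq by (cases k) (auto simp: poly_monom)
  then have "K x = K 0" for x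
    using homogeneous_scale[OF hK, of 0 x] by simp
  then have "det (J x) = K 0 * Delta x" for x using K(2)[of x] by (metis mult.commute)
  moreover have "K 0 \<noteq> 0" using Kq \<open>\<And>x. K x = K 0\<close> by metis
  ultimately show "\<exists>k\<noteq>0. \<forall>x. det (J x) = k * Delta x" by blast
  show "(\<Sum>a\<in>UNIV. of_nat (d a) - 1) = (of_nat (card P) :: complex)"
    using k \<open>k = 0\<close> by (simp add: \<kappa>_def)
qed

end

section \<open>Algebraic independence, and invariant one-forms in the basis of the
  differentials\<close>

lemma row_cancel:
  fixes A :: "complex^'n^'n"
  assumes "det A \<noteq> 0" "\<And>k. (\<Sum>a\<in>UNIV. f a * A $ a $ k) = (\<Sum>a\<in>UNIV. g a * A $ a $ k)"
  shows "f a = g a"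
proof -
  define v where "v = (\<chi> a. f a - g a)"
  have "(\<Sum>a\<in>UNIV. A $ a $ k * (f a - g a)) = 0" for k
    using assms(2)[of k] by (simp add: algebra_simps sum_subtractf)
  then have "transpose A *v v = 0"
    by (simp add: vec_eq_iff matrix_vector_mult_def transpose_def v_def)
  moreover have "det (transpose A) \<noteq> 0" using assms(1) by (simp add: det_transpose)
  ultimately have "v = 0" using det_zero_kernel by blast
  then show ?thesis by (simp add: v_def vec_eq_iff)
qed

lemma column_cancel:
  fixes A :: "complex^'n^'n"
  assumes "det A \<noteq> 0" "\<And>a. (\<Sum>k\<in>UNIV. A $ a $ k * f k) = (\<Sum>k\<in>UNIV. A $ a $ k * g k)"
  shows "f k = g k"
proof (rule row_cancel[of "transpose A"])
  show "det (transpose A) \<noteq> 0" using assms(1) by (simp add: det_transpose)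
  show "(\<Sum>a\<in>UNIV. f a * transpose A $ a $ k) = (\<Sum>a\<in>UNIV. g a * transpose A $ a $ k)" for k
    using assms(2)[of k] by (simp add: transpose_def mult.commute)
qed

context invariants_setup
begin

lemma detJ_nonzero_iff: "det (J x) \<noteq> 0 \<longleftrightarrow> Delta x \<noteq> 0"
  using detJ_Delta by force

lemma is_poly_regular_eq:
  assumes "is_poly f" "is_poly g" "\<And>x. Delta x \<noteq> 0 \<Longrightarrow> f x = g x"
  shows "f x = g x"
proof -
  obtain y where "Delta y \<noteq> 0" using Delta_nonzero by blast
  then show ?thesis
    using is_poly_eq_on_nonzero[OF is_poly_Delta, of y f g] assms by metis
qed

lemma J_row_cancel:
  assumes "\<And>a. is_poly (f a)" "\<And>a. is_poly (g a)"
    "\<And>x k. (\<Sum>a\<in>UNIV. f a x * dt k a x) = (\<Sum>a\<in>UNIV. g a x * dt k a x)"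
  shows "f a x = g a x"
proof (rule is_poly_regular_eq[OF assms(1,2)])
  fix x assume "Delta x \<noteq> 0"
  then show "f a x = g a x"
    using row_cancel[of "J x" "\<lambda>a. f a x" "\<lambda>a. g a x"] assms(3) by (simp add: detJ_nonzero_iff)
qed

text \<open>By the chain rule and the invertibility of \<open>J\<close> off the mirrors, every
  partial derivative of a relation is again a relation. So a relation vanishes at \<open>T 0\<close>
  together with all its derivatives.\<close>

lemma T_independent:
  assumes "is_poly F" "\<And>x. F (T x) = 0"
  shows "F y = 0"
proof (rule is_poly_zero_if_derivatives_vanish[where I = "{F. is_poly F \<and> (\<forall>x. F (T x) = 0)}" and y = "T 0"])
  show "F \<in> {F. is_poly F \<and> (\<forall>x. F (T x) = 0)}" using assms by simp
  show "F (T 0) = 0" if "F \<in> {F. is_poly F \<and> (\<forall>x. F (T x) = 0)}" for F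
    using that by simp
  show "(\<lambda>x. \<Sum>k\<in>UNIV. v $ k * partial k F x) \<in> {F. is_poly F \<and> (\<forall>x. F (T x) = 0)}"
    if "F \<in> {F. is_poly F \<and> (\<forall>x. F (T x) = 0)}" for F and v :: "complex^'n"
  proof -
    have F: "is_poly F" "(\<lambda>x. F (T x)) = (\<lambda>x. 0)" using that by auto
    have "partial a F (T x) = 0" for a x
    proof (rule J_row_cancel[where f = "\<lambda>a x. partial a F (T x)" and g = "\<lambda>_ _. 0"])
      show "is_poly (\<lambda>x. partial a F (T x))" for a by (intro is_poly_T is_poly_partial F)
      show "(\<Sum>a\<in>UNIV. partial a F (T x) * dt k a x) = (\<Sum>a\<in>UNIV. 0 * dt k a x)" for x k
        using fun_cong[OF partial_T[OF F(1), of k], of x] unfolding F(2) by (simp add: partial_const)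
    qed (rule is_poly_zero)
    then show ?thesis
      by (simp add: is_poly_sum is_poly_mult is_poly_const is_poly_partial F(1))
  qed
qed auto

lemma T_eqI:
  assumes "is_poly F" "is_poly G" "\<And>x. F (T x) = G (T x)"
  shows "F y = G y"
  using T_independent[of "\<lambda>y. F y - G y" y] assms by (simp add: is_poly_diff)

text \<open>Solomon's theorem for one-forms: by Cramer's rule the coefficients are quotients
  by \<open>det J\<close> of determinants which vanish on all hyperplanes, hence are polynomials.\<close>

lemma equivariant_coefficients:
  assumes w: "equivariant w" "\<And>k. is_poly (w k)"
  shows "\<exists>G. (\<forall>\<gamma>. is_poly (G \<gamma>)) \<and> (\<forall>x k. w k x = (\<Sum>\<gamma>\<in>UNIV. G \<gamma> (T x) * dt k \<gamma> x))"
proof -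
  obtain k0 where k0: "k0 \<noteq> 0" "\<And>x. det (J x) = k0 * Delta x" using detJ_Delta by blast
  \<comment> \<open>Cramer's numerator for the coefficient of \<open>dt k \<gamma>\<close>. On a
    mirror all columns are orthogonal to the root, which makes it divisible by
    \<open>Delta\<close>.\<close>
  define M where "M \<gamma> x = (\<chi> i j. if j = \<gamma> then (\<chi> k. w k x) $ i else transpose (J x) $ i $ j)" for \<gamma> x
  have "\<exists>p. is_poly p \<and> (\<forall>x. det (M \<gamma> x) = Delta x * p x)" for \<gamma>
  proof (rule Delta_dvd)
    show "is_poly (\<lambda>x. det (M \<gamma> x))"
    proof (rule is_poly_det)
      show "is_poly (\<lambda>x. M \<gamma> x $ i $ j)" for i j
        by (cases "j = \<gamma>") (simp_all add: M_def transpose_def w is_poly_J)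
    qed
    fix \<delta> x assume \<delta>: "\<delta> \<in> P" "root_form \<delta> x = 0"
    have "(transpose (M \<gamma> x) *v cplx \<delta>) $ i = 0" for i
      using equivariant_hyperplane[OF w(1) \<delta>] equivariant_hyperplane[OF equivariant_J \<delta>, of i]
      by (cases "i = \<gamma>") (simp_all add: matrix_vector_mult_def transpose_def M_def mult.commute)
    then have "transpose (M \<gamma> x) *v cplx \<delta> = 0"
      by (simp add: vec_eq_iff)
    then have "det (transpose (M \<gamma> x)) = 0"
      using det_zero_kernel cplx_root_nonzero[OF \<delta>(1)] by blast
    then show "det (M \<gamma> x) = 0" by (simp only: det_transpose)
  qed
  then have "\<forall>\<gamma>. \<exists>p. is_poly p \<and> (\<forall>x. det (M \<gamma> x) = Delta x * p x)" by blast
  from choice[OF this] obtain p where p: "\<And>\<gamma>. is_poly (p \<gamma>)" "\<And>\<gamma> x. det (M \<gamma> x) = Delta x * p \<gamma> x"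
    by blast
  define N where "N \<gamma> x = p \<gamma> x / k0" for \<gamma> x
  have N: "is_poly (N \<gamma>)" for \<gamma> unfolding N_def[abs_def] by (intro is_poly_divide p)
  have wN: "w k x = (\<Sum>\<gamma>\<in>UNIV. N \<gamma> x * dt k \<gamma> x)" for k x
  proof (rule is_poly_regular_eq[where f = "w k" and g = "\<lambda>x. \<Sum>\<gamma>\<in>UNIV. N \<gamma> x * dt k \<gamma> x"])
    show "is_poly (\<lambda>x. \<Sum>\<gamma>\<in>UNIV. N \<gamma> x * dt k \<gamma> x)"
      by (intro is_poly_sum is_poly_mult N is_poly_J)
    fix x assume x: "Delta x \<noteq> 0"
    have "det (transpose (J x)) \<noteq> 0" using x by (simp add: det_transpose detJ_nonzero_iff)
    moreover have "(\<chi> \<gamma>. N \<gamma> x) = (\<chi> \<gamma>. det (M \<gamma> x) / det (transpose (J x)))"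
      using x k0(1) by (simp add: vec_eq_iff p(2) N_def det_transpose k0(2))
    ultimately have "transpose (J x) *v (\<chi> \<gamma>. N \<gamma> x) = (\<chi> k. w k x)"
      using cramer[of "transpose (J x)" "\<chi> \<gamma>. N \<gamma> x" "\<chi> k. w k x"] unfolding M_def by blast
    from arg_cong[OF this, of "\<lambda>u. u $ k"]
    show "w k x = (\<Sum>\<gamma>\<in>UNIV. N \<gamma> x * dt k \<gamma> x)"
      by (simp add: matrix_vector_mult_def transpose_def mult.commute)
  qed (rule w(2))
  \<comment> \<open>The form and the differentials of the \<open>t\<close> are invariant, so the
    coefficients are, by uniqueness.\<close>
  have inv: "invariant_poly W (N \<gamma>)" for \<gamma>
    unfolding invariant_iff
  proof (intro conjI ballI allI)
    fix u x assume u: "u \<in> W"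
    show "N \<gamma> (capp u x) = N \<gamma> x"
    proof (rule J_row_cancel[where f = "\<lambda>\<gamma> x. N \<gamma> (capp u x)" and g = N])
      fix x k
      have eJ: "(\<Sum>i\<in>UNIV. dt i \<gamma> (capp u x) * complex_of_real (u $ i $ k)) = dt k \<gamma> x" for \<gamma>
        using equivariant_J u unfolding equivariant_def by blast
      have "(\<Sum>\<gamma>\<in>UNIV. N \<gamma> x * dt k \<gamma> x) = w k x" by (simp only: wN)
      also have "\<dots> = (\<Sum>i\<in>UNIV. w i (capp u x) * complex_of_real (u $ i $ k))"
        by (rule sym) (use w(1) u in \<open>unfold equivariant_def, blast\<close>)
      also have "\<dots> = (\<Sum>i\<in>UNIV. \<Sum>\<gamma>\<in>UNIV. N \<gamma> (capp u x) * (dt i \<gamma> (capp u x) * complex_of_real (u $ i $ k)))"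
        by (simp only: wN sum_distrib_right mult.assoc)
      also have "\<dots> = (\<Sum>\<gamma>\<in>UNIV. N \<gamma> (capp u x) * dt k \<gamma> x)"
        by (subst sum.swap) (simp only: sum_distrib_left[symmetric] eJ)
      finally show "(\<Sum>\<gamma>\<in>UNIV. N \<gamma> (capp u x) * dt k \<gamma> x) = (\<Sum>\<gamma>\<in>UNIV. N \<gamma> x * dt k \<gamma> x)" ..
    qed (auto intro: is_poly_capp[OF N] N)
  qed (rule N)
  have "\<forall>\<gamma>. \<exists>F. is_poly F \<and> (\<forall>x. N \<gamma> x = F (T x))" using invariant_through_T[OF inv] by blast
  from choice[OF this] obtain G where "\<And>\<gamma>. is_poly (G \<gamma>)" "\<And>\<gamma> x. N \<gamma> x = G \<gamma> (T x)" by blast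
  then show ?thesis using wN by (intro exI[of _ G]) simp
qed

text \<open>The coordinates \<open>x\<close> are flat, so the Hessian is the covariant derivative of
  the differential of \<open>t b\<close>. The coefficients of this form in the basis
  \<open>dt\<close> are the contravariant Christoffel symbols of \<open>g\<close>.\<close>

definition wform :: "'n \<Rightarrow> 'n \<Rightarrow> 'n \<Rightarrow> complex^'n \<Rightarrow> complex" where
  "wform a b k x = (\<Sum>i\<in>UNIV. dt i a x * partial k (dt i b) x)"

lemma is_poly_hess: "is_poly (partial k (dt i b))"
  by (intro is_poly_partial t_poly)

lemma is_poly_wform: "is_poly (wform a b k)"
  unfolding wform_def[abs_def] by (intro is_poly_sum is_poly_mult is_poly_J is_poly_hess)

text \<open>Under \<open>u\<close> the gradient picks up one matrix factor and the Hessian two; the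
  contracted pair cancels because \<open>u\<close> is orthogonal.\<close>

lemma equivariant_wform: "equivariant (wform a b)"
  unfolding equivariant_def
proof (intro ballI allI)
  fix u x k assume u: "u \<in> W"
  define m where "m i j = complex_of_real (u $ i $ j)" for i j
  have J: "(\<Sum>p\<in>UNIV. dt p r (capp u y) * m p i) = dt i r y" for r i y
    using equivariant_J u unfolding equivariant_def m_def by blast
  have H: "partial k (dt i b) x =
      (\<Sum>p\<in>UNIV. (\<Sum>c\<in>UNIV. partial c (dt p b) (capp u x) * m c k) * m p i)" for i
  proof -
    have "dt i b = (\<lambda>x. \<Sum>p\<in>UNIV. dt p b (capp u x) * m p i)"
      using J by (simp add: fun_eq_iff)
    then have "partial k (dt i b) x = partial k (\<lambda>x. \<Sum>p\<in>UNIV. dt p b (capp u x) * m p i) x"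
      by (rule arg_cong)
    also have "\<dots> = (\<Sum>p\<in>UNIV. (\<Sum>c\<in>UNIV. partial c (dt p b) (capp u x) * m c k) * m p i)"
      unfolding m_def by (subst partial_sum) (simp_all add: partial_mult is_poly_const is_poly_mult
          partial_const is_poly_capp[OF is_poly_J] partial_capp[OF is_poly_J])
    finally show ?thesis .
  qed
  have orth: "(\<Sum>i\<in>UNIV. m p i * m q i) = (if p = q then 1 else 0)" for p q
  proof -
    have "(u ** transpose u) $ p $ q = (mat 1 :: real^'n^'n) $ p $ q"
      using orthogonal_W[OF u] by (simp add: orthogonal_matrix_def)
    then have "(\<Sum>i\<in>UNIV. u $ p $ i * u $ q $ i) = (if p = q then 1 else 0)"
      by (simp add: matrix_matrix_mult_def transpose_def mat_def)
    from arg_cong[OF this, of complex_of_real] show ?thesis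
      by (simp add: m_def)
  qed
  have J': "(\<Sum>i\<in>UNIV. dt i a x * m p i) = dt p a (capp u x)" for p
  proof -
    have "(\<Sum>i\<in>UNIV. dt i a x * m p i) =
        (\<Sum>i\<in>UNIV. \<Sum>q\<in>UNIV. dt q a (capp u x) * (m p i * m q i))"
      unfolding J[of _ x, symmetric] by (simp only: sum_distrib_right) (simp only: mult_ac)
    also have "\<dots> = (\<Sum>q\<in>UNIV. dt q a (capp u x) * (\<Sum>i\<in>UNIV. m p i * m q i))"
      by (subst sum.swap) (simp only: sum_distrib_left)
    finally show ?thesis by (simp add: orth if_distrib[of "\<lambda>c. _ * c"] cong: if_cong)
  qed
  have "wform a b k x = (\<Sum>i\<in>UNIV. \<Sum>p\<in>UNIV. dt i a x * m p i *
      (\<Sum>c\<in>UNIV. partial c (dt p b) (capp u x) * m c k))"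
    unfolding wform_def H by (simp add: sum_distrib_left mult_ac)
  also have "\<dots> = (\<Sum>p\<in>UNIV. dt p a (capp u x) *
      (\<Sum>c\<in>UNIV. partial c (dt p b) (capp u x) * m c k))"
    by (subst sum.swap) (simp only: sum_distrib_right[symmetric] J')
  also have "\<dots> = (\<Sum>c\<in>UNIV. wform a b c (capp u x) * m c k)"
    unfolding wform_def sum_distrib_left sum_distrib_right by (subst sum.swap) (simp add: mult_ac)
  finally show "(\<Sum>c\<in>UNIV. wform a b c (capp u x) * complex_of_real (u $ c $ k)) = wform a b k x"
    by (simp add: m_def)
qed

text \<open>The contravariant Christoffel symbols of \<open>g\<close>, as polynomials in the invariants.\<close>

definition Gam :: "'n \<Rightarrow> 'n \<Rightarrow> 'n \<Rightarrow> complex^'n \<Rightarrow> complex" where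
  "Gam a b = (SOME G. (\<forall>r. is_poly (G r)) \<and>
     (\<forall>x k. wform a b k x = (\<Sum>r\<in>UNIV. G r (T x) * dt k r x)))"

lemma is_poly_Gam: "is_poly (Gam a b r)"
  and wform_Gam: "wform a b k x = (\<Sum>r\<in>UNIV. Gam a b r (T x) * dt k r x)"
  using someI_ex[OF equivariant_coefficients[OF equivariant_wform is_poly_wform, of a b]]
  unfolding Gam_def by blast+

lemma eul_wform: "eul (of_nat (d a) + of_nat (d b) - 3) (wform a b k)"
proof -
  have "eul ((of_nat (d a) - 1) + (of_nat (d b) - 1 - 1)) (wform a b k)"
    unfolding wform_def[abs_def] by (intro eul_sum eul_mult eul_partial t_eul)
  then show ?thesis by (simp add: algebra_simps)
qed

text \<open>Apply the Euler field to the expansion of \<open>wform\<close> in the \<open>dt\<close>,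
  which are eigenfunctions themselves, and compare coefficients.\<close>

lemma eul_Gam: "eul (of_nat (d a) + of_nat (d b) - 2 - of_nat (d r)) (\<lambda>x. Gam a b r (T x))"
proof -
  define K :: "'n \<Rightarrow> complex" where "K r = of_nat (d a) + of_nat (d b) - 2 - of_nat (d r)" for r
  define E where "E r x = (\<Sum>k\<in>UNIV. x $ k * partial k (\<lambda>x. Gam a b r (T x)) x)" for r x
  have pG: "is_poly (\<lambda>x. Gam a b r (T x))" for r by (intro is_poly_T is_poly_Gam)
  have "E r x = K r * Gam a b r (T x)" for r x
  proof (rule J_row_cancel[where f = E and g = "\<lambda>r x. K r * Gam a b r (T x)"])
    show "is_poly (E r)" for r
      unfolding E_def[abs_def] by (intro is_poly_intros is_poly_partial pG)
    show "is_poly (\<lambda>x. K r * Gam a b r (T x))" for r by (intro is_poly_cmult pG)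
    fix x i
    have "(of_nat (d a) + of_nat (d b) - 3) * wform a b i x = (\<Sum>k\<in>UNIV. x $ k * partial k (wform a b i) x)"
      using eulD[OF eul_wform] by simp
    also have "wform a b i = (\<lambda>x. \<Sum>r\<in>UNIV. Gam a b r (T x) * dt i r x)"
      by (rule ext) (rule wform_Gam)
    also have "(\<Sum>k\<in>UNIV. x $ k * partial k (\<lambda>x. \<Sum>r\<in>UNIV. Gam a b r (T x) * dt i r x) x) =
        (\<Sum>k\<in>UNIV. \<Sum>r\<in>UNIV. x $ k * partial k (\<lambda>x. Gam a b r (T x)) x * dt i r x +
          Gam a b r (T x) * (x $ k * partial k (dt i r) x))"
      by (simp add: partial_sum partial_mult is_poly_mult pG is_poly_J sum_distrib_left algebra_simps)
    also have "\<dots> = (\<Sum>r\<in>UNIV. E r x * dt i r x +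
          Gam a b r (T x) * (\<Sum>k\<in>UNIV. x $ k * partial k (dt i r) x))"
      by (subst sum.swap) (simp add: sum.distrib sum_distrib_left sum_distrib_right E_def)
    also have "\<dots> = (\<Sum>r\<in>UNIV. E r x * dt i r x +
          Gam a b r (T x) * ((of_nat (d r) - 1) * dt i r x))"
      by (simp only: eulD[OF eul_partial[OF t_eul]])
    finally have "(\<Sum>r\<in>UNIV. E r x * dt i r x) =
        (\<Sum>r\<in>UNIV. (of_nat (d a) + of_nat (d b) - 3) * (Gam a b r (T x) * dt i r x)) -
        (\<Sum>r\<in>UNIV. Gam a b r (T x) * ((of_nat (d r) - 1) * dt i r x))"
      by (simp add: sum.distrib sum_distrib_left)
    also have "\<dots> = (\<Sum>r\<in>UNIV. K r * Gam a b r (T x) * dt i r x)"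
      unfolding sum_subtractf[symmetric] by (intro sum.cong) (simp_all add: K_def algebra_simps)
    finally show "(\<Sum>r\<in>UNIV. E r x * dt i r x) =
        (\<Sum>r\<in>UNIV. K r * Gam a b r (T x) * dt i r x)" .
  qed
  then show ?thesis using pG unfolding eul_def E_def K_def by blast
qed

text \<open>The Euler field pushed forward along \<open>T\<close>: quasi-homogeneity with the
  degrees as weights.\<close>

definition weul :: "complex \<Rightarrow> (complex^'n \<Rightarrow> complex) \<Rightarrow> bool" where
  "weul \<kappa> F \<longleftrightarrow> is_poly F \<and> (\<forall>y. (\<Sum>l\<in>UNIV. of_nat (d l) * y $ l * partial l F y) = \<kappa> * F y)"

lemma eul_T_sum:
  assumes "is_poly F"
  shows "(\<Sum>k\<in>UNIV. x $ k * partial k (\<lambda>x. F (T x)) x) =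
    (\<Sum>l\<in>UNIV. of_nat (d l) * t l x * partial l F (T x))"
proof -
  have "(\<Sum>k\<in>UNIV. x $ k * partial k (\<lambda>x. F (T x)) x) =
      (\<Sum>k\<in>UNIV. \<Sum>l\<in>UNIV. partial l F (T x) * (x $ k * dt k l x))"
    unfolding partial_T[OF assms] by (simp add: sum_distrib_left mult_ac)
  also have "\<dots> = (\<Sum>l\<in>UNIV. partial l F (T x) * (\<Sum>k\<in>UNIV. x $ k * dt k l x))"
    by (subst sum.swap) (simp only: sum_distrib_left)
  finally show ?thesis by (simp only: eulD[OF t_eul]) (simp add: mult_ac)
qed

lemma weul_iff:
  assumes "is_poly F"
  shows "weul \<kappa> F \<longleftrightarrow> eul \<kappa> (\<lambda>x. F (T x))"
proof
  assume "weul \<kappa> F"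
  then have "(\<Sum>l\<in>UNIV. of_nat (d l) * T x $ l * partial l F (T x)) = \<kappa> * F (T x)" for x
    unfolding weul_def by blast
  then show "eul \<kappa> (\<lambda>x. F (T x))"
    using eul_T_sum[OF assms] is_poly_T[OF assms] by (simp add: eul_def)
next
  assume *: "eul \<kappa> (\<lambda>x. F (T x))"
  have "(\<Sum>l\<in>UNIV. of_nat (d l) * y $ l * partial l F y) = \<kappa> * F y" for y
  proof (rule T_eqI[where F = "\<lambda>y. \<Sum>l\<in>UNIV. of_nat (d l) * y $ l * partial l F y"
        and G = "\<lambda>y. \<kappa> * F y"])
    show "is_poly (\<lambda>y. \<Sum>l\<in>UNIV. of_nat (d l) * y $ l * partial l F y)"
      by (intro is_poly_intros is_poly_partial assms)
    show "is_poly (\<lambda>y. \<kappa> * F y)" by (intro is_poly_cmult assms)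
    show "(\<Sum>l\<in>UNIV. of_nat (d l) * T x $ l * partial l F (T x)) = \<kappa> * F (T x)" for x
      using eulD[OF *, of x] eul_T_sum[OF assms, of x] by simp
  qed
  then show "weul \<kappa> F" using assms by (simp add: weul_def)
qed

lemma weul_partial:
  assumes "weul \<kappa> F"
  shows "weul (\<kappa> - of_nat (d s)) (partial s F)"
proof -
  have F: "is_poly F" using assms by (simp add: weul_def)
  have "partial s (\<lambda>y. \<Sum>l\<in>UNIV. of_nat (d l) * y $ l * partial l F y) y = \<kappa> * partial s F y" for y
    using assms by (simp add: weul_def partial_cmult F)
  moreover have "partial s (\<lambda>y. \<Sum>l\<in>UNIV. of_nat (d l) * y $ l * partial l F y) y =
      of_nat (d s) * partial s F y + (\<Sum>l\<in>UNIV. of_nat (d l) * y $ l * partial l (partial s F) y)" for y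
  proof -
    have "partial s (\<lambda>y. of_nat (d l) * y $ l * partial l F y) y =
        (if l = s then of_nat (d s) * partial s F y else 0) + of_nat (d l) * y $ l * partial l (partial s F) y" for l y
      by (simp add: partial_mult partial_coord partial_const F is_poly_partial is_poly_mult is_poly_const
          is_poly_coord partial_commute[OF F, of s])
    moreover have "is_poly (\<lambda>y. of_nat (d l) * y $ l * partial l F y)" for l
      by (intro is_poly_intros is_poly_partial F)
    ultimately show ?thesis by (simp add: partial_sum sum.distrib)
  qed
  ultimately show ?thesis
    using F by (simp add: weul_def is_poly_partial algebra_simps)
qed

lemma weul_not_nat:
  assumes "weul \<kappa> F" "\<kappa> \<notin> \<nat>"
  shows "F y = 0"
proof (rule T_independent)
  show F: "is_poly F" using assms by (simp add: weul_def)
  have "eul \<kappa> (\<lambda>x. F (T x))" using assms(1) weul_iff[OF F] by blast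
  from eul_not_nat[OF this assms(2)] show "F (T x) = 0" for x .
qed

lemma weul_Gam: "weul (of_nat (d a) + of_nat (d b) - 2 - of_nat (d r)) (Gam a b r)"
  using eul_Gam weul_iff[OF is_poly_Gam] by blast

end

section \<open>The Frobenius structure\<close>

lemma idx_bij: "bij_betw idx (UNIV :: 'n::{finite,linorder} set) {1..CARD('n)}"
proof -
  have "strict_mono (idx :: 'n \<Rightarrow> nat)"
  proof (rule strict_monoI)
    fix a b :: 'n assume "a < b"
    then have "{\<beta>. \<beta> \<le> a} \<subseteq> {\<beta>. \<beta> \<le> b}" "b \<in> {\<beta>. \<beta> \<le> b}" "b \<notin> {\<beta>. \<beta> \<le> a}"
      by auto
    then have "{\<beta>. \<beta> \<le> a} \<subset> {\<beta>. \<beta> \<le> b}" by blast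
    then show "idx a < idx b" unfolding idx_def by (intro psubset_card_mono) auto
  qed
  then have inj: "inj (idx :: 'n \<Rightarrow> nat)" by (rule strict_mono_imp_inj_on)
  have "idx a \<in> {1..CARD('n)}" for a :: 'n
  proof -
    have "0 < idx a" unfolding idx_def by (subst card_gt_0_iff) auto
    moreover have "idx a \<le> CARD('n)" unfolding idx_def by (intro card_mono) auto
    ultimately show ?thesis by simp
  qed
  then have "range (idx :: 'n \<Rightarrow> nat) \<subseteq> {1..CARD('n)}" by blast
  moreover have "card (range (idx :: 'n \<Rightarrow> nat)) = card {1..CARD('n)}"
    using card_image[OF inj] by simp
  ultimately have "range (idx :: 'n \<Rightarrow> nat) = {1..CARD('n)}"
    by (intro card_subset_eq) auto
  then show ?thesis using inj by (simp add: bij_betw_def)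
qed

text \<open>The index reversal \<open>\<alpha> \<mapsto> n + 1 - \<alpha>\<close>;
  \<open>eta\<close> is its permutation matrix.\<close>

definition star :: "'n::{finite,linorder} \<Rightarrow> 'n" where
  "star a = (THE b. idx a + idx b = CARD('n) + 1)"

lemma star_iff: "idx \<alpha> + idx \<beta> = CARD('n) + 1 \<longleftrightarrow> \<beta> = star (\<alpha> :: 'n::{finite,linorder})"
proof -
  have r: "idx (a :: 'n) \<in> {1..CARD('n)}" for a using idx_bij bij_betw_apply by fastforce
  have inj: "idx (a :: 'n) = idx b \<Longrightarrow> a = b" for a b
    using idx_bij[where 'n = 'n] by (auto simp: bij_betw_def inj_on_def)
  have "CARD('n) + 1 - idx \<alpha> \<in> {1..CARD('n)}" using r[of \<alpha>] by auto
  then have "CARD('n) + 1 - idx \<alpha> \<in> range (idx :: 'n \<Rightarrow> nat)"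
    using idx_bij[where 'n = 'n] by (simp add: bij_betw_def)
  then obtain \<gamma> :: 'n where \<gamma>: "idx \<gamma> = CARD('n) + 1 - idx \<alpha>" by auto
  have \<gamma>': "idx \<alpha> + idx \<beta> = CARD('n) + 1 \<longleftrightarrow> \<beta> = \<gamma>" for \<beta>
    using r[of \<alpha>] \<gamma> inj[of \<beta> \<gamma>] by auto
  then have "star \<alpha> = \<gamma>" unfolding star_def by simp
  then show ?thesis using \<gamma>' by simp
qed

lemma eta_star: "eta $ a $ b = (if b = star a then 1 else 0)"
  by (simp only: eta_def star_iff vec_lambda_beta)

lemma star_star [simp]: "star (star a) = a"
  using star_iff[of a "star a"] star_iff[of "star a" a] by (simp add: add.commute)

lemma star_eq_iff: "b = star a \<longleftrightarrow> a = star b"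
  by auto

lemma sum_star: "(\<Sum>a\<in>UNIV. f (star a)) = (\<Sum>a\<in>UNIV. f a)"
  by (rule sum.reindex_bij_witness[of _ star star]) auto

lemma star_Min: "star (Min UNIV) = (Max UNIV :: 'n::{finite,linorder})"
proof -
  have "{b. b \<le> (Min UNIV :: 'n)} = {Min UNIV}" by (auto intro: antisym)
  then have "idx (Min UNIV :: 'n) = 1" by (simp add: idx_def)
  moreover have "{b. b \<le> (Max UNIV :: 'n)} = UNIV" by auto
  then have "idx (Max UNIV :: 'n) = CARD('n)" by (simp add: idx_def)
  ultimately show ?thesis using star_iff[of "Min UNIV :: 'n" "Max UNIV"] by simp
qed

section \<open>The metric on the orbit space: compatibility, torsion and curvature\<close>

locale saito_setup = invariants_setup W P d t
  for W :: "'n::{finite,linorder} rmat set" and P d t +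
  assumes saito: "saito_polynomials W d t"
begin

abbreviation one :: 'n where "one \<equiv> Min UNIV"

definition h :: complex where "h = of_nat (coxeter_number d)"

definition G :: "'n \<Rightarrow> 'n \<Rightarrow> 'n cvec \<Rightarrow> complex" where
  "G a b = (SOME G. is_poly G \<and> (\<forall>x. metric_g t x $ a $ b = G (\<chi> s. t s x)) \<and>
     (\<forall>y. partial one G y = eta $ a $ b))"

lemma G_props:
  "is_poly (G a b) \<and> (\<forall>x. metric_g t x $ a $ b = G a b (\<chi> s. t s x)) \<and>
     (\<forall>y. partial one (G a b) y = eta $ a $ b)"
proof -
  have "\<exists>G. is_poly G \<and> (\<forall>x. metric_g t x $ a $ b = G (\<chi> s. t s x)) \<and>
     (\<forall>y. partial one G y = eta $ a $ b)"
    using saito unfolding saito_polynomials_def by blast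
  from someI_ex[OF this] show ?thesis unfolding G_def .
qed

lemma is_poly_G: "is_poly (G a b)"
  using G_props by blast

lemma partial_one_G: "partial one (G a b) = (\<lambda>y. if b = star a then 1 else 0)"
  using G_props[of a b] by (auto simp: eta_star)

lemma G_T: "G a b (T x) = (\<Sum>i\<in>UNIV. dt i a x * dt i b x)"
  using G_props[of a b] unfolding T_def metric_g_def by simp

lemma G_sym: "G a b y = G b a y"
  by (rule T_eqI[OF is_poly_G is_poly_G]) (simp add: G_T mult.commute)

lemma weul_G: "weul (of_nat (d a) + of_nat (d b) - 2) (G a b)"
proof -
  have "eul ((of_nat (d a) - 1) + (of_nat (d b) - 1)) (\<lambda>x. G a b (T x))"
    unfolding G_T by (intro eul_sum eul_mult eul_partial t_eul)
  then show ?thesis using weul_iff[OF is_poly_G] by (simp add: algebra_simps)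
qed

lemma d_le_h: "d a \<le> coxeter_number d"
  using saito unfolding saito_polynomials_def coxeter_number_def by (auto dest!: antimonoD[of d one a])

text \<open>The derivative of \<open>G a (star a)\<close> along \<open>t one\<close> is the constant
  1, so its weight \<open>d a + d (star a) - 2 - h\<close> must be 0.\<close>

lemma d_star: "d a + d (star a) = coxeter_number d + 2"
proof -
  have "weul (of_nat (d a) + of_nat (d (star a)) - 2 - h) (\<lambda>y. 1)"
    using weul_partial[OF weul_G, of a "star a" one] by (simp add: partial_one_G h_def coxeter_number_def)
  then have "of_nat (d a) + of_nat (d (star a)) - 2 - h = 0"
    by (simp add: weul_def partial_const)
  then have "of_nat (d a) + of_nat (d (star a)) = h + 2"
    by (simp add: algebra_simps)
  then have "(of_nat (d a + d (star a)) :: complex) = of_nat (coxeter_number d + 2)"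
    by (simp add: h_def)
  then show ?thesis by (simp only: of_nat_eq_iff)
qed

text \<open>The duality of degrees with \<open>d one = h\<close> makes the last and smallest degree
  equal to 2.\<close>

lemma d_ge_2: "2 \<le> d a"
proof -
  have "d (Max UNIV) = 2" using d_star[of one] by (simp add: star_Min coxeter_number_def)
  moreover have "d (Max UNIV) \<le> d a"
    using saito unfolding saito_polynomials_def by (auto dest!: antimonoD[of d a "Max UNIV"])
  ultimately show ?thesis by simp
qed

lemma h_nonzero: "h \<noteq> 0"
  using d_ge_2[of one] by (simp add: h_def coxeter_number_def)

definition nu :: "'n \<Rightarrow> complex" where "nu a = (of_nat (d a) - 1) / h"

lemma nu_nonzero: "nu a \<noteq> 0"
  using d_ge_2[of a] h_nonzero of_nat_eq_1_iff[of "d a", where 'a = complex] by (auto simp: nu_def)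

lemma nu_star: "nu a + nu (star a) = 1"
proof -
  have "of_nat (d a + d (star a)) = h + 2" by (simp only: d_star) (simp add: h_def)
  then have "(of_nat (d a) - 1) + (of_nat (d (star a)) - 1) = h" by simp
  then show ?thesis using h_nonzero by (simp add: nu_def flip: add_divide_distrib)
qed

text \<open>Compatibility of the connection with the metric: the product rule for \<open>G\<close>
  in the flat coordinates.\<close>

lemma partial_G: "partial s (G a b) y = Gam a b s y + Gam b a s y"
proof (rule T_eqI[where G = "\<lambda>y. Gam a b s y + Gam b a s y"])
  show "is_poly (partial s (G a b))" by (intro is_poly_partial is_poly_G)
  show "is_poly (\<lambda>y. Gam a b s y + Gam b a s y)" by (intro is_poly_add is_poly_Gam)
  show "partial s (G a b) (T x) = Gam a b s (T x) + Gam b a s (T x)" for x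
  proof (rule J_row_cancel[where f = "\<lambda>s x. partial s (G a b) (T x)"
        and g = "\<lambda>s x. Gam a b s (T x) + Gam b a s (T x)"])
    show "is_poly (\<lambda>x. partial s (G a b) (T x))" for s by (intro is_poly_T is_poly_partial is_poly_G)
    show "is_poly (\<lambda>x. Gam a b s (T x) + Gam b a s (T x))" for s
      by (intro is_poly_add is_poly_T is_poly_Gam)
    fix x k
    have "(\<Sum>s\<in>UNIV. partial s (G a b) (T x) * dt k s x) = partial k (\<lambda>x. G a b (T x)) x"
      by (simp add: partial_T[OF is_poly_G])
    also have "\<dots> = wform a b k x + wform b a k x"
      unfolding G_T wform_def
      by (simp add: partial_sum partial_mult is_poly_J is_poly_mult sum.distrib mult.commute)
    also have "\<dots> = (\<Sum>s\<in>UNIV. (Gam a b s (T x) + Gam b a s (T x)) * dt k s x)"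
      by (simp only: wform_Gam distrib_right sum.distrib)
    finally show "(\<Sum>s\<in>UNIV. partial s (G a b) (T x) * dt k s x) =
        (\<Sum>s\<in>UNIV. (Gam a b s (T x) + Gam b a s (T x)) * dt k s x)" .
  qed
qed

lemma G_Gam_sum: "(\<Sum>s\<in>UNIV. G a s (T x) * Gam b r s (T x)) = (\<Sum>i\<in>UNIV. dt i a x * wform b r i x)"
proof -
  have "(\<Sum>s\<in>UNIV. G a s (T x) * Gam b r s (T x)) =
      (\<Sum>s\<in>UNIV. \<Sum>i\<in>UNIV. dt i a x * (Gam b r s (T x) * dt i s x))"
    by (simp only: G_T sum_distrib_right) (simp only: mult_ac)
  also have "\<dots> = (\<Sum>i\<in>UNIV. dt i a x * wform b r i x)"
    by (subst sum.swap) (simp only: sum_distrib_left[symmetric] wform_Gam)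
  finally show ?thesis .
qed

text \<open>Both sides are the Hessian of \<open>t r\<close> evaluated on the gradients of
  \<open>t a\<close> and \<open>t b\<close>.\<close>

lemma torsion_free:
  "(\<Sum>s\<in>UNIV. G a s y * Gam b r s y) = (\<Sum>s\<in>UNIV. G b s y * Gam a r s y)"
proof (rule T_eqI[where F = "\<lambda>y. \<Sum>s\<in>UNIV. G a s y * Gam b r s y"
      and G = "\<lambda>y. \<Sum>s\<in>UNIV. G b s y * Gam a r s y"])
  show "is_poly (\<lambda>y. \<Sum>s\<in>UNIV. G a s y * Gam b r s y)"
    "is_poly (\<lambda>y. \<Sum>s\<in>UNIV. G b s y * Gam a r s y)"
    by (intro is_poly_sum is_poly_mult is_poly_G is_poly_Gam)+
  show "(\<Sum>s\<in>UNIV. G a s (T x) * Gam b r s (T x)) = (\<Sum>s\<in>UNIV. G b s (T x) * Gam a r s (T x))" for x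
  proof -
    have "(\<Sum>i\<in>UNIV. dt i a x * wform b r i x) =
        (\<Sum>i\<in>UNIV. \<Sum>k\<in>UNIV. dt k b x * (dt i a x * partial k (dt i r) x))"
      unfolding wform_def by (simp add: sum_distrib_left mult_ac partial_commute[OF t_poly])
    also have "\<dots> = (\<Sum>i\<in>UNIV. dt i b x * wform a r i x)"
      unfolding wform_def by (subst sum.swap) (simp add: sum_distrib_left)
    finally show ?thesis by (simp only: G_Gam_sum)
  qed
qed

text \<open>Both come from differentiating the torsion identity along \<open>t one\<close>. The
  second derivative, together with metric compatibility, kills the derivatives of the symbols; the
  first one then leaves the index symmetry.\<close>

lemma partial_one_Gam: "partial one (Gam a b r) = (\<lambda>y. 0)"
  and Gam_star: "Gam b r (star a) y = Gam a r (star b) y"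
proof -
  define X where "X b r s = partial one (Gam b r s)" for b r s
  have X: "is_poly (X b r s)" for b r s unfolding X_def by (intro is_poly_partial is_poly_Gam)
  have dX: "partial one (X b r s) = (\<lambda>y. 0)" for b r s
  proof
    fix y
    \<comment> \<open>The weight is at most \<open>- 2 - d s\<close>, because no degree exceeds
      \<open>h = d one\<close>.\<close>
    have "(of_nat (d b) + of_nat (d r) - 2 - of_nat (d s) - of_nat (d one) - of_nat (d one) :: complex) \<notin> \<nat>"
    proof
      assume "(of_nat (d b) + of_nat (d r) - 2 - of_nat (d s) - of_nat (d one) - of_nat (d one) :: complex) \<in> \<nat>"
      then obtain k where "(of_nat (d b) + of_nat (d r) - 2 - of_nat (d s) - of_nat (d one) - of_nat (d one) :: complex) = of_nat k"
        by (auto simp: Nats_def)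
      then have "(of_nat (d b + d r) :: complex) = of_nat (k + 2 + d s + d one + d one)"
        by (simp add: algebra_simps)
      then have "d b + d r = k + 2 + d s + d one + d one"
        by (simp only: of_nat_eq_iff)
      then show False using d_le_h[of b] d_le_h[of r] by (simp add: coxeter_number_def)
    qed
    then show "partial one (X b r s) y = 0"
      unfolding X_def by (rule weul_not_nat[OF weul_partial[OF weul_partial[OF weul_Gam]]])
  qed
  have delta: "(\<Sum>s\<in>UNIV. (if s = star a then 1 else 0) * f s + g s) = f (star a) + (\<Sum>s\<in>UNIV. g s)"
    for a and f g :: "'n \<Rightarrow> complex"
    by (simp add: sum.distrib if_distrib[of "\<lambda>c. c * _"] cong: if_cong)
  have d1: "partial one (\<lambda>y. \<Sum>s\<in>UNIV. G a s y * Gam b r s y) =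
      (\<lambda>y. Gam b r (star a) y + (\<Sum>s\<in>UNIV. G a s y * X b r s y))" for a b r
    by (simp add: partial_sum partial_mult is_poly_mult is_poly_G is_poly_Gam partial_one_G delta flip: X_def)
  have d2: "partial one (\<lambda>y. Gam b r (star a) y + (\<Sum>s\<in>UNIV. G a s y * X b r s y)) y =
      2 * X b r (star a) y" for a b r y
    using delta[of a "\<lambda>s. X b r s y" "\<lambda>_. 0"]
    by (simp add: partial_add partial_sum partial_mult is_poly_mult is_poly_sum is_poly_G is_poly_Gam X dX
        partial_one_G flip: X_def)
  have tf: "(\<lambda>y. \<Sum>s\<in>UNIV. G a s y * Gam b r s y) = (\<lambda>y. \<Sum>s\<in>UNIV. G b s y * Gam a r s y)" for a b r
    using torsion_free by blast
  have tf1: "(\<lambda>y. Gam b r (star a) y + (\<Sum>s\<in>UNIV. G a s y * X b r s y)) =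
      (\<lambda>y. Gam a r (star b) y + (\<Sum>s\<in>UNIV. G b s y * X a r s y))" for a b r
    using arg_cong[OF tf, of "partial one"] unfolding d1 .
  have Y1: "X b r (star a) y = X a r (star b) y" for a b r y
    using fun_cong[OF arg_cong[OF tf1, of "partial one"], of b r a y] unfolding d2 by simp
  have Y2: "X a b s y + X b a s y = 0" for a b s y
  proof -
    have "X a b s y + X b a s y = partial one (\<lambda>y. Gam a b s y + Gam b a s y) y"
      by (simp add: X_def partial_add is_poly_Gam)
    also have "(\<lambda>y. Gam a b s y + Gam b a s y) = partial s (G a b)"
      by (rule ext) (simp add: partial_G)
    also have "partial one (partial s (G a b)) y = 0"
      by (subst partial_commute[OF is_poly_G]) (simp add: partial_one_G partial_const)
    finally show ?thesis .
  qed
  \<comment> \<open>As in the uniqueness of the Levi-Civita connection: three antisymmetries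
    \<open>Y2\<close> alternate with three symmetries \<open>Y1\<close>, and the round trip changes
    the sign.\<close>
  have X0: "X b r (star a) y = 0" for a b r y
  proof -
    have "X b r (star a) y = - X r b (star a) y" using Y2[of b r "star a" y] by (simp add: eq_neg_iff_add_eq_0)
    also have "X r b (star a) y = X a b (star r) y" by (rule Y1)
    also have "X a b (star r) y = - X b a (star r) y" using Y2[of a b "star r" y] by (simp add: eq_neg_iff_add_eq_0)
    also have "X b a (star r) y = X r a (star b) y" by (rule Y1)
    also have "X r a (star b) y = - X a r (star b) y" using Y2[of r a "star b" y] by (simp add: eq_neg_iff_add_eq_0)
    also have "X a r (star b) y = X b r (star a) y" by (rule Y1)
    finally show ?thesis by simp
  qed
  have X0': "X a b r y = 0" for a b r y using X0[of a b "star r" y] by simp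
  then show "partial one (Gam a b r) = (\<lambda>y. 0)" by (auto simp: X_def)
  show "Gam b r (star a) y = Gam a r (star b) y"
    using fun_cong[OF tf1, of b r a y] by (simp add: X0')
qed

lemma J_wform: "(\<Sum>i\<in>UNIV. dt i s x * partial i (dt j a) x) = wform s a j x"
  unfolding wform_def by (simp add: partial_commute[OF t_poly])

text \<open>Flatness in contravariant form. The antisymmetrized derivative of \<open>wform\<close>
  is computed twice: from its expansion in the \<open>dt\<close>, and from the definition, where the
  third derivatives cancel.\<close>

lemma curvature:
  "(\<Sum>\<delta>\<in>UNIV. G s \<delta> y * (partial \<delta> (Gam a b \<epsilon>) y - partial \<epsilon> (Gam a b \<delta>) y)) =
   (\<Sum>r\<in>UNIV. Gam s a r y * Gam r b \<epsilon> y - Gam s b r y * Gam r a \<epsilon> y)"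
proof (rule T_eqI[where F = "\<lambda>y. \<Sum>\<delta>\<in>UNIV. G s \<delta> y * (partial \<delta> (Gam a b \<epsilon>) y - partial \<epsilon> (Gam a b \<delta>) y)"
      and G = "\<lambda>y. \<Sum>r\<in>UNIV. Gam s a r y * Gam r b \<epsilon> y - Gam s b r y * Gam r a \<epsilon> y"])
  let ?F = "\<lambda>\<epsilon> y. \<Sum>\<delta>\<in>UNIV. G s \<delta> y * (partial \<delta> (Gam a b \<epsilon>) y - partial \<epsilon> (Gam a b \<delta>) y)"
  let ?H = "\<lambda>\<epsilon> y. \<Sum>r\<in>UNIV. Gam s a r y * Gam r b \<epsilon> y - Gam s b r y * Gam r a \<epsilon> y"
  show pF: "is_poly (?F \<epsilon>)" for \<epsilon>
    by (intro is_poly_sum is_poly_mult is_poly_diff is_poly_partial is_poly_G is_poly_Gam)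
  show pH: "is_poly (?H \<epsilon>)" for \<epsilon>
    by (intro is_poly_sum is_poly_mult is_poly_diff is_poly_Gam)
  show "?F \<epsilon> (T x) = ?H \<epsilon> (T x)" for x
  proof (rule J_row_cancel[where f = "\<lambda>\<epsilon> x. ?F \<epsilon> (T x)" and g = "\<lambda>\<epsilon> x. ?H \<epsilon> (T x)"])
    show "is_poly (\<lambda>x. ?F \<epsilon> (T x))" for \<epsilon> by (rule is_poly_T[OF pF])
    show "is_poly (\<lambda>x. ?H \<epsilon> (T x))" for \<epsilon> by (rule is_poly_T[OF pH])
    fix x k
    define j where "j a i = dt i a x" for a i
    define D where "D \<delta> \<epsilon> = partial \<delta> (Gam a b \<epsilon>) (T x)" for \<delta> \<epsilon>
    define H where "H a i k = partial i (dt k a) x" for a i k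
    have Hsym: "H a i k = H a k i" for a i k
      unfolding H_def by (simp add: partial_commute[OF t_poly])
    have dw1: "partial i (wform a b k) x = (\<Sum>\<epsilon>\<in>UNIV. (\<Sum>\<delta>\<in>UNIV. D \<delta> \<epsilon> * j \<delta> i) * j \<epsilon> k + Gam a b \<epsilon> (T x) * H \<epsilon> i k)" for i k
    proof -
      have "wform a b k = (\<lambda>x. \<Sum>\<epsilon>\<in>UNIV. Gam a b \<epsilon> (T x) * dt k \<epsilon> x)"
        by (rule ext) (rule wform_Gam)
      then show ?thesis
        by (simp add: partial_sum partial_mult is_poly_mult is_poly_T is_poly_Gam is_poly_J
            partial_T[OF is_poly_Gam] D_def j_def H_def)
    qed
    have dw2: "partial i (wform a b k) x - partial k (wform a b i) x =
        (\<Sum>l\<in>UNIV. H a i l * H b k l - H a k l * H b i l)" for i k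
    proof -
      have dw: "partial i (wform a b k) x = (\<Sum>l\<in>UNIV. H a i l * H b k l +
          j a l * partial i (partial k (dt l b)) x)" for i k
        unfolding wform_def[abs_def]
        by (simp add: partial_sum partial_mult is_poly_mult is_poly_J is_poly_hess H_def j_def)
      have "partial i (partial k (dt l b)) = partial k (partial i (dt l b))" for l
        by (rule partial_commute[OF is_poly_J])
      then show ?thesis unfolding dw by (simp flip: sum_subtractf)
    qed
    have "(\<Sum>\<epsilon>\<in>UNIV. ?F \<epsilon> (T x) * j \<epsilon> k) =
        (\<Sum>i\<in>UNIV. j s i * (partial i (wform a b k) x - partial k (wform a b i) x))"
    proof -
      have "(\<Sum>i\<in>UNIV. j s i * (partial i (wform a b k) x - partial k (wform a b i) x)) =
        (\<Sum>i\<in>UNIV. j s i * ((\<Sum>\<epsilon>\<in>UNIV. \<Sum>\<delta>\<in>UNIV. D \<delta> \<epsilon> * j \<delta> i * j \<epsilon> k) - (\<Sum>\<epsilon>\<in>UNIV. \<Sum>\<delta>\<in>UNIV. D \<delta> \<epsilon> * j \<delta> k * j \<epsilon> i)))"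
        unfolding dw1 by (simp add: Hsym sum.distrib sum_distrib_right)
      also have "\<dots> = (\<Sum>i\<in>UNIV. j s i * (\<Sum>\<epsilon>\<in>UNIV. \<Sum>\<delta>\<in>UNIV. (D \<delta> \<epsilon> - D \<epsilon> \<delta>) * j \<delta> i * j \<epsilon> k))"
      proof -
        have "(\<Sum>\<epsilon>\<in>UNIV. \<Sum>\<delta>\<in>UNIV. D \<delta> \<epsilon> * j \<delta> k * j \<epsilon> i) = (\<Sum>\<epsilon>\<in>UNIV. \<Sum>\<delta>\<in>UNIV. D \<epsilon> \<delta> * j \<delta> i * j \<epsilon> k)" for i
          by (subst sum.swap) (simp add: mult_ac)
        then show ?thesis by (simp add: left_diff_distrib sum_subtractf)
      qed
      also have "\<dots> = (\<Sum>i\<in>UNIV. \<Sum>\<epsilon>\<in>UNIV. \<Sum>\<delta>\<in>UNIV. j s i * j \<delta> i * (D \<delta> \<epsilon> - D \<epsilon> \<delta>) * j \<epsilon> k)"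
        by (simp only: sum_distrib_left) (simp only: mult_ac)
      also have "\<dots> = (\<Sum>\<epsilon>\<in>UNIV. \<Sum>\<delta>\<in>UNIV. \<Sum>i\<in>UNIV. j s i * j \<delta> i * (D \<delta> \<epsilon> - D \<epsilon> \<delta>) * j \<epsilon> k)"
        by (subst sum.swap, rule sum.cong[OF HOL.refl], rule sum.swap)
      also have "\<dots> = (\<Sum>\<epsilon>\<in>UNIV. ?F \<epsilon> (T x) * j \<epsilon> k)"
        unfolding G_T D_def[symmetric] j_def[symmetric] by (simp only: sum_distrib_right)
      finally show ?thesis ..
    qed
    also have "\<dots> = (\<Sum>i\<in>UNIV. \<Sum>l\<in>UNIV. j s i * H a i l * H b k l - j s i * H b i l * H a k l)"
      unfolding dw2 by (simp add: sum_distrib_left algebra_simps)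
    also have "\<dots> = (\<Sum>l\<in>UNIV. (\<Sum>i\<in>UNIV. j s i * H a i l) * H b k l - (\<Sum>i\<in>UNIV. j s i * H b i l) * H a k l)"
      by (subst sum.swap) (simp add: sum_subtractf sum_distrib_right)
    also have "\<dots> = (\<Sum>l\<in>UNIV. wform s a l x * H b k l - wform s b l x * H a k l)"
      by (simp only: j_def H_def J_wform)
    also have "\<dots> = (\<Sum>l\<in>UNIV. \<Sum>r\<in>UNIV. Gam s a r (T x) * (j r l * H b k l) - Gam s b r (T x) * (j r l * H a k l))"
      unfolding wform_Gam j_def[symmetric] by (simp add: sum_distrib_right sum_subtractf mult.assoc)
    also have "\<dots> = (\<Sum>r\<in>UNIV. Gam s a r (T x) * (\<Sum>l\<in>UNIV. j r l * H b k l) - Gam s b r (T x) * (\<Sum>l\<in>UNIV. j r l * H a k l))"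
      by (subst sum.swap) (simp add: sum_subtractf sum_distrib_left)
    also have "\<dots> = (\<Sum>r\<in>UNIV. Gam s a r (T x) * wform r b k x - Gam s b r (T x) * wform r a k x)"
      unfolding wform_def j_def H_def ..
    also have "\<dots> = (\<Sum>r\<in>UNIV. \<Sum>\<epsilon>\<in>UNIV. (Gam s a r (T x) * Gam r b \<epsilon> (T x) - Gam s b r (T x) * Gam r a \<epsilon> (T x)) * j \<epsilon> k)"
      unfolding wform_Gam j_def[symmetric]
      by (simp add: sum_distrib_left left_diff_distrib sum_subtractf mult.assoc)
    also have "\<dots> = (\<Sum>\<epsilon>\<in>UNIV. ?H \<epsilon> (T x) * j \<epsilon> k)"
      by (subst sum.swap) (simp only: sum_distrib_right)
    finally show "(\<Sum>\<epsilon>\<in>UNIV. ?F \<epsilon> (T x) * dt k \<epsilon> x) = (\<Sum>\<epsilon>\<in>UNIV. ?H \<epsilon> (T x) * dt k \<epsilon> x)"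
      unfolding j_def .
  qed
qed

text \<open>Since \<open>G\<close> is linear in \<open>t\<^sup>1\<close> and the Christoffel symbols do not depend on it, this is the
  part of degree one in \<open>t\<^sup>1\<close> of the vanishing of the curvature.\<close>

lemma Gam_closed: "partial \<delta> (Gam a b \<epsilon>) y = partial \<epsilon> (Gam a b \<delta>) y"
proof -
  define R where "R \<delta> y = partial \<delta> (Gam a b \<epsilon>) y - partial \<epsilon> (Gam a b \<delta>) y" for \<delta> y
  have R: "is_poly (R \<delta>)" for \<delta>
    unfolding R_def[abs_def] by (intro is_poly_diff is_poly_partial is_poly_Gam)
  have "partial one (partial s (Gam a b r)) = (\<lambda>y. 0)" for s r
    by (subst partial_commute[OF is_poly_Gam]) (simp add: partial_one_Gam partial_const)
  then have dR: "partial one (R \<delta>) = (\<lambda>y. 0)" for \<delta>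
    unfolding R_def[abs_def] by (simp add: partial_diff is_poly_partial is_poly_Gam)
  have "R (star s) y = 0" for s
  proof -
    have "(\<lambda>y. \<Sum>\<delta>\<in>UNIV. G s \<delta> y * R \<delta> y) =
        (\<lambda>y. \<Sum>r\<in>UNIV. Gam s a r y * Gam r b \<epsilon> y - Gam s b r y * Gam r a \<epsilon> y)"
      unfolding R_def by (rule ext) (rule curvature)
    then have "partial one (\<lambda>y. \<Sum>\<delta>\<in>UNIV. G s \<delta> y * R \<delta> y) y =
        partial one (\<lambda>y. \<Sum>r\<in>UNIV. Gam s a r y * Gam r b \<epsilon> y - Gam s b r y * Gam r a \<epsilon> y) y"
      by simp
    moreover have "partial one (\<lambda>y. \<Sum>r\<in>UNIV. Gam s a r y * Gam r b \<epsilon> y - Gam s b r y * Gam r a \<epsilon> y) y = 0"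
      by (simp add: partial_sum partial_diff partial_mult is_poly_mult is_poly_diff is_poly_Gam partial_one_Gam)
    moreover have "partial one (\<lambda>y. \<Sum>\<delta>\<in>UNIV. G s \<delta> y * R \<delta> y) y = R (star s) y"
      by (simp add: partial_sum partial_mult is_poly_mult is_poly_G R dR partial_one_G
          if_distrib[of "\<lambda>c. c * _"] cong: if_cong)
    ultimately show ?thesis by simp
  qed
  from this[of "star \<delta>"] show ?thesis by (simp add: R_def)
qed

text \<open>Contract \<open>wform\<close> with the Euler field, for which each partial derivative of
  \<open>t b\<close> is an eigenfunction.\<close>

lemma Gam_euler: "(\<Sum>l\<in>UNIV. Gam a b l y * (of_nat (d l) * y $ l)) = (of_nat (d b) - 1) * G a b y"
proof (rule T_eqI[where F = "\<lambda>y. \<Sum>l\<in>UNIV. Gam a b l y * (of_nat (d l) * y $ l)"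
      and G = "\<lambda>y. (of_nat (d b) - 1) * G a b y"])
  show "is_poly (\<lambda>y. \<Sum>l\<in>UNIV. Gam a b l y * (of_nat (d l) * y $ l))"
    by (intro is_poly_sum is_poly_mult is_poly_Gam is_poly_const is_poly_coord)
  show "is_poly (\<lambda>y. (of_nat (d b) - 1) * G a b y)" by (intro is_poly_cmult is_poly_G)
  fix x
  have "(\<Sum>l\<in>UNIV. Gam a b l (T x) * (of_nat (d l) * T x $ l)) =
      (\<Sum>l\<in>UNIV. Gam a b l (T x) * (\<Sum>k\<in>UNIV. x $ k * dt k l x))"
    by (simp add: eulD[OF t_eul])
  also have "\<dots> = (\<Sum>k\<in>UNIV. x $ k * wform a b k x)"
    unfolding wform_Gam sum_distrib_left by (subst sum.swap) (simp add: mult_ac)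
  also have "\<dots> = (\<Sum>i\<in>UNIV. dt i a x * (\<Sum>k\<in>UNIV. x $ k * partial k (dt i b) x))"
    unfolding wform_def sum_distrib_left by (subst sum.swap) (simp add: mult_ac)
  also have "\<dots> = (of_nat (d b) - 1) * G a b (T x)"
    unfolding G_T by (simp add: eulD[OF eul_partial[OF t_eul]] sum_distrib_left mult_ac)
  finally show "(\<Sum>l\<in>UNIV. Gam a b l (T x) * (of_nat (d l) * T x $ l)) = (of_nat (d b) - 1) * G a b (T x)" .
qed

text \<open>Differentiate the Euler relation along \<open>t s\<close>. Closedness turns the
  resulting sum into the weight operator applied to \<open>Gam a b s\<close>, and metric
  compatibility supplies the transposed symbol.\<close>

lemma Gam_swap: "(of_nat (d a) - 1) * Gam a b s y = (of_nat (d b) - 1) * Gam b a s y"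
proof -
  have "(\<lambda>y. \<Sum>l\<in>UNIV. Gam a b l y * (of_nat (d l) * y $ l)) = (\<lambda>y. (of_nat (d b) - 1) * G a b y)"
    by (rule ext) (rule Gam_euler)
  then have "partial s (\<lambda>y. \<Sum>l\<in>UNIV. Gam a b l y * (of_nat (d l) * y $ l)) y =
      partial s (\<lambda>y. (of_nat (d b) - 1) * G a b y) y" by simp
  also have "\<dots> = (of_nat (d b) - 1) * (Gam a b s y + Gam b a s y)"
    by (simp add: partial_cmult is_poly_G partial_G)
  also have "partial s (\<lambda>y. \<Sum>l\<in>UNIV. Gam a b l y * (of_nat (d l) * y $ l)) y =
      (\<Sum>l\<in>UNIV. partial s (Gam a b l) y * (of_nat (d l) * y $ l) + (if s = l then Gam a b l y * of_nat (d l) else 0))"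
  proof -
    have "partial s (\<lambda>y. of_nat (d l) * y $ l) = (\<lambda>y. if s = l then of_nat (d l) else 0)" for l
      by (simp add: partial_cmult is_poly_coord partial_coord fun_eq_iff)
    moreover have "is_poly (\<lambda>y. Gam a b l y * (of_nat (d l) * y $ l))" for l
      by (intro is_poly_mult is_poly_Gam is_poly_const is_poly_coord)
    moreover have "is_poly (\<lambda>y. of_nat (d l) * y $ l)" for l
      by (intro is_poly_mult is_poly_const is_poly_coord)
    ultimately show ?thesis
      by (simp add: partial_sum partial_mult[OF is_poly_Gam] if_distrib[of "\<lambda>c. _ * c"] cong: if_cong)
  qed
  also have "\<dots> = (\<Sum>l\<in>UNIV. of_nat (d l) * y $ l * partial l (Gam a b s) y) + of_nat (d s) * Gam a b s y"
    by (simp add: sum.distrib Gam_closed[of s] mult_ac)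
  also have "(\<Sum>l\<in>UNIV. of_nat (d l) * y $ l * partial l (Gam a b s) y) =
      (of_nat (d a) + of_nat (d b) - 2 - of_nat (d s)) * Gam a b s y"
    using weul_Gam by (simp add: weul_def)
  finally show ?thesis by (simp add: algebra_simps)
qed

section \<open>Structure constants and their symmetries\<close>

definition c :: "'n \<Rightarrow> 'n \<Rightarrow> 'n \<Rightarrow> 'n cvec \<Rightarrow> complex" where
  "c a b r y = Gam a b r y / nu b"

lemma Gam_c: "Gam a b r y = nu b * c a b r y"
  using nu_nonzero by (simp add: c_def)

lemma c_sym: "c a b r y = c b a r y"
proof -
  have "nu a * Gam a b r y = nu b * Gam b a r y"
    using Gam_swap[of a b r y] by (simp add: nu_def)
  then show ?thesis using nu_nonzero[of a] nu_nonzero[of b] by (simp add: c_def field_simps)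
qed

lemma c_star: "c b r (star a) y = c a r (star b) y"
  by (simp add: c_def Gam_star[of b r a])

lemma G_c_sym: "(\<Sum>s\<in>UNIV. G a s y * c b r s y) = (\<Sum>s\<in>UNIV. G b s y * c a r s y)"
  using torsion_free[of a y b r] by (simp add: c_def flip: sum_divide_distrib)

text \<open>Torsion freeness with the indices rearranged by the symmetries of \<open>c\<close>, in
  the form that the recursion for \<open>xi\<close> needs.\<close>

lemma G_star_c_sym:
  "(\<Sum>s\<in>UNIV. G a s y * c (star s) b \<delta> y) = (\<Sum>s\<in>UNIV. G b s y * c (star s) a \<delta> y)"
proof -
  have "c (star s) b \<delta> y = c b (star \<delta>) s y" for s b
    using c_star[of "star s" b "star \<delta>" y] c_sym[of "star \<delta>" b] by simp
  then show ?thesis using G_c_sym[of a y b "star \<delta>"] by simp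
qed

text \<open>The diagonal entries for \<open>b\<close> and \<open>star b\<close> agree and
  \<open>nu b + nu (star b) = 1\<close>, so the weights average to one half.\<close>

lemma c_trace: "(\<Sum>b\<in>UNIV. nu b * c a b b y) = (\<Sum>b\<in>UNIV. c a b b y) / 2"
proof -
  have s: "c a (star b) (star b) y = c a b b y" for b
    using c_star[of "star b" a b y] c_sym[of "star b" a] c_sym[of b a] by simp
  have "(\<Sum>b\<in>UNIV. nu b * c a b b y) = (\<Sum>b\<in>UNIV. nu (star b) * c a b b y)"
    using sum_star[of "\<lambda>b. nu b * c a b b y"] by (simp add: s)
  moreover have "nu b * c a b b y + nu (star b) * c a b b y = c a b b y" for b
    using nu_star[of b] by (simp flip: distrib_right)
  then have "(\<Sum>b\<in>UNIV. nu b * c a b b y) + (\<Sum>b\<in>UNIV. nu (star b) * c a b b y) = (\<Sum>b\<in>UNIV. c a b b y)"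
    by (simp flip: sum.distrib)
  ultimately have "2 * (\<Sum>b\<in>UNIV. nu b * c a b b y) = (\<Sum>b\<in>UNIV. c a b b y)"
    by simp
  then show ?thesis by (simp add: field_simps)
qed

text \<open>The lower index of \<open>c\<close> is taken in the coordinates \<open>x\<close>, so
  that \<open>wform a b\<close> is \<open>nu b\<close> times a form symmetric in \<open>a\<close>
  and \<open>b\<close>.\<close>

definition C :: "'n \<Rightarrow> 'n \<Rightarrow> 'n \<Rightarrow> 'n cvec \<Rightarrow> complex" where
  "C k a b x = (\<Sum>r\<in>UNIV. c a b r (T x) * dt k r x)"

lemma wform_C: "wform a b k x = nu b * C k a b x"
  by (simp add: wform_Gam Gam_c C_def sum_distrib_left mult.assoc)

lemma C_sym: "C k a b x = C k b a x"
  by (simp add: C_def c_sym[of a])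

lemma G_star_C_sym:
  "(\<Sum>s\<in>UNIV. G a s (T x) * C k (star s) b x) = (\<Sum>s\<in>UNIV. G b s (T x) * C k (star s) a x)"
proof -
  have "(\<Sum>s\<in>UNIV. G a s (T x) * C k (star s) b x) =
      (\<Sum>\<delta>\<in>UNIV. (\<Sum>s\<in>UNIV. G a s (T x) * c (star s) b \<delta> (T x)) * dt k \<delta> x)" for a b
    unfolding C_def sum_distrib_left sum_distrib_right by (subst sum.swap) (simp add: mult.assoc)
  then show ?thesis by (simp only: G_star_c_sym[of a])
qed

end

section \<open>The logarithmic derivative of \<open>Delta\<close> and the dual structure
  constants\<close>

lemma det_replace_row:
  fixes A B :: "complex^'n^'n"
  assumes "B ** A = mat 1"
  shows "det (\<chi> i j. if i = b then v $ j else A $ i $ j) = (\<Sum>l\<in>UNIV. v $ l * B $ l $ b) * det A"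
proof -
  \<comment> \<open>The coordinates of \<open>v\<close> with respect to the rows of
    \<open>A\<close>.\<close>
  define y where "y = (\<chi> r. \<Sum>l\<in>UNIV. v $ l * B $ l $ r)"
  have BA: "(\<Sum>r\<in>UNIV. B $ l $ r * A $ r $ j) = (if l = j then 1 else 0)" for l j
    using arg_cong[OF assms, of "\<lambda>M. M $ l $ j"] by (simp add: matrix_matrix_mult_def mat_def)
  have "(\<Sum>r\<in>UNIV. y $ r *s row r A) $ j = v $ j" for j
  proof -
    have "(\<Sum>r\<in>UNIV. y $ r *s row r A) $ j = (\<Sum>r\<in>UNIV. \<Sum>l\<in>UNIV. v $ l * (B $ l $ r * A $ r $ j))"
      by (simp add: y_def row_def sum_distrib_right mult.assoc)
    also have "\<dots> = (\<Sum>l\<in>UNIV. v $ l * (\<Sum>r\<in>UNIV. B $ l $ r * A $ r $ j))"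
      by (subst sum.swap) (simp only: sum_distrib_left)
    finally show ?thesis by (simp add: BA if_distrib[of "\<lambda>c. _ * c"] cong: if_cong)
  qed
  then have "(\<Sum>r\<in>UNIV. y $ r *s row r A) = v" by (simp add: vec_eq_iff)
  then have "(\<chi> i. if i = b then (\<Sum>r\<in>UNIV. y $ r *s row r A) else row i A) =
      (\<chi> i j. if i = b then v $ j else A $ i $ j)"
    by (simp add: vec_eq_iff row_def)
  then show ?thesis
    using cramer_lemma_transpose[of b y A] by (simp add: y_def)
qed

lemma partial_det:
  fixes M :: "complex^'m \<Rightarrow> complex^'n^'n"
  assumes M: "\<And>i j. is_poly (\<lambda>x. M x $ i $ j)"
  shows "partial k (\<lambda>x. det (M x)) x =
    (\<Sum>b\<in>UNIV. det (\<chi> i j. if i = b then partial k (\<lambda>x. M x $ b $ j) x else M x $ i $ j))"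
proof -
  have pp: "partial k (\<lambda>x. of_int (sign p) * (\<Prod>i\<in>UNIV. M x $ i $ p i)) x =
      (\<Sum>b\<in>UNIV. of_int (sign p) * (\<Prod>i\<in>UNIV. if i = b then partial k (\<lambda>x. M x $ b $ p i) x else M x $ i $ p i))" for p
    using partial_prod[of UNIV "\<lambda>i x. M x $ i $ p i" k] M
    by (simp add: partial_cmult is_poly_prod sum_distrib_left cong: if_cong)
  have pf: "is_poly (\<lambda>x. of_int (sign p) * (\<Prod>i\<in>UNIV. M x $ i $ p i))" for p
    by (intro is_poly_cmult is_poly_prod M)
  show ?thesis
    unfolding det_def by (simp add: partial_sum pf pp) (rule sum.swap)
qed

lemma jacobi_formula:
  fixes M :: "complex^'m \<Rightarrow> complex^'n^'n"
  assumes "\<And>i j. is_poly (\<lambda>x. M x $ i $ j)" "B ** M x = mat 1"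
  shows "partial k (\<lambda>x. det (M x)) x = det (M x) * trace ((\<chi> i j. partial k (\<lambda>x. M x $ i $ j) x) ** B)"
proof -
  have "det (\<chi> i j. if i = b then partial k (\<lambda>x. M x $ b $ j) x else M x $ i $ j) =
      (\<Sum>l\<in>UNIV. partial k (\<lambda>x. M x $ b $ l) x * B $ l $ b) * det (M x)" for b
    using det_replace_row[OF assms(2), of b "\<chi> j. partial k (\<lambda>x. M x $ b $ j) x"]
    by (simp cong: if_cong)
  then show ?thesis
    by (simp only: partial_det[OF assms(1)] sum_distrib_right[symmetric] trace_def
        matrix_matrix_mult_def vec_lambda_beta mult.commute[of "det (M x)"])
qed

context saito_setup
begin

text \<open>As \<open>det J\<close> is a multiple of \<open>Delta\<close>, Jacobi's formula gives a
  trace. Differentiating \<open>J\<close> along the gradient of \<open>t a\<close> multiplies it by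
  the matrix \<open>nu b * c a b r\<close>, and \<open>c_trace\<close> produces the factor one
  half.\<close>

lemma gradient_log_Delta:
  assumes "Delta x \<noteq> 0"
  shows "(\<Sum>k\<in>UNIV. dt k a x * partial k Delta x) = Delta x * (\<Sum>b\<in>UNIV. c a b b (T x)) / 2"
proof -
  obtain k0 where k0: "k0 \<noteq> 0" "\<And>x. det (J x) = k0 * Delta x" using detJ_Delta by blast
  have "det (J x) \<noteq> 0" using assms by (simp add: detJ_nonzero_iff)
  then obtain B where B: "B ** J x = mat 1" "J x ** B = mat 1"
    using invertible_det_nz[of "J x"] unfolding invertible_def by blast
  define D where "D k = (\<chi> b j. partial k (dt j b) x)" for k
  define M where "M = (\<chi> b r. nu b * c a b r (T x))"
  have "(\<chi> b j. \<Sum>k\<in>UNIV. dt k a x * D k $ b $ j) = M ** J x"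
  proof -
    have "(\<Sum>k\<in>UNIV. dt k a x * D k $ b $ j) = (M ** J x) $ b $ j" for b j
    proof -
      have "(\<Sum>k\<in>UNIV. dt k a x * D k $ b $ j) = wform a b j x"
        by (simp add: D_def J_wform)
      also have "\<dots> = (M ** J x) $ b $ j"
        by (simp add: wform_C C_def M_def matrix_matrix_mult_def sum_distrib_left mult.assoc)
      finally show ?thesis .
    qed
    then show ?thesis by (simp add: vec_eq_iff)
  qed
  then have tr: "trace ((\<chi> b j. \<Sum>k\<in>UNIV. dt k a x * D k $ b $ j) ** B) = trace M"
    by (simp add: matrix_mul_assoc[symmetric] B)
  have "(\<Sum>k\<in>UNIV. dt k a x * trace (D k ** B)) =
      (\<Sum>k\<in>UNIV. \<Sum>b\<in>UNIV. \<Sum>j\<in>UNIV. dt k a x * D k $ b $ j * B $ j $ b)"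
    by (simp add: trace_def matrix_matrix_mult_def sum_distrib_left mult.assoc)
  also have "\<dots> = (\<Sum>b\<in>UNIV. \<Sum>j\<in>UNIV. \<Sum>k\<in>UNIV. dt k a x * D k $ b $ j * B $ j $ b)"
    by (subst sum.swap, rule sum.cong[OF HOL.refl], rule sum.swap)
  also have "\<dots> = trace ((\<chi> b j. \<Sum>k\<in>UNIV. dt k a x * D k $ b $ j) ** B)"
    by (simp add: trace_def matrix_matrix_mult_def sum_distrib_right)
  finally have s: "(\<Sum>k\<in>UNIV. dt k a x * trace (D k ** B)) = (\<Sum>b\<in>UNIV. c a b b (T x)) / 2"
    by (simp add: tr) (simp add: trace_def M_def c_trace)
  have "k0 * partial k Delta x = k0 * (Delta x * trace (D k ** B))" for k
  proof -
    have "partial k (\<lambda>x. det (J x)) x = det (J x) * trace ((\<chi> i j. partial k (\<lambda>x. J x $ i $ j) x) ** B)"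
      by (rule jacobi_formula) (simp_all add: is_poly_J B)
    then show ?thesis
      by (simp add: k0(2) partial_cmult is_poly_Delta D_def)
  qed
  then have "partial k Delta x = Delta x * trace (D k ** B)" for k using k0(1) by simp
  then have "(\<Sum>k\<in>UNIV. dt k a x * partial k Delta x) =
      Delta x * (\<Sum>k\<in>UNIV. dt k a x * trace (D k ** B))"
    by (simp add: sum_distrib_left mult_ac)
  then show ?thesis by (simp add: s)
qed

text \<open>The Hessian is conjugate by \<open>J\<close> to the matrix
  \<open>nu a * c b a r\<close>. Here the fixed index supplies the weight, whereas
  \<open>gradient_log_Delta\<close> averages the weights.\<close>

lemma laplacian_trace:
  assumes "Delta x \<noteq> 0"
  shows "(\<Sum>j\<in>UNIV. partial j (dt j a) x) = nu a * (\<Sum>b\<in>UNIV. c a b b (T x))"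
proof -
  have "det (J x) \<noteq> 0" using assms by (simp add: detJ_nonzero_iff)
  then obtain B where B: "B ** J x = mat 1" "J x ** B = mat 1"
    using invertible_det_nz[of "J x"] unfolding invertible_def by blast
  define H where "H = (\<chi> i j. partial j (dt i a) x)"
  define M where "M = (\<chi> b r. nu a * c b a r (T x))"
  have "(J x ** H) $ b $ j = (M ** J x) $ b $ j" for b j
  proof -
    have "(J x ** H) $ b $ j = wform b a j x"
      by (simp add: matrix_matrix_mult_def H_def wform_def)
    also have "\<dots> = (M ** J x) $ b $ j"
      by (simp add: wform_C C_def M_def matrix_matrix_mult_def sum_distrib_left mult.assoc)
    finally show ?thesis .
  qed
  then have "J x ** H = M ** J x" by (simp add: vec_eq_iff)
  then have "B ** (J x ** H) = B ** (M ** J x)" by simp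
  then have "H = B ** (M ** J x)" by (simp only: matrix_mul_assoc B matrix_mul_lid)
  then have "trace H = trace (B ** (M ** J x))" by (rule arg_cong)
  also have "\<dots> = trace ((M ** J x) ** B)" by (rule trace_mul_sym)
  also have "\<dots> = trace M" by (simp add: matrix_mul_assoc[symmetric] B)
  finally have "trace H = trace M" .
  moreover have "c b a b (T x) = c a b b (T x)" for b by (rule c_sym)
  ultimately show ?thesis
    by (simp add: trace_def H_def M_def sum_distrib_left)
qed

text \<open>Terms with vanishing denominator are 0 by convention; the tensor is used only where
  \<open>Delta\<close> is nonzero.\<close>

definition D :: "'n \<Rightarrow> 'n \<Rightarrow> 'n \<Rightarrow> 'n cvec \<Rightarrow> complex" where
  "D i k j x = (\<Sum>\<gamma>\<in>P. complex_of_real (\<gamma> $ i) * complex_of_real (\<gamma> $ k) * complex_of_real (\<gamma> $ j) / root_form \<gamma> x)"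

text \<open>The dual structure constants \<open>S / Delta\<close> have simple poles along the hyperplanes, with residue
  proportional to \<open>\<gamma> \<otimes> \<gamma> \<otimes> \<gamma>\<close> by symmetry. The trace, which is twice the logarithmic derivative
  of \<open>Delta\<close>, fixes the factor. The remaining difference is a polynomial of degree \<open>- 1\<close>.\<close>

lemma dual_structure_constants:
  assumes reg: "Delta x \<noteq> 0"
  shows "partial i (dt k b) x = nu b * (\<Sum>j\<in>UNIV. D i k j x * dt j b x)"
proof -
  obtain k0 where k0: "k0 \<noteq> 0" "\<And>x. det (J x) = k0 * Delta x" using detJ_Delta by blast
  \<comment> \<open>Dividing by \<open>nu b\<close> gives one linear system with matrix
    \<open>J\<close> for a tensor that does not depend on \<open>b\<close>; \<open>S\<close> is
    \<open>Delta\<close> times its solution by Cramer's rule.\<close>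
  define v where "v b i k x = partial i (dt k b) x / nu b" for b i k x
  define M where "M i k j x = (\<chi> b l. if l = j then (\<chi> b. v b i k x) $ b else J x $ b $ l)" for i k j x
  define S where "S i k j x = det (M i k j x) / k0" for i k j x
  have pv: "is_poly (v b i k)" for b i k
    unfolding v_def[abs_def] by (intro is_poly_divide is_poly_hess)
  have pM: "is_poly (\<lambda>x. M i k j x $ b $ l)" for i k j b l
    by (cases "l = j") (simp_all add: M_def pv is_poly_J)
  have pS: "is_poly (S i k j)" for i k j
    unfolding S_def[abs_def] by (intro is_poly_divide is_poly_det pM)
  have JS: "(\<Sum>j\<in>UNIV. dt j b x * S i k j x) = Delta x * v b i k x" for b i k x
  proof (rule is_poly_regular_eq[where f = "\<lambda>x. \<Sum>j\<in>UNIV. dt j b x * S i k j x"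
        and g = "\<lambda>x. Delta x * v b i k x"])
    show "is_poly (\<lambda>x. \<Sum>j\<in>UNIV. dt j b x * S i k j x)"
      by (intro is_poly_sum is_poly_mult is_poly_J pS)
    show "is_poly (\<lambda>x. Delta x * v b i k x)" by (intro is_poly_mult is_poly_Delta pv)
    fix x assume x: "Delta x \<noteq> 0"
    have "det (J x) \<noteq> 0" using x by (simp add: detJ_nonzero_iff)
    moreover have "(\<chi> j. S i k j x / Delta x) = (\<chi> j. det (M i k j x) / det (J x))"
      by (simp add: S_def k0(2))
    ultimately have "J x *v (\<chi> j. S i k j x / Delta x) = (\<chi> b. v b i k x)"
      using cramer[of "J x" "\<chi> j. S i k j x / Delta x" "\<chi> b. v b i k x"] unfolding M_def by blast
    from arg_cong[OF this, of "\<lambda>u. u $ b"]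
    have "(\<Sum>j\<in>UNIV. dt j b x * S i k j x) / Delta x = v b i k x"
      by (simp add: matrix_vector_mult_def sum_divide_distrib)
    then show "(\<Sum>j\<in>UNIV. dt j b x * S i k j x) = Delta x * v b i k x"
      using x by (simp add: field_simps)
  qed
  have vsym: "v b i k = v b k i" for b i k
    unfolding v_def[abs_def] by (subst partial_commute[OF t_poly]) (rule HOL.refl)
  have S1: "S i k j x = S k i j x" for i k j x
    unfolding S_def M_def vsym[of _ i k] ..
  have JJS: "(\<Sum>k\<in>UNIV. dt k a x * (\<Sum>j\<in>UNIV. dt j b x * S i k j x)) = Delta x * C i a b x"
    for a b i x
  proof -
    have "(\<Sum>k\<in>UNIV. dt k a x * (\<Sum>j\<in>UNIV. dt j b x * S i k j x)) =
        Delta x * (wform a b i x / nu b)"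
      unfolding JS wform_def v_def by (simp add: sum_distrib_left sum_divide_distrib mult_ac)
    then show ?thesis using nu_nonzero[of b] by (simp add: wform_C)
  qed
  \<comment> \<open>Contracting the last two indices with gradients gives \<open>Delta * C\<close>,
    which is symmetric in its upper indices.\<close>
  have S2: "S i k j x = S i j k x" for i k j x
  proof (rule is_poly_regular_eq[OF pS pS])
    fix x assume x: "Delta x \<noteq> 0"
    then have nz: "det (J x) \<noteq> 0" by (simp add: detJ_nonzero_iff)
    have 1: "(\<Sum>j\<in>UNIV. J x $ b $ j * S i k j x) = (\<Sum>j\<in>UNIV. J x $ b $ j * S i j k x)" for b k
    proof (rule column_cancel[OF nz])
      fix a
      have "(\<Sum>k\<in>UNIV. J x $ a $ k * (\<Sum>j\<in>UNIV. J x $ b $ j * S i k j x)) = Delta x * C i a b x"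
        using JJS by simp
      also have "\<dots> = Delta x * C i b a x" by (simp only: C_sym)
      also have "\<dots> = (\<Sum>j\<in>UNIV. J x $ b $ j * (\<Sum>k\<in>UNIV. J x $ a $ k * S i j k x))"
        using JJS by simp
      also have "\<dots> = (\<Sum>k\<in>UNIV. J x $ a $ k * (\<Sum>j\<in>UNIV. J x $ b $ j * S i j k x))"
        unfolding sum_distrib_left by (subst sum.swap) (simp add: mult_ac)
      finally show "(\<Sum>k\<in>UNIV. J x $ a $ k * (\<Sum>j\<in>UNIV. J x $ b $ j * S i k j x)) =
          (\<Sum>k\<in>UNIV. J x $ a $ k * (\<Sum>j\<in>UNIV. J x $ b $ j * S i j k x))" .
    qed
    show "S i k j x = S i j k x"
      by (rule column_cancel[OF nz, of "\<lambda>j. S i k j x" "\<lambda>j. S i j k x"]) (rule 1)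
  qed
  \<comment> \<open>By symmetry the trace is that of the Hessians, so \<open>laplacian_trace\<close>
    and \<open>gradient_log_Delta\<close> can be compared; this yields the factor 2.\<close>
  have Str: "(\<Sum>j\<in>UNIV. S k j j x) = 2 * partial k Delta x" for k x
  proof (rule is_poly_regular_eq[where f = "\<lambda>x. \<Sum>j\<in>UNIV. S k j j x" and g = "\<lambda>x. 2 * partial k Delta x"])
    show "is_poly (\<lambda>x. \<Sum>j\<in>UNIV. S k j j x)" by (intro is_poly_sum pS)
    show "is_poly (\<lambda>x. 2 * partial k Delta x)" by (intro is_poly_cmult is_poly_partial is_poly_Delta)
    fix x assume x: "Delta x \<noteq> 0"
    then have nz: "det (J x) \<noteq> 0" by (simp add: detJ_nonzero_iff)
    show "(\<Sum>j\<in>UNIV. S k j j x) = 2 * partial k Delta x"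
    proof (rule column_cancel[OF nz, of "\<lambda>k. \<Sum>j\<in>UNIV. S k j j x" "\<lambda>k. 2 * partial k Delta x"])
      fix a
      have "(\<Sum>k\<in>UNIV. J x $ a $ k * (\<Sum>j\<in>UNIV. S k j j x)) = (\<Sum>j\<in>UNIV. \<Sum>k\<in>UNIV. dt k a x * S j j k x)"
      proof -
        have "S k j j x = S j j k x" for k j using S1[of k j j x] S2[of j k j x] by simp
        then show ?thesis unfolding sum_distrib_left by (subst sum.swap) simp
      qed
      also have "\<dots> = Delta x * ((\<Sum>j\<in>UNIV. partial j (dt j a) x) / nu a)"
        by (simp only: JS v_def sum_distrib_left sum_divide_distrib)
      also have "\<dots> = Delta x * (\<Sum>b\<in>UNIV. c a b b (T x))"
        using nu_nonzero[of a] by (simp add: laplacian_trace[OF x])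
      also have "\<dots> = 2 * (\<Sum>k\<in>UNIV. dt k a x * partial k Delta x)"
        by (simp add: gradient_log_Delta[OF x])
      also have "\<dots> = (\<Sum>k\<in>UNIV. J x $ a $ k * (2 * partial k Delta x))"
        by (simp add: sum_distrib_left mult_ac)
      finally show "(\<Sum>k\<in>UNIV. J x $ a $ k * (\<Sum>j\<in>UNIV. S k j j x)) =
          (\<Sum>k\<in>UNIV. J x $ a $ k * (2 * partial k Delta x))" .
    qed
  qed
  define g where "g \<gamma> i = complex_of_real (\<gamma> $ i)" for \<gamma> :: "(real, 'n) vec" and i
  define R where "R \<gamma> x = (\<Prod>\<delta>\<in>P - {\<gamma>}. root_form \<delta> x)" for \<gamma> x
  \<comment> \<open>The expected value of \<open>S\<close>: \<open>Delta\<close> times the tensor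
    \<open>D\<close>, with the denominators cancelled.\<close>
  define E where "E i k j x = (\<Sum>\<gamma>\<in>P. g \<gamma> i * g \<gamma> k * g \<gamma> j * R \<gamma> x)" for i k j x
  define \<tau> where "\<tau> i k j x = S i k j x - E i k j x" for i k j x
  have pR: "is_poly (R \<gamma>)" for \<gamma>
    unfolding R_def[abs_def] by (intro is_poly_prod is_poly_root_form)
  have pE: "is_poly (E i k j)" for i k j
    unfolding E_def[abs_def] by (intro is_poly_sum is_poly_mult is_poly_const pR)
  have p\<tau>: "is_poly (\<tau> i k j)" for i k j
    unfolding \<tau>_def[abs_def] by (intro is_poly_diff pS pE)
  have gg: "(\<Sum>j\<in>UNIV. g \<gamma> j * g \<gamma> j) = 2" if "\<gamma> \<in> P" for \<gamma>
    using sum_root_square[OF P_root[OF that]] by (simp add: g_def)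
  have DR: "Delta x = root_form \<gamma> x * R \<gamma> x" if "\<gamma> \<in> P" for \<gamma> x
    unfolding Delta_def R_def by (rule prod.remove[OF finite_P that])
  have dDelta: "partial k Delta x = (\<Sum>\<gamma>\<in>P. g \<gamma> k * R \<gamma> x)" for k x
  proof -
    have "partial k Delta x = (\<Sum>\<gamma>\<in>P. \<Prod>\<delta>\<in>P. if \<delta> = \<gamma> then g \<delta> k else root_form \<delta> x)"
      unfolding Delta_def[abs_def]
      by (simp add: partial_prod finite_P is_poly_root_form partial_root_form g_def cong: if_cong)
    also have "\<dots> = (\<Sum>\<gamma>\<in>P. g \<gamma> k * R \<gamma> x)"
    proof (rule sum.cong[OF HOL.refl])
      fix \<gamma> assume "\<gamma> \<in> P"
      then show "(\<Prod>\<delta>\<in>P. if \<delta> = \<gamma> then g \<delta> k else root_form \<delta> x) = g \<gamma> k * R \<gamma> x"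
        unfolding R_def by (subst prod.remove[OF finite_P]) (auto intro!: prod.cong)
    qed
    finally show ?thesis .
  qed
  have \<tau>tr: "(\<Sum>j\<in>UNIV. \<tau> k j j x) = 0" for k x
  proof -
    have "(\<Sum>j\<in>UNIV. E k j j x) = (\<Sum>\<gamma>\<in>P. (g \<gamma> k * R \<gamma> x) * (\<Sum>j\<in>UNIV. g \<gamma> j * g \<gamma> j))"
      unfolding E_def sum_distrib_left by (subst sum.swap) (simp add: mult_ac)
    also have "\<dots> = 2 * partial k Delta x"
      by (simp add: gg dDelta sum_distrib_left mult.commute cong: sum.cong)
    finally show ?thesis by (simp add: \<tau>_def sum_subtractf Str)
  qed
  have \<tau>2: "\<tau> i k j x = \<tau> i j k x" for i k j x
    by (simp add: \<tau>_def E_def S2[of i k j] mult_ac)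
  have \<tau>0: "\<tau> i k j x = 0" if \<gamma>: "\<gamma> \<in> P" and x: "root_form \<gamma> x = 0" for \<gamma> x i k j
  proof (rule hyperplane_generic[OF \<gamma> p\<tau> _ x])
    fix x assume x: "root_form \<gamma> x = 0" "stab x = {mat 1, refl_matrix \<gamma>}"
    \<comment> \<open>\<open>S\<close> is annihilated since \<open>Delta\<close> vanishes. In
      \<open>E\<close> the term of \<open>\<gamma>\<close> is annihilated because \<open>J\<close>
      kills the root, and every other term contains the vanishing form of
      \<open>\<gamma>\<close>.\<close>
    have ker: "J x *v (\<chi> j. \<tau> i k j x) = 0" for i k
    proof -
      have "(\<Sum>j\<in>UNIV. dt j b x * \<tau> i k j x) = 0" for b
      proof -
        have "Delta x = 0" using DR[OF \<gamma>] x by simp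
        then have "(\<Sum>j\<in>UNIV. dt j b x * \<tau> i k j x) = - (\<Sum>j\<in>UNIV. dt j b x * E i k j x)"
          by (simp add: \<tau>_def right_diff_distrib sum_subtractf JS)
        also have "(\<Sum>j\<in>UNIV. dt j b x * E i k j x) =
            (\<Sum>\<delta>\<in>P. g \<delta> i * g \<delta> k * R \<delta> x * (\<Sum>j\<in>UNIV. g \<delta> j * dt j b x))"
          unfolding E_def sum_distrib_left by (subst sum.swap) (simp add: mult_ac)
        also have "\<dots> = 0"
        proof (intro sum.neutral ballI)
          fix \<delta> assume \<delta>: "\<delta> \<in> P"
          show "g \<delta> i * g \<delta> k * R \<delta> x * (\<Sum>j\<in>UNIV. g \<delta> j * dt j b x) = 0"
          proof (cases "\<delta> = \<gamma>")
            case True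
            then show ?thesis using equivariant_hyperplane[OF equivariant_J \<gamma> x(1)] by (simp add: g_def)
          next
            case False
            have "R \<delta> x = 0"
              unfolding R_def using False \<gamma> x finite_P by (intro prod_zero) auto
            then show ?thesis by simp
          qed
        qed
        finally show ?thesis by simp
      qed
      then show ?thesis by (simp add: vec_eq_iff matrix_vector_mult_def)
    qed
    define \<sigma> where "\<sigma> i k = root_form \<gamma> (\<chi> j. \<tau> i k j x) / 2" for i k
    have \<sigma>: "\<tau> i k j x = \<sigma> i k * g \<gamma> j" for i k j
    proof -
      have "(\<chi> j. \<tau> i k j x) = \<sigma> i k *s cplx \<gamma>"
        unfolding \<sigma>_def by (rule kernel_on_hyperplane[OF \<gamma> x(2) ker])
      from arg_cong[OF this, of "\<lambda>u. u $ j"] show ?thesis by (simp add: g_def)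
    qed
    \<comment> \<open>Symmetry in the last two indices moves the root factor to \<open>k\<close> and
      leaves the trace, which is 0.\<close>
    have "2 * \<sigma> i k = (\<Sum>j\<in>UNIV. g \<gamma> j * \<tau> i k j x)"
      unfolding \<sigma>_def root_form_def g_def by simp
    also have "\<dots> = g \<gamma> k * (\<Sum>j\<in>UNIV. \<tau> i j j x)"
      unfolding \<tau>2[of i k] unfolding \<sigma> by (simp add: sum_distrib_left mult_ac)
    finally have "\<sigma> i k = 0" by (simp add: \<tau>tr)
    then show "\<tau> i k j x = 0" by (simp add: \<sigma>)
  qed
  have "\<tau> i k j x = 0" for i k j x
  proof -
    have "\<exists>p. is_poly p \<and> (\<forall>x. \<tau> i k j x = Delta x * p x)"
      by (rule Delta_dvd[OF p\<tau>]) (rule \<tau>0)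
    then obtain p where p: "is_poly p" "\<And>x. \<tau> i k j x = Delta x * p x" by blast
    have "eul (of_nat (card P) - 1) (S i k j)"
    proof -
      \<comment> \<open>Column \<open>j\<close> holds second derivatives, one degree below the
        entries of \<open>J\<close>; \<open>sum_degrees\<close> turns the total into
        \<open>card P - 1\<close>.\<close>
      have "eul ((\<Sum>b\<in>UNIV. of_nat (d b) - 1) + (\<Sum>l\<in>UNIV. if l = j then - 1 else 0)) (\<lambda>x. det (M i k j x))"
      proof (rule eul_det)
        fix b l
        have "eul (of_nat (d b) - 1 - 1) (v b i k)"
          unfolding v_def[abs_def] by (intro eul_divide eul_partial t_eul)
        then show "eul (of_nat (d b) - 1 + (if l = j then - 1 else 0)) (\<lambda>x. M i k j x $ b $ l)"
          using eul_partial[OF t_eul] by (cases "l = j") (simp_all add: M_def)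
      qed
      from eul_divide[OF this, of k0] show ?thesis
        unfolding S_def[abs_def] by (simp add: sum_degrees)
    qed
    moreover have "eul (of_nat (card P) - 1) (E i k j)"
      unfolding E_def[abs_def]
    proof (intro eul_sum eul_cmult)
      fix \<gamma> assume \<gamma>: "\<gamma> \<in> P"
      then have "card P \<ge> 1" using finite_P card_gt_0_iff[of P] by (auto simp: Suc_le_eq)
      moreover have "eul (of_nat (card (P - {\<gamma>}))) (R \<gamma>)"
        unfolding R_def[abs_def] using eul_prod[of "P - {\<gamma>}" "\<lambda>_. 1" root_form] by (simp add: eul_root_form)
      ultimately show "eul (of_nat (card P) - 1) (R \<gamma>)"
        using \<gamma> finite_P by (simp add: of_nat_diff)
    qed
    ultimately have "eul (of_nat (card P) - 1) (\<lambda>x. Delta x * p x)"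
      unfolding p(2)[symmetric] \<tau>_def by (rule eul_diff)
    moreover have "eul (of_nat (card P)) Delta"
      unfolding Delta_def[abs_def] using eul_prod[of P "\<lambda>_. 1" root_form] by (simp add: eul_root_form)
    ultimately have "eul (of_nat (card P) - 1 - of_nat (card P)) p"
      using p(1) reg by (rule eul_quotient)
    moreover have "(of_nat (card P) - 1 - of_nat (card P) :: complex) \<notin> \<nat>"
    proof
      assume "(of_nat (card P) - 1 - of_nat (card P) :: complex) \<in> \<nat>"
      then obtain n where n: "(of_nat (card P) - 1 - of_nat (card P) :: complex) = of_nat n"
        by (rule Nats_cases)
      have "of_nat n = (- 1 :: complex)" using n[symmetric] by simp
      then have "(of_nat (n + 1) :: complex) = of_nat 0" by simp
      then show False by (simp only: of_nat_eq_iff)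
    qed
    ultimately have "p x = 0" by (rule eul_not_nat)
    then show ?thesis by (simp add: p)
  qed
  then have SE: "S i k j x = E i k j x" for i k j x by (simp add: \<tau>_def)
  define X where "X j = (\<Sum>\<gamma>\<in>P. g \<gamma> i * g \<gamma> k * g \<gamma> j / root_form \<gamma> x)" for j
  have EX: "E i k j x = Delta x * X j" for j
    unfolding E_def X_def sum_distrib_left
  proof (rule sum.cong[OF HOL.refl])
    fix \<gamma> assume \<gamma>: "\<gamma> \<in> P"
    then have "root_form \<gamma> x \<noteq> 0" using reg by (simp add: Delta_nonzero_iff)
    then show "g \<gamma> i * g \<gamma> k * g \<gamma> j * R \<gamma> x = Delta x * (g \<gamma> i * g \<gamma> k * g \<gamma> j / root_form \<gamma> x)"
      by (simp add: DR[OF \<gamma>])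
  qed
  have "Delta x * v b i k x = (\<Sum>j\<in>UNIV. dt j b x * (Delta x * X j))"
    by (simp only: JS[symmetric] SE EX)
  also have "\<dots> = Delta x * (\<Sum>j\<in>UNIV. X j * dt j b x)"
    by (simp add: sum_distrib_left mult_ac)
  finally have "v b i k x = (\<Sum>j\<in>UNIV. X j * dt j b x)" using reg by simp
  moreover have "partial i (dt k b) x = nu b * v b i k x"
    using nu_nonzero by (simp add: v_def)
  ultimately show ?thesis by (simp only: X_def g_def D_def)
qed

section \<open>The singular polynomials\<close>

lemma C_D:
  assumes "Delta x \<noteq> 0"
  shows "C k s a x = (\<Sum>i\<in>UNIV. dt i s x * (\<Sum>j\<in>UNIV. D k i j x * dt j a x))"
proof -
  have "partial k (dt i a) x = nu a * (\<Sum>j\<in>UNIV. D k i j x * dt j a x)" for i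
    by (rule dual_structure_constants[OF assms])
  then have "wform s a k x = nu a * (\<Sum>i\<in>UNIV. dt i s x * (\<Sum>j\<in>UNIV. D k i j x * dt j a x))"
    unfolding wform_def by (simp only: sum_distrib_left mult_ac)
  then show ?thesis using nu_nonzero[of a] by (simp add: wform_C)
qed

section \<open>The coefficient recursion\<close>

definition X :: "'n \<Rightarrow> nat \<Rightarrow> 'n \<Rightarrow> 'n cvec \<Rightarrow> complex" where
  "X b m a x = xi d t b m x $ a"

text \<open>The diagonal entry of the matrix inverted in \<open>A_matrix\<close>. With
  \<open>j = m\<close> it is also the factor in the differential system for the
  coefficients.\<close>

definition e :: "'n \<Rightarrow> nat \<Rightarrow> 'n \<Rightarrow> complex" where
  "e b j r = nu b + of_nat j - nu r"

text \<open>Vanishing would mean \<open>d r = d b + h * j\<close>, but \<open>d r\<close> is at most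
  \<open>h\<close> and \<open>d b\<close> is positive. Hence the inverses in \<open>A_matrix\<close>
  are genuine.\<close>

lemma e_nonzero:
  assumes "j \<ge> 1"
  shows "e b j r \<noteq> 0"
proof
  assume "e b j r = 0"
  then have "h * (nu b + of_nat j - nu r) = 0" by (simp add: e_def)
  moreover have "h * nu a = of_nat (d a) - 1" for a
    using h_nonzero by (simp add: nu_def)
  ultimately have "(of_nat (d b) - 1) + h * of_nat j - (of_nat (d r) - 1) = 0"
    by (simp only: right_diff_distrib distrib_left)
  then have "(of_nat (d b + coxeter_number d * j) :: complex) = of_nat (d r)"
    by (simp add: h_def algebra_simps)
  then have "d b + coxeter_number d * j = d r" by (simp only: of_nat_eq_iff)
  moreover have "coxeter_number d * 1 \<le> coxeter_number d * j" using assms by (rule mult_le_mono2)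
  ultimately show False using d_ge_2[of b] d_le_h[of r] by simp
qed

lemma A_matrix_nth:
  assumes "j \<ge> 1"
  shows "A_matrix d t b j x $ a $ r = G a (star r) (T x) / e b j r"
proof -
  define L where "L = Lambda_matrix d + mat ((of_nat (d b) - 1) / of_nat (coxeter_number d)) + mat (of_nat j)"
  define N where "N = (\<chi> a r. if a = r then 1 / e b j r else 0)"
  have L: "L = (\<chi> a r. if a = r then e b j r else 0)"
    by (simp add: L_def vec_eq_iff Lambda_matrix_def mat_def e_def nu_def h_def)
      (simp add: diff_divide_distrib)
  have "L ** N = mat 1" "N ** L = mat 1"
    using e_nonzero[OF assms]
    by (simp_all add: L N_def vec_eq_iff matrix_matrix_mult_def mat_def if_distrib[of "\<lambda>c. c * _"] cong: if_cong)
  then have "matrix_inv L = N" by (rule matrix_inv_eqI)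
  moreover have "metric_g t x $ a $ \<delta> = G a \<delta> (T x)" for a \<delta>
    by (simp add: metric_g_def G_T)
  then have "U_matrix t x $ a $ r = G a (star r) (T x)" for r
    by (simp add: U_matrix_def matrix_matrix_mult_def eta_star star_eq_iff[of r]
        if_distrib[of "\<lambda>c. _ * c"] cong: if_cong)
  ultimately show ?thesis
    by (simp add: A_matrix_def L_def[symmetric] matrix_matrix_mult_def N_def
        if_distrib[of "\<lambda>c. _ * c"] cong: if_cong)
qed

lemma X_0: "X b 0 a = (\<lambda>x. if a = b then 1 else 0)"
  by (rule ext) (simp add: X_def axis_def)

lemma X_Suc: "X b (Suc m) r = (\<lambda>x. (\<Sum>a\<in>UNIV. X b m a x * G a (star r) (T x)) / e b (Suc m) r)"
  by (rule ext)
    (simp add: X_def vector_matrix_mult_def A_matrix_nth sum_divide_distrib mult.commute del: of_nat_Suc)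

lemma eul_X: "eul (of_nat (d b) + h * of_nat m - of_nat (d a)) (X b m a)"
proof (induction m arbitrary: a)
  case 0
  show ?case
    by (cases "a = b") (simp_all add: X_0 eul_const eul_zero)
next
  case (Suc m)
  have "eul (of_nat (d b) + h * of_nat (Suc m) - of_nat (d a)) (\<lambda>x. X b m \<delta> x * G \<delta> (star a) (T x))" for \<delta>
  proof -
    have "eul (of_nat (d \<delta>) + of_nat (d (star a)) - 2) (\<lambda>x. G \<delta> (star a) (T x))"
      using weul_G weul_iff[OF is_poly_G] by blast
    from eul_mult[OF Suc.IH[of \<delta>] this]
    have "eul (of_nat (d b) + h * of_nat m + of_nat (d (star a)) - 2) (\<lambda>x. X b m \<delta> x * G \<delta> (star a) (T x))"
      by (simp add: algebra_simps)
    moreover have "of_nat (d (star a)) = h + 2 - of_nat (d a)"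
    proof -
      have "of_nat (d a + d (star a)) = h + 2" by (simp only: d_star) (simp add: h_def)
      then show ?thesis by (simp add: algebra_simps)
    qed
    ultimately show ?thesis by (simp add: algebra_simps)
  qed
  then show ?case unfolding X_Suc by (intro eul_divide eul_sum)
qed

lemma is_poly_X: "is_poly (X b m a)"
  by (rule eul_is_poly[OF eul_X])

lemma T_invariant: "w \<in> W \<Longrightarrow> T (capp w x) = T x"
  using t_invariant by (simp add: T_def vec_eq_iff invariant_iff)

lemma X_invariant: "w \<in> W \<Longrightarrow> X b m a (capp w x) = X b m a x"
  by (induction m arbitrary: a) (simp_all add: X_0 X_Suc T_invariant)

lemma partial_G_T: "partial k (\<lambda>x. G a b (T x)) x = (nu a + nu b) * C k a b x"
proof -
  have "partial k (\<lambda>x. G a b (T x)) x = wform a b k x + wform b a k x"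
    by (simp add: partial_T[OF is_poly_G] partial_G wform_Gam distrib_right sum.distrib)
  then show ?thesis by (simp add: wform_C C_sym[of k b a] algebra_simps)
qed

text \<open>Equivalently, \<open>\<Sum>\<^sub>\<alpha> \<xi>\<^sub>\<alpha> dt\<^sup>\<alpha>\<close> satisfies the equation of the gradient of a twisted period.\<close>

lemma X_system:
  "(\<Sum>a\<in>UNIV. G s a (T x) * partial k (X b m a) x) = (\<Sum>a\<in>UNIV. e b m a * X b m a x * C k s a x)"
proof (induction m arbitrary: s)
  case 0
  \<comment> \<open>The only nonzero coefficient of \<open>X b 0\<close> sits at
    \<open>a = b\<close>, where \<open>e b 0\<close> vanishes.\<close>
  have "e b 0 a * (if a = b then 1 else 0) * C k s a x = 0" for a by (simp add: e_def)
  then show ?case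
    by (simp only: X_0 partial_const) simp
next
  case (Suc m)
  have pG: "is_poly (\<lambda>x. G a b (T x))" for a b by (intro is_poly_T is_poly_G)
  have dX: "partial k (X b (Suc m) r) x = (\<Sum>a\<in>UNIV. X b m a x * C k a (star r) x)" for r
  proof -
    define f where "f a = X b m a x * C k a (star r) x" for a
    have "partial k (X b (Suc m) r) x = ((\<Sum>a\<in>UNIV. G (star r) a (T x) * partial k (X b m a) x) +
        (\<Sum>a\<in>UNIV. X b m a x * ((nu a + nu (star r)) * C k a (star r) x))) / e b (Suc m) r"
      unfolding X_Suc
      by (simp add: partial_divide partial_sum partial_mult is_poly_sum is_poly_mult is_poly_X pG
          partial_G_T sum.distrib G_sym[of "star r"] mult.commute)
    also have "(\<Sum>a\<in>UNIV. G (star r) a (T x) * partial k (X b m a) x) = (\<Sum>a\<in>UNIV. e b m a * f a)"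
      unfolding Suc.IH f_def by (simp only: C_sym[of k "star r"] mult.assoc)
    also have "(\<Sum>a\<in>UNIV. X b m a x * ((nu a + nu (star r)) * C k a (star r) x)) = (\<Sum>a\<in>UNIV. (nu a + nu (star r)) * f a)"
      unfolding f_def by (simp only: mult_ac)
    also have "(\<Sum>a\<in>UNIV. e b m a * f a) + (\<Sum>a\<in>UNIV. (nu a + nu (star r)) * f a) = (\<Sum>a\<in>UNIV. e b (Suc m) r * f a)"
    proof -
      \<comment> \<open>The dependence on \<open>a\<close> cancels, and what is left is the
        denominator in \<open>X_Suc\<close>.\<close>
      have "nu (star r) = 1 - nu r" using nu_star[of r] by (simp add: algebra_simps)
      then have "e b m a + (nu a + nu (star r)) = e b (Suc m) r" for a by (simp add: e_def)
      then show ?thesis by (simp only: sum.distrib[symmetric] distrib_right[symmetric])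
    qed
    finally show ?thesis
      using e_nonzero[of "Suc m" b r] by (simp add: f_def flip: sum_distrib_left)
  qed
  have "(\<Sum>r\<in>UNIV. G s r (T x) * partial k (X b (Suc m) r) x) =
      (\<Sum>r\<in>UNIV. \<Sum>a\<in>UNIV. X b m a x * (G s r (T x) * C k (star r) a x))"
    unfolding dX sum_distrib_left by (simp only: C_sym[of k _ "star _"] mult_ac)
  also have "\<dots> = (\<Sum>a\<in>UNIV. X b m a x * (\<Sum>r\<in>UNIV. G s r (T x) * C k (star r) a x))"
    by (subst sum.swap) (simp only: sum_distrib_left)
  \<comment> \<open>Exchanging \<open>s\<close> and \<open>a\<close> lets the sum over
    \<open>a\<close> reassemble \<open>X b (Suc m)\<close>.\<close>
  also have "\<dots> = (\<Sum>a\<in>UNIV. X b m a x * (\<Sum>r\<in>UNIV. G a r (T x) * C k (star r) s x))"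
    by (simp only: G_star_C_sym[of s])
  also have "\<dots> = (\<Sum>a\<in>UNIV. X b m a x * (\<Sum>r\<in>UNIV. G a (star r) (T x) * C k r s x))"
    using sum_star[of "\<lambda>r. G _ (star r) (T x) * C k r s x"] by simp
  also have "\<dots> = (\<Sum>r\<in>UNIV. (\<Sum>a\<in>UNIV. X b m a x * G a (star r) (T x)) * C k s r x)"
    unfolding sum_distrib_left sum_distrib_right
    by (subst sum.swap) (simp only: C_sym[of k s] mult.assoc)
  also have "\<dots> = (\<Sum>r\<in>UNIV. e b (Suc m) r * X b (Suc m) r x * C k s r x)"
    using e_nonzero[of "Suc m" b] by (simp add: X_Suc)
  finally show ?case .
qed

section \<open>Singularity and degree\<close>

lemma q_poly_X: "q_poly d t m b i = (\<lambda>x. \<Sum>a\<in>UNIV. X b m a x * dt i a x)"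
  by (rule ext) (simp add: q_poly_def X_def)

lemma is_poly_q: "is_poly (q_poly d t m b i)"
  unfolding q_poly_X by (intro is_poly_sum is_poly_mult is_poly_X is_poly_J)

lemma equivariant_q: "equivariant (q_poly d t m b)"
  unfolding equivariant_def
proof (intro ballI allI)
  fix w x k assume w: "w \<in> W"
  have "(\<Sum>i\<in>UNIV. q_poly d t m b i (capp w x) * complex_of_real (w $ i $ k)) =
      (\<Sum>i\<in>UNIV. \<Sum>a\<in>UNIV. X b m a x * (dt i a (capp w x) * complex_of_real (w $ i $ k)))"
    by (simp add: q_poly_X X_invariant[OF w] sum_distrib_right mult.assoc)
  also have "\<dots> = (\<Sum>a\<in>UNIV. X b m a x * (\<Sum>i\<in>UNIV. dt i a (capp w x) * complex_of_real (w $ i $ k)))"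
    by (subst sum.swap) (simp only: sum_distrib_left)
  also have "\<dots> = q_poly d t m b k x"
    using equivariant_J w unfolding equivariant_def by (simp add: q_poly_X)
  finally show "(\<Sum>i\<in>UNIV. q_poly d t m b i (capp w x) * complex_of_real (w $ i $ k)) = q_poly d t m b k x" .
qed

text \<open>After contraction with the gradient of \<open>t s\<close>, both terms of the product
  rule become combinations of \<open>X b m a * C k s a\<close>, with factors \<open>nu a\<close> and
  \<open>e b m a\<close> that add up to the parameter.\<close>

lemma partial_q:
  assumes reg: "Delta x \<noteq> 0"
  shows "partial k (q_poly d t m b i) x = (nu b + of_nat m) * (\<Sum>j\<in>UNIV. D k i j x * q_poly d t m b j x)"
proof -
  have nz: "det (J x) \<noteq> 0" using reg by (simp add: detJ_nonzero_iff)
  have dq: "partial k (q_poly d t m b i) x =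
      (\<Sum>a\<in>UNIV. X b m a x * partial k (dt i a) x + partial k (X b m a) x * dt i a x)" for i
    unfolding q_poly_X by (simp add: partial_sum partial_mult is_poly_mult is_poly_X is_poly_J add.commute)
  have "partial k (q_poly d t m b i) x = (\<Sum>j\<in>UNIV. (nu b + of_nat m) * (D k i j x * q_poly d t m b j x))" for i
  proof (rule column_cancel[OF nz, of "\<lambda>i. partial k (q_poly d t m b i) x"
        "\<lambda>i. \<Sum>j\<in>UNIV. (nu b + of_nat m) * (D k i j x * q_poly d t m b j x)"])
    fix s
    have "(\<Sum>i\<in>UNIV. J x $ s $ i * partial k (q_poly d t m b i) x) =
        (\<Sum>i\<in>UNIV. \<Sum>a\<in>UNIV. X b m a x * (dt i s x * partial k (dt i a) x) +
          dt i s x * dt i a x * partial k (X b m a) x)"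
      unfolding dq sum_distrib_left J_nth by (simp only: distrib_left mult_ac)
    also have "\<dots> = (\<Sum>a\<in>UNIV. X b m a x * wform s a k x + G s a (T x) * partial k (X b m a) x)"
      by (subst sum.swap) (simp add: wform_def G_T sum.distrib sum_distrib_left sum_distrib_right)
    also have "\<dots> = (\<Sum>a\<in>UNIV. X b m a x * wform s a k x + e b m a * X b m a x * C k s a x)"
      by (simp add: sum.distrib X_system)
    also have "\<dots> = (\<Sum>a\<in>UNIV. (nu b + of_nat m) * X b m a x * C k s a x)"
      by (intro sum.cong) (simp_all add: wform_C e_def algebra_simps)
    also have "\<dots> = (\<Sum>a\<in>UNIV. \<Sum>i\<in>UNIV. \<Sum>j\<in>UNIV. dt i s x * ((nu b + of_nat m) * (D k i j x * (X b m a x * dt j a x))))"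
      unfolding C_D[OF reg] sum_distrib_left by (simp only: mult_ac)
    also have "\<dots> = (\<Sum>i\<in>UNIV. \<Sum>j\<in>UNIV. \<Sum>a\<in>UNIV. dt i s x * ((nu b + of_nat m) * (D k i j x * (X b m a x * dt j a x))))"
      by (subst sum.swap, rule sum.cong[OF HOL.refl], rule sum.swap)
    also have "\<dots> = (\<Sum>i\<in>UNIV. J x $ s $ i * (\<Sum>j\<in>UNIV. (nu b + of_nat m) * (D k i j x * q_poly d t m b j x)))"
      unfolding J_nth q_poly_X by (simp only: sum_distrib_left)
    finally show "(\<Sum>i\<in>UNIV. J x $ s $ i * partial k (q_poly d t m b i) x) =
        (\<Sum>i\<in>UNIV. J x $ s $ i * (\<Sum>j\<in>UNIV. (nu b + of_nat m) * (D k i j x * q_poly d t m b j x)))" .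
  qed
  then show ?thesis by (simp add: sum_distrib_left)
qed

text \<open>Off the mirrors equivariance evaluates each divided difference as a quotient, and their
  weighted sum is the contraction of \<open>D\<close> with \<open>q_poly\<close> from
  \<open>partial_q\<close>. The other points follow because the left side is a polynomial.\<close>

lemma dunkl_q: "dunkl P (nu b + of_nat m) k (q_poly d t m b i) x = 0"
proof -
  define c' where "c' = nu b + of_nat m"
  let ?q = "q_poly d t m b"
  have pdd: "is_poly (divided_difference \<gamma> (?q i))" if "\<gamma> \<in> P" for \<gamma>
    by (rule divided_difference(1)[OF P_root[OF that] is_poly_q])
  have "dunkl P c' k (?q i) x = 0"
  proof (rule is_poly_regular_eq[where f = "dunkl P c' k (?q i)" and g = "\<lambda>_. 0"])
    show "is_poly (dunkl P c' k (?q i))"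
      unfolding dunkl_def[abs_def]
      by (intro is_poly_diff is_poly_partial is_poly_q is_poly_mult is_poly_sum is_poly_const pdd)
    show "is_poly (\<lambda>_. 0)" by (rule is_poly_zero)
    fix x assume reg: "Delta x \<noteq> 0"
    have dd: "divided_difference \<gamma> (?q i) x =
        complex_of_real (\<gamma> $ i) * (\<Sum>j\<in>UNIV. complex_of_real (\<gamma> $ j) * ?q j x) / root_form \<gamma> x" if \<gamma>: "\<gamma> \<in> P" for \<gamma>
    proof -
      have "root_form \<gamma> x * divided_difference \<gamma> (?q i) x = ?q i x - ?q i (capp (refl_matrix \<gamma>) x)"
        using divided_difference(2)[OF P_root[OF \<gamma>] is_poly_q]
        by (simp add: act_capp matrix_inv_refl_matrix[OF P_root[OF \<gamma>]])
      also have "\<dots> = complex_of_real (\<gamma> $ i) * (\<Sum>j\<in>UNIV. complex_of_real (\<gamma> $ j) * ?q j x)"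
        by (simp only: equivariant_refl[OF equivariant_q \<gamma>]) simp
      finally show ?thesis
        using reg \<gamma> by (simp add: Delta_nonzero_iff nonzero_eq_divide_eq mult.commute)
    qed
    have "(\<Sum>\<gamma>\<in>P. complex_of_real (\<gamma> $ k) * divided_difference \<gamma> (?q i) x) =
        (\<Sum>\<gamma>\<in>P. \<Sum>j\<in>UNIV. complex_of_real (\<gamma> $ k) * complex_of_real (\<gamma> $ i) * complex_of_real (\<gamma> $ j) / root_form \<gamma> x * ?q j x)"
      by (intro sum.cong) (simp_all add: dd sum_distrib_left sum_divide_distrib mult_ac)
    also have "\<dots> = (\<Sum>j\<in>UNIV. D k i j x * ?q j x)"
      unfolding D_def sum_distrib_right by (rule sum.swap)
    finally show "dunkl P c' k (?q i) x = 0"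
      unfolding dunkl_def partial_q[OF reg] c'_def by simp
  qed
  then show ?thesis by (simp only: c'_def)
qed

lemma homogeneous_q: "homogeneous (d b - 1 + coxeter_number d * m) (q_poly d t m b i)"
proof (rule homogeneous_eul)
  have "eul (of_nat (d b) + h * of_nat m - of_nat (d a) + (of_nat (d a) - 1))
      (\<lambda>x. X b m a x * dt i a x)" for a
    by (intro eul_mult eul_X eul_partial t_eul)
  then have "eul (of_nat (d b) + h * of_nat m - 1) (\<lambda>x. X b m a x * dt i a x)" for a
    by (simp add: algebra_simps)
  \<comment> \<open>The truncated subtraction is exact because \<open>2 \<le> d b\<close>.\<close>
  moreover have "of_nat (d b - 1 + coxeter_number d * m) = of_nat (d b) + h * of_nat m - 1"
    using d_ge_2[of b] by (simp add: of_nat_diff h_def)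
  ultimately show "eul (of_nat (d b - 1 + coxeter_number d * m)) (q_poly d t m b i)"
    unfolding q_poly_X by (simp only:) (intro eul_sum)
qed

end

theorem theorem16:
  fixes W :: "'n::{finite,linorder} rmat set"
    and P :: "(real, 'n) vec set"
    and d :: "'n \<Rightarrow> nat"
    and t :: "'n \<Rightarrow> 'n cvec \<Rightarrow> complex"
    and \<beta> i :: 'n
    and m :: nat
  assumes "irreducible_coxeter_group W"
    and "positive_system W P"
    and "saito_polynomials W d t"
  shows "singular_poly P ((of_nat (d \<beta>) - 1) / of_nat (coxeter_number d) + of_nat m)
           (q_poly d t m \<beta> i) \<and>
         homogeneous (d \<beta> - 1 + coxeter_number d * m) (q_poly d t m \<beta> i)"
proof -
  interpret saito_setup W P d t
    using assms by unfold_locales (auto simp: irreducible_coxeter_group_def saito_polynomials_def)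
  show ?thesis
    using dunkl_q[of \<beta> m _ i] homogeneous_q is_poly_q unfolding singular_poly_def nu_def h_def by blast
qed

end
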